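(* Let $X$ be a finite, connected CW complex and let $\mathfrak{h}$ be a combinatorial basis for $H_*(X;\mathbb{R})$. Then $$\tau^2(X;\mathfrak{h})=\prod_{k\ge 0}\Bigl(\delta_k\sum_{T\in\mathcal{T}_{k+1}}\theta_T^2\Bigr)^{(-1)^k},$$ where, for $T\in\mathcal{T}_{k+1}$, $\theta_T$ denotes the order of the torsion subgroup of $H_k(T;\mathbb{Z})$.
   Context: Notation. $X_k$ is the set of $k$-cells of $X$, $X^{(k)}$ its $k$-skeleton, $C_k(X;A)$ the cellular chain group (free $A$-module on $X_k$), $\partial$ the cellular boundary, $Z_k(X;A)$, $B_k(X;A)$ the cycles and boundaries; all homology is cellular, $\beta_k$ is the $k$-th Betti number. The standard inner product on $C_k(X;\mathbb{R})$ is the one for which $X_k$ is an orthonormal basis. Combinatorial basis. $H_k(X;\mathbb{Z})_0$ is the image of $H_k(X;\mathbb{Z})\to H_k(X;\mathbb{R})$, a lattice in $H_k(X;\mathbb{R})$. A combinatorial basis $\mathfrak{h}=\{\mathfrak{h}_k\}$ consists of a $\mathbb{Z}$-basis $\mathfrak{h}_k$ of $H_k(X;\mathbb{Z})_0$ for each $k\ge0$. Reidemeister torsion. Write $C_k,Z_k,B_k,H_k$ for the real chains, cycles, boundaries and homology. Choose splittings $s_{k-1}\colon B_{k-1}\to C_k$ of $\partial\colon C_k\to B_{k-1}$ and $t_k\colon H_k\to Z_k$ of $Z_k\to H_k$, and a basis $\mathfrak{b}_k$ of each $B_k$. Then $\mathfrak{b}_k$, $t_k(\mathfrak{h}_k)$,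 $s_{k-1}(\mathfrak{b}_{k-1})$ together form a basis of $C_k$; let $[\mathfrak{b}_k\mathfrak{h}_k\mathfrak{b}_{k-1}/\mathfrak{c}_k]$ be the matrix expressing it in the basis $\mathfrak{c}_k$ of $C_k$ given by the set of $k$-cells. The torsion is $$\tau(X;\mathfrak{h})=\prod_{k\ge0}\det[\mathfrak{b}_k\mathfrak{h}_k\mathfrak{b}_{k-1}/\mathfrak{c}_k]^{(-1)^k};$$ it is independent of the choice of the $\mathfrak{b}_k$ and of the splittings (and its square does not depend on orderings of the bases). $\tau^2(X;\mathfrak{h})$ is its square. Spanning trees. For $k>0$, $\mathcal{T}_k$ is the set of spanning trees of $X^{(k)}$, i.e. subcomplexes $T\subset X^{(k)}$ with $H_k(T;\mathbb{Z})=0$, $\beta_{k-1}(T)=\beta_{k-1}(X^{(k)})$ and $X^{(k-1)}\subset T$. (So if $X$ has no $k$-cells, the only element of $\mathcal{T}_k$ is $X^{(k)}$ itself.) Constants. $\mu_k$ is the square of the covolume of the lattice $B_k(X;\mathbb{Z})\subset B_k(X;\mathbb{R})$ with respect to the restriction of the standard inner product on $C_k(X;\mathbb{R})$. $\eta_k$ is the square of the covolume of the lattice $H_k(X;\mathbb{Z})_0\subset H_k(X;\mathbb{R})$, where $H_k(X;\mathbb{R})$ is given the inner product obtained by identifying it with the orthogonal complement of $B_k(X;\mathbb{R})$ in $Z_k(X;\mathbb{R})$ with respect to the standard inner product on $C_k(X;\mathbb{R})$. (The covolume of the zero lattice in the zero space is $1$.) $\theta_k$ is the order of the torsion subgroup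 of $H_k(X;\mathbb{Z})$. Finally $\delta_k=\eta_k\mu_k/\theta_k^2$. *)

theory Defs
  imports
    "HOL-Analysis.Analysis"
    "HOL-Homology.Homology"
    "Jordan_Normal_Form.Determinant"
begin

no_notation vec_index (infixl \<open>$\<close> 100)

definition additive_group :: "'v::ab_group_add set \<Rightarrow> 'v monoid" where
  "additive_group A = \<lparr>carrier = A, monoid.mult = (+), one = 0\<rparr>"

definition Z_combination :: "('g, 'm) monoid_scheme \<Rightarrow> 'g list \<Rightarrow> (nat \<Rightarrow> int) \<Rightarrow> 'g" where
  "Z_combination G xs m = finprod G (\<lambda>i. (xs ! i) [^]\<^bsub>G\<^esub> m i) {..<length xs}"

definition Z_independent :: "('g, 'm) monoid_scheme \<Rightarrow> 'g list \<Rightarrow> bool" where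
  "Z_independent G xs \<longleftrightarrow> set xs \<subseteq> carrier G \<and>
     (\<forall>m. Z_combination G xs m = \<one>\<^bsub>G\<^esub> \<longrightarrow> (\<forall>i<length xs. m i = 0))"

definition Z_basis :: "('g, 'm) monoid_scheme \<Rightarrow> 'g list \<Rightarrow> bool" where
  "Z_basis G xs \<longleftrightarrow> Z_independent G xs \<and> (\<forall>x\<in>carrier G. \<exists>m. x = Z_combination G xs m)"

definition Z_rank :: "('g, 'm) monoid_scheme \<Rightarrow> nat" where
  "Z_rank G = (GREATEST n. \<exists>xs. length xs = n \<and> Z_independent G xs)"

definition torsion_subgroup :: "('g, 'm) monoid_scheme \<Rightarrow> 'g set" where
  "torsion_subgroup G = {x \<in> carrier G. \<exists>n>0. x [^]\<^bsub>G\<^esub> (n::nat) = \<one>\<^bsub>G\<^esub>}"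

text \<open>The covolume of a lattice \<open>L\<close> in the Euclidean space spanned by \<open>L\<close>: the square root of the
  Gram determinant of any \<open>\<int>\<close>-basis of \<open>L\<close>. It is \<open>1\<close> for the zero lattice, whose basis is the
  empty list.\<close>

definition covolume :: "'v::euclidean_space set \<Rightarrow> real" where
  "covolume L = (THE v. \<exists>bs. Z_basis (additive_group L) bs \<and>
     v = sqrt (Determinant.det
           (Matrix.mat (length bs) (length bs) (\<lambda>(i, j). inner (bs ! i) (bs ! j)))))"

definition unit_sphere :: "nat \<Rightarrow> (nat \<Rightarrow> real) set" where
  "unit_sphere n = {x \<in> topspace (Euclidean_space n). (\<Sum>i<n. (x i)\<^sup>2) = 1}"

definition open_disk :: "nat \<Rightarrow> (nat \<Rightarrow> real) set" where
  "open_disk n = {x \<in> topspace (Euclidean_space n). (\<Sum>i<n. (x i)\<^sup>2) < 1}"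

definition disk :: "nat \<Rightarrow> (nat \<Rightarrow> real) topology" where
  "disk n = subtopology (Euclidean_space n) {x. (\<Sum>i<n. (x i)\<^sup>2) \<le> 1}"

text \<open>The cells are indexed by a set of elements of \<open>'c\<close>; each has a dimension and a characteristic
  map defined on the closed disk of that dimension.\<close>

record ('a, 'c) cell_complex =
  underlying :: "'a topology"
  cells :: "'c set"
  cell_dim :: "'c \<Rightarrow> nat"
  char_map :: "'c \<Rightarrow> (nat \<Rightarrow> real) \<Rightarrow> 'a"

definition cells_of_dim :: "('a, 'c) cell_complex \<Rightarrow> nat \<Rightarrow> 'c set" where
  "cells_of_dim X k = {c \<in> cells X. cell_dim X c = k}"

definition open_cell :: "('a, 'c) cell_complex \<Rightarrow> 'c \<Rightarrow> 'a set" where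
  "open_cell X c = char_map X c ` open_disk (cell_dim X c)"

definition finite_CW_complex :: "('a, 'c) cell_complex \<Rightarrow> bool" where
  "finite_CW_complex X \<longleftrightarrow>
     finite (cells X) \<and>
     Hausdorff_space (underlying X) \<and>
     (\<forall>c\<in>cells X. continuous_map (disk (cell_dim X c)) (underlying X) (char_map X c)) \<and>
     (\<forall>c\<in>cells X. homeomorphic_map
        (subtopology (disk (cell_dim X c)) (open_disk (cell_dim X c)))
        (subtopology (underlying X) (open_cell X c)) (char_map X c)) \<and>
     disjoint_family_on (open_cell X) (cells X) \<and>
     (\<Union>c\<in>cells X. open_cell X c) = topspace (underlying X) \<and>
     (\<forall>c\<in>cells X. char_map X c ` unit_sphere (cell_dim X c)
        \<subseteq> (\<Union>d\<in>{d \<in> cells X. cell_dim X d < cell_dim X c}. open_cell X d)) \<and>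
     (\<forall>A \<subseteq> topspace (underlying X).
        (\<forall>c\<in>cells X. closedin (underlying X) (A \<inter> underlying X closure_of open_cell X c))
          \<longrightarrow> closedin (underlying X) A)"

definition restrict_cells :: "('a, 'c) cell_complex \<Rightarrow> 'c set \<Rightarrow> ('a, 'c) cell_complex" where
  "restrict_cells X S =
     X\<lparr>underlying := subtopology (underlying X) (\<Union>c\<in>S. open_cell X c), cells := S\<rparr>"

definition subcomplexes :: "('a, 'c) cell_complex \<Rightarrow> ('a, 'c) cell_complex set" where
  "subcomplexes X = {restrict_cells X S |S. S \<subseteq> cells X \<and>
     (\<forall>c\<in>S. underlying X closure_of open_cell X c \<subseteq> (\<Union>d\<in>S. open_cell X d))}"

definition skeleton :: "('a, 'c) cell_complex \<Rightarrow> nat \<Rightarrow> ('a, 'c) cell_complex" where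
  "skeleton X k = restrict_cells X {c \<in> cells X. cell_dim X c \<le> k}"

text \<open>The underlying set of the \<open>k\<close>-skeleton, for integer \<open>k\<close> so that it is empty for \<open>k < 0\<close>.\<close>

definition skeleton_set :: "('a, 'c) cell_complex \<Rightarrow> int \<Rightarrow> 'a set" where
  "skeleton_set X k = (\<Union>c\<in>{c \<in> cells X. int (cell_dim X c) \<le> k}. open_cell X c)"

definition skeleton_top :: "('a, 'c) cell_complex \<Rightarrow> int \<Rightarrow> 'a topology" where
  "skeleton_top X k = subtopology (underlying X) (skeleton_set X k)"

text \<open>An orientation of the \<open>n\<close>-disk, i.e. a generator of the infinite cyclic group
  \<open>H\<^sub>n(D\<^sup>n, S\<^bsup>n-1\<^esup>)\<close>. Its image under the characteristic map of an \<open>n\<close>-cell is the basis element of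
  \<open>H\<^sub>n(X\<^bsup>(n)\<^esup>, X\<^bsup>(n-1)\<^esup>)\<close> given by that cell.\<close>

definition disk_generator :: "nat \<Rightarrow> (nat \<Rightarrow> real) chain set" where
  "disk_generator n =
     (SOME g. g \<in> carrier (relative_homology_group (int n) (disk n) (unit_sphere n)) \<and>
        subgroup_generated (relative_homology_group (int n) (disk n) (unit_sphere n)) {g}
          = relative_homology_group (int n) (disk n) (unit_sphere n))"

definition cell_class :: "('a, 'c) cell_complex \<Rightarrow> 'c \<Rightarrow> 'a chain set" where
  "cell_class X c = (let n = cell_dim X c in
     hom_induced (int n) (disk n) (unit_sphere n)
       (skeleton_top X (int n)) (skeleton_set X (int n - 1)) (char_map X c) (disk_generator n))"

text \<open>The incidence numbers \<open>[c : d]\<close> are the coefficients of the image of (the class of) the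
  \<open>n\<close>-cell \<open>c\<close> under
  \<open>H\<^sub>n(X\<^bsup>(n)\<^esup>, X\<^bsup>(n-1)\<^esup>) \<rightarrow> H\<^bsub>n-1\<^esub>(X\<^bsup>(n-1)\<^esup>) \<rightarrow> H\<^bsub>n-1\<^esub>(X\<^bsup>(n-1)\<^esup>, X\<^bsup>(n-2)\<^esup>)\<close>
  in the basis of the target given by the \<open>(n-1)\<close>-cells. They are only used for \<open>n > 0\<close>.\<close>

definition incidence :: "('a, 'c) cell_complex \<Rightarrow> 'c \<Rightarrow> 'c \<Rightarrow> int" where
  "incidence X c = (let n = cell_dim X c;
       G = relative_homology_group (int n - 1) (skeleton_top X (int n - 1)) (skeleton_set X (int n - 2))
     in THE m. (\<forall>d. d \<notin> cells_of_dim X (n - 1) \<longrightarrow> m d = 0) \<and>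
          hom_relboundary (int n) (skeleton_top X (int n))
            (skeleton_set X (int n - 1)) (skeleton_set X (int n - 2)) (cell_class X c)
          = finprod G (\<lambda>d. cell_class X d [^]\<^bsub>G\<^esub> m d) (cells_of_dim X (n - 1)))"

text \<open>Chains of all degrees live in the one module \<open>'r ^ 'c\<close>; \<open>C\<^sub>k(X; 'r)\<close> consists of the vectors
  supported on the \<open>k\<close>-cells. For \<open>'r = real\<close> the library's inner product is the one for which the
  cells are orthonormal. The coefficient ring is determined by the type.\<close>

definition chains :: "('a, 'c::finite) cell_complex \<Rightarrow> nat \<Rightarrow> ('r::comm_ring_1 ^ 'c) set" where
  "chains X k = {v. \<forall>c. c \<notin> cells_of_dim X k \<longrightarrow> v $ c = 0}"

definition bdry :: "('a, 'c::finite) cell_complex \<Rightarrow> 'r::comm_ring_1 ^ 'c \<Rightarrow> 'r ^ 'c" where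
  "bdry X v = (\<chi> d. if d \<in> cells X
     then \<Sum>c\<in>cells_of_dim X (Suc (cell_dim X d)). of_int (incidence X c d) * v $ c else 0)"

definition cycles :: "('a, 'c::finite) cell_complex \<Rightarrow> nat \<Rightarrow> ('r::comm_ring_1 ^ 'c) set" where
  "cycles X k = {z \<in> chains X k. bdry X z = 0}"

definition boundaries :: "('a, 'c::finite) cell_complex \<Rightarrow> nat \<Rightarrow> ('r::comm_ring_1 ^ 'c) set" where
  "boundaries X k = bdry X ` chains X (Suc k)"

definition homology :: "('a, 'c::finite) cell_complex \<Rightarrow> nat \<Rightarrow> ('r::comm_ring_1 ^ 'c) set monoid" where
  "homology X k = additive_group (cycles X k) Mod boundaries X k"

definition homology_class ::
    "('a, 'c::finite) cell_complex \<Rightarrow> nat \<Rightarrow> 'r::comm_ring_1 ^ 'c \<Rightarrow> ('r ^ 'c) set" where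
  "homology_class X k z = boundaries X k #>\<^bsub>additive_group (cycles X k)\<^esub> z"

abbreviation homology_int :: "('a, 'c::finite) cell_complex \<Rightarrow> nat \<Rightarrow> (int ^ 'c) set monoid" where
  "homology_int X k \<equiv> homology X k"

abbreviation homology_real :: "('a, 'c::finite) cell_complex \<Rightarrow> nat \<Rightarrow> (real ^ 'c) set monoid" where
  "homology_real X k \<equiv> homology X k"

definition betti :: "('a, 'c::finite) cell_complex \<Rightarrow> nat \<Rightarrow> nat" where
  "betti X k = Z_rank (homology_int X k)"

definition real_vec :: "int ^ 'c \<Rightarrow> real ^ 'c" where
  "real_vec z = (\<chi> c. of_int (z $ c))"

text \<open>The homomorphism \<open>H\<^sub>k(X; \<int>) \<rightarrow> H\<^sub>k(X; \<real>)\<close>. All the sets in the union coincide.\<close>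

definition homology_extend ::
    "('a, 'c::finite) cell_complex \<Rightarrow> nat \<Rightarrow> (int ^ 'c) set \<Rightarrow> (real ^ 'c) set" where
  "homology_extend X k x = (\<Union>z\<in>x. homology_class X k (real_vec z))"

definition homology_lattice :: "('a, 'c::finite) cell_complex \<Rightarrow> nat \<Rightarrow> (real ^ 'c) set set" where
  "homology_lattice X k = homology_extend X k ` carrier (homology_int X k)"

definition combinatorial_basis ::
    "('a, 'c::finite) cell_complex \<Rightarrow> (nat \<Rightarrow> (real ^ 'c) set list) \<Rightarrow> bool" where
  "combinatorial_basis X h \<longleftrightarrow>
     (\<forall>k. Z_basis ((homology_real X k)\<lparr>carrier := homology_lattice X k\<rparr>) (h k))"

definition linear_on :: "'v::real_vector set \<Rightarrow> ('v \<Rightarrow> 'w::real_vector) \<Rightarrow> bool" where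
  "linear_on V f \<longleftrightarrow> (\<forall>x\<in>V. \<forall>y\<in>V. f (x + y) = f x + f y) \<and> (\<forall>r. \<forall>x\<in>V. f (r *\<^sub>R x) = r *\<^sub>R f x)"

definition boundary_splitting ::
    "('a, 'c::finite) cell_complex \<Rightarrow> nat \<Rightarrow> (real ^ 'c \<Rightarrow> real ^ 'c) \<Rightarrow> bool" where
  "boundary_splitting X k s \<longleftrightarrow> linear_on (boundaries X k) s \<and>
     (\<forall>x\<in>boundaries X k. s x \<in> chains X (Suc k) \<and> bdry X (s x) = x)"

text \<open>Linearity of a map on \<open>H\<^sub>k(X; \<real>)\<close> is linearity of its composition with the quotient map
  \<open>Z\<^sub>k(X; \<real>) \<rightarrow> H\<^sub>k(X; \<real>)\<close>.\<close>

definition homology_splitting ::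
    "('a, 'c::finite) cell_complex \<Rightarrow> nat \<Rightarrow> ((real ^ 'c) set \<Rightarrow> real ^ 'c) \<Rightarrow> bool" where
  "homology_splitting X k t \<longleftrightarrow> linear_on (cycles X k) (\<lambda>z. t (homology_class X k z)) \<and>
     (\<forall>x\<in>carrier (homology_real X k). t x \<in> cycles X k \<and> homology_class X k (t x) = x)"

definition boundary_basis ::
    "('a, 'c::finite) cell_complex \<Rightarrow> nat \<Rightarrow> (real ^ 'c) list \<Rightarrow> bool" where
  "boundary_basis X k bs \<longleftrightarrow> distinct bs \<and> independent (set bs) \<and> span (set bs) = boundaries X k"

definition cell_ordering :: "('a, 'c) cell_complex \<Rightarrow> nat \<Rightarrow> 'c list \<Rightarrow> bool" where
  "cell_ordering X k cs \<longleftrightarrow> distinct cs \<and> set cs = cells_of_dim X k"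

definition coordinate_matrix :: "(real ^ 'c) list \<Rightarrow> 'c list \<Rightarrow> real Matrix.mat" where
  "coordinate_matrix vs cs = Matrix.mat (length cs) (length vs) (\<lambda>(i, j). (vs ! j) $ (cs ! i))"

definition combined_basis ::
    "(nat \<Rightarrow> (real ^ 'c) list) \<Rightarrow> (nat \<Rightarrow> (real ^ 'c) set list) \<Rightarrow>
     (nat \<Rightarrow> real ^ 'c \<Rightarrow> real ^ 'c) \<Rightarrow> (nat \<Rightarrow> (real ^ 'c) set \<Rightarrow> real ^ 'c) \<Rightarrow>
     nat \<Rightarrow> (real ^ 'c) list" where
  "combined_basis b h s t k =
     b k @ map (t k) (h k) @ (case k of 0 \<Rightarrow> [] | Suc j \<Rightarrow> map (s j) (b j))"

definition torsion_of_choices ::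
    "(nat \<Rightarrow> (real ^ 'c) list) \<Rightarrow> (nat \<Rightarrow> (real ^ 'c) set list) \<Rightarrow>
     (nat \<Rightarrow> real ^ 'c \<Rightarrow> real ^ 'c) \<Rightarrow> (nat \<Rightarrow> (real ^ 'c) set \<Rightarrow> real ^ 'c) \<Rightarrow>
     (nat \<Rightarrow> 'c list) \<Rightarrow> real" where
  "torsion_of_choices b h s t cs =
     prodinf (\<lambda>k. Determinant.det (coordinate_matrix (combined_basis b h s t k) (cs k)) powi ((-1) ^ k))"

text \<open>The torsion is defined up to a sign depending on the orderings of the bases; its square does
  not depend on any of the choices.\<close>

definition torsion_squared ::
    "('a, 'c::finite) cell_complex \<Rightarrow> (nat \<Rightarrow> (real ^ 'c) set list) \<Rightarrow> real" where
  "torsion_squared X h = (THE r. \<exists>b s t cs.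
     (\<forall>k. boundary_basis X k (b k) \<and> boundary_splitting X k (s k) \<and>
          homology_splitting X k (t k) \<and> cell_ordering X k (cs k)) \<and>
     r = (torsion_of_choices b h s t cs)\<^sup>2)"

definition torsion_order :: "('a, 'c::finite) cell_complex \<Rightarrow> nat \<Rightarrow> nat" where
  "torsion_order X k = card (torsion_subgroup (homology_int X k))"

text \<open>Only used for \<open>k > 0\<close>.\<close>

definition spanning_trees :: "('a, 'c::finite) cell_complex \<Rightarrow> nat \<Rightarrow> ('a, 'c) cell_complex set" where
  "spanning_trees X k = {T \<in> subcomplexes (skeleton X k).
     trivial_group (homology_int T k) \<and>
     betti T (k - 1) = betti (skeleton X k) (k - 1) \<and>
     cells (skeleton X (k - 1)) \<subseteq> cells T}"

definition harmonic_rep ::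
    "('a, 'c::finite) cell_complex \<Rightarrow> nat \<Rightarrow> (real ^ 'c) set \<Rightarrow> real ^ 'c" where
  "harmonic_rep X k x = (THE z. z \<in> x \<and> z \<in> orthogonal_comp (boundaries X k))"

definition mu_const :: "('a, 'c::finite) cell_complex \<Rightarrow> nat \<Rightarrow> real" where
  "mu_const X k = (covolume (real_vec ` boundaries X k))\<^sup>2"

text \<open>\<open>harmonic_rep\<close> is the isometry from \<open>H\<^sub>k(X; \<real>)\<close> onto the orthogonal complement of the
  boundaries in the cycles by which the inner product on \<open>H\<^sub>k(X; \<real>)\<close> is defined.\<close>

definition eta_const :: "('a, 'c::finite) cell_complex \<Rightarrow> nat \<Rightarrow> real" where
  "eta_const X k = (covolume (harmonic_rep X k ` homology_lattice X k))\<^sup>2"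

definition delta_const :: "('a, 'c::finite) cell_complex \<Rightarrow> nat \<Rightarrow> real" where
  "delta_const X k = eta_const X k * mu_const X k / (real (torsion_order X k))\<^sup>2"

end

theory Submission
  imports Defs "HOL-Analysis.Kronecker_Approximation_Theorem"
begin

text \<open>
  Every determinant in the torsion is squared, and the square of the determinant that expresses
  vectors in the basis of cells is their Gram determinant. A Gram determinant does not change when a
  vector is altered by a combination of earlier ones, and it is multiplicative over mutually
  orthogonal blocks. In the basis \<open>b\<^sub>k\<close>, \<open>t\<^sub>k(h\<^sub>k)\<close>, \<open>s\<^bsub>k-1\<^esub>(b\<^bsub>k-1\<^esub>)\<close> of \<open>C\<^sub>k\<close> one may therefore replace
  \<open>t\<^sub>k(h\<^sub>k)\<close> by harmonic representatives, and the last part by its component \<open>w\<^sub>k\<close> orthogonal to the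
  cycles. The squared determinant in degree \<open>k\<close> is \<open>gram(b\<^sub>k) \<cdot> \<eta>\<^sub>k \<cdot> gram(w\<^sub>k)\<close> (\<open>torsion_factor\<close>).

  The boundary map takes \<open>w\<^bsub>k+1\<^esub>\<close>, which spans the orthogonal complement of the cycles in \<open>C\<^bsub>k+1\<^esub>\<close>,
  to \<open>b\<^sub>k\<close>. The Cauchy-Binet formula turns this into \<open>gram(b\<^sub>k) = c\<^sub>k \<cdot> gram(w\<^bsub>k+1\<^esub>)\<close>, where \<open>c\<^sub>k\<close> is the
  sum of the Gram determinants of \<open>\<partial>(S)\<close> over all sets \<open>S\<close> of \<open>dim B\<^sub>k\<close> cells of dimension \<open>k + 1\<close>
  (\<open>sum_gram_columns\<close>, \<open>orthogonal_splitting\<close>). In the alternating product over \<open>k\<close> the factors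
  \<open>gram(w\<^sub>k)\<close> cancel, and \<open>\<tau>\<^sup>2\<close> is the alternating product of the numbers \<open>\<eta>\<^sub>k \<cdot> c\<^sub>k\<close>
  (\<open>torsion_of_choices_squared\<close>).

  It remains to see that \<open>c\<^sub>k = (\<mu>\<^sub>k / \<theta>\<^sub>k\<^sup>2) \<cdot> (\<Sum>T. \<theta>\<^sub>T\<^sup>2)\<close> (\<open>spanning_tree_sum\<close>). The elements of
  \<open>\<T>\<^bsub>k+1\<^esub>\<close> are the complexes that consist of the \<open>k\<close>-skeleton and a set \<open>S\<close> of \<open>dim B\<^sub>k\<close> cells of dimension
  \<open>k + 1\<close> for which \<open>\<partial>(S)\<close> is linearly independent. Then \<open>\<partial>(S)\<close> is a basis of the lattice
  \<open>B\<^sub>k(T; \<int>)\<close>. Let \<open>g\<close> be the squared covolume of the lattice of integral cycles that are real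
  boundaries. It contains \<open>B\<^sub>k(T; \<int>)\<close> with index \<open>\<theta>\<^sub>T\<close> and \<open>B\<^sub>k(X; \<int>)\<close> with index \<open>\<theta>\<^sub>k\<close>, and a
  sublattice of index \<open>m\<close> has \<open>m\<^sup>2\<close> times the Gram determinant (\<open>sublattice_basis\<close>,
  \<open>card_torsion_Q\<close>). Hence \<open>gram(\<partial>(S)) = \<theta>\<^sub>T\<^sup>2 \<cdot> g\<close> and \<open>\<mu>\<^sub>k = \<theta>\<^sub>k\<^sup>2 \<cdot> g\<close>.

  Two supports carry this computation. On the topological side, the incidence numbers are the
  coefficients of boundaries of cells in the relative homology groups \<open>H\<^sub>n(X\<^bsup>(n)\<^esup>, X\<^bsup>(n-1)\<^esup>)\<close>; these
  groups are free on the cells (\<open>freely_generates_cell_class\<close>), which is proved by attaching one cell at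
  a time with excision and the exact sequence of a triple. This yields \<open>\<partial>\<partial> = 0\<close> and the equality of
  the incidence numbers of \<open>X\<close> and of its subcomplexes. On the arithmetical side, integral vectors
  that are independent over \<open>\<int>\<close> are independent over \<open>\<real>\<close>, and the real kernel of an integral map is
  spanned by integral vectors; both follow from Dirichlet's theorem on simultaneous approximation
  (\<open>lin_indep_of_int_indep\<close>, \<open>rational_kernel\<close>).
\<close>

section \<open>Closed disks and annuli\<close>

definition radius :: "nat \<Rightarrow> (nat \<Rightarrow> real) \<Rightarrow> real" where
  "radius n x = sqrt (\<Sum>i<n. (x i)\<^sup>2)"

definition annulus :: "nat \<Rightarrow> real \<Rightarrow> (nat \<Rightarrow> real) set" where
  "annulus n r = {x \<in> topspace (disk n). r \<le> radius n x}"

definition inner_disk :: "nat \<Rightarrow> real \<Rightarrow> (nat \<Rightarrow> real) set" where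
  "inner_disk n r = {x \<in> topspace (disk n). radius n x < r}"

lemma radius_nonneg [simp]: "0 \<le> radius n x"
  by (simp add: radius_def sum_nonneg)

lemma topspace_disk: "topspace (disk n) = {x. (\<forall>i\<ge>n. x i = 0) \<and> radius n x \<le> 1}"
  by (auto simp: disk_def topspace_Euclidean_space radius_def real_le_rsqrt sum_nonneg)

lemma unit_sphere_eq_annulus: "unit_sphere n = annulus n 1"
  by (auto simp: unit_sphere_def annulus_def topspace_disk topspace_Euclidean_space radius_def sum_nonneg)

lemma open_disk_eq_inner_disk: "open_disk n = inner_disk n 1"
  by (auto simp: open_disk_def inner_disk_def topspace_disk topspace_Euclidean_space radius_def sum_nonneg)

lemma continuous_map_coordinate_Euclidean_space:
  "continuous_map (Euclidean_space n) euclideanreal (\<lambda>x. x i)"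
  unfolding Euclidean_space_def
  by (intro continuous_map_from_subtopology continuous_map_product_projection) auto

lemma continuous_map_radius: "continuous_map (disk n) euclideanreal (radius n)"
proof -
  have "continuous_map (Euclidean_space n) euclideanreal (\<lambda>x. \<Sum>i<n. (x i)\<^sup>2)"
    by (intro continuous_intros continuous_map_coordinate_Euclidean_space) auto
  then have "continuous_map (Euclidean_space n) euclideanreal (sqrt \<circ> (\<lambda>x. \<Sum>i<n. (x i)\<^sup>2))"
    by (rule continuous_map_compose) (simp add: continuous_on_real_sqrt continuous_on_id)
  then show ?thesis
    unfolding disk_def radius_def o_def by (rule continuous_map_from_subtopology)
qed

lemma Hausdorff_space_disk: "Hausdorff_space (disk n)"
  by (simp add: disk_def Hausdorff_Euclidean_space Hausdorff_space_subtopology)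

text \<open>The disk is a closed subset of the cube \<open>[-1, 1]\<^sup>\<nat>\<close>, which is compact by Tychonoff's theorem.\<close>

lemma compact_space_disk: "compact_space (disk n)"
proof -
  let ?K = "PiE UNIV (\<lambda>i::nat. {-1..1::real})"
  have K: "compactin (powertop_real UNIV) ?K"
    unfolding compactin_PiE by simp
  have disk: "disk n = subtopology (powertop_real UNIV) (topspace (disk n))"
    by (simp add: disk_def Euclidean_space_def subtopology_subtopology)
  have "continuous_map (powertop_real UNIV) euclideanreal (\<lambda>x. \<Sum>i<n. (x i)\<^sup>2)"
    by (intro continuous_intros continuous_map_product_projection) auto
  then have "closedin (powertop_real UNIV) {x \<in> topspace (powertop_real UNIV). (\<Sum>i<n. (x i)\<^sup>2) \<in> {..1}}"
    by (rule closedin_continuous_map_preimage) auto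
  from closedin_Int [OF closedin_Euclidean_space [of n] this]
  have "closedin (powertop_real UNIV) (topspace (disk n))"
    by (simp add: disk_def)
  moreover have "x \<in> ?K" if x: "x \<in> topspace (disk n)" for x
  proof (rule PiE_I)
    fix i :: nat
    have "(x i)\<^sup>2 \<le> 1"
    proof (cases "i < n")
      case True
      then have "(x i)\<^sup>2 \<le> (\<Sum>i<n. (x i)\<^sup>2)"
        by (intro member_le_sum) auto
      with x show ?thesis
        by (auto simp: disk_def)
    next
      case False
      then show ?thesis using x by (auto simp: topspace_disk)
    qed
    then show "x i \<in> {-1..1}"
      by (auto simp: abs_square_le_1 abs_le_iff)
  qed auto
  ultimately have "compactin (powertop_real UNIV) (topspace (disk n))"
    using K closed_compactin [OF K] by blast
  then show ?thesis
    by (subst disk) (rule compact_space_subtopology)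
qed

lemma closedin_annulus: "closedin (disk n) (annulus n r)"
proof -
  have "closedin (disk n) {x \<in> topspace (disk n). radius n x \<in> {r..}}"
    by (rule closedin_continuous_map_preimage [OF continuous_map_radius]) auto
  then show ?thesis
    by (simp add: annulus_def)
qed

lemma closedin_small_disk: "closedin (disk n) {x \<in> topspace (disk n). radius n x \<le> r}"
proof -
  have "closedin (disk n) {x \<in> topspace (disk n). radius n x \<in> {..r}}"
    by (rule closedin_continuous_map_preimage [OF continuous_map_radius]) auto
  then show ?thesis
    by simp
qed

lemma radius_scale: "0 \<le> c \<Longrightarrow> radius n (\<lambda>i. c * x i) = c * radius n x"
  by (simp add: radius_def power_mult_distrib real_sqrt_mult flip: sum_distrib_left)

lemma continuous_map_scale:
  assumes "continuous_map Z euclideanreal c" "continuous_map Z (Euclidean_space n) f"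
  shows "continuous_map Z (Euclidean_space n) (\<lambda>z i. c z * f z i)"
  using assms unfolding Euclidean_space_def continuous_map_in_subtopology
  by (auto simp: continuous_map_componentwise_UNIV Pi_iff continuous_map_real_mult)

lemma contractible_space_disk: "contractible_space (disk n)"
  unfolding contractible_space_def
proof
  let ?I = "top_of_set {0..1::real}"
  let ?h = "\<lambda>z. \<lambda>i. (1 - fst z) * snd z i :: real"
  have "continuous_map (prod_topology ?I (disk n)) (Euclidean_space n) ?h"
  proof (rule continuous_map_scale)
    have "continuous_map (prod_topology ?I (disk n)) euclideanreal fst"
      by (metis continuous_map_fst continuous_map_into_fulltopology)
    then show "continuous_map (prod_topology ?I (disk n)) euclideanreal (\<lambda>z. 1 - fst z)"
      by (intro continuous_intros)
    show "continuous_map (prod_topology ?I (disk n)) (Euclidean_space n) snd"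
      unfolding disk_def using continuous_map_into_fulltopology continuous_map_snd by blast
  qed
  moreover have "?h \<in> topspace (prod_topology ?I (disk n)) \<rightarrow> topspace (disk n)"
    by (auto simp: topspace_disk radius_scale intro!: mult_le_one)
  ultimately have cont: "continuous_map (prod_topology ?I (disk n)) (disk n) ?h"
    unfolding disk_def by (auto simp: continuous_map_in_subtopology Pi_iff)
  show "homotopic_with (\<lambda>x. True) (disk n) (disk n) id (\<lambda>x. (\<lambda>i. 0))"
    unfolding homotopic_with_def
    by (rule exI [of _ ?h]) (use cont in auto)
qed

section \<open>Attaching one cell\<close>

text \<open>Attaching a single \<open>n\<close>-cell is the induction step in the computation of the cellular chain groups.
  The outcome is \<open>iso_hom_induced_char\<close>: the characteristic map is an isomorphism in relative homology.\<close>

locale cell_attachment =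
  fixes X :: "'a topology" and A :: "'a set" and n :: nat and \<phi> :: "(nat \<Rightarrow> real) \<Rightarrow> 'a"
  assumes Hausdorff: "Hausdorff_space X"
    and closed_base: "closedin X A"
    and cont: "continuous_map (disk n) X \<phi>"
    and inj: "inj_on \<phi> (open_disk n)"
    and sphere: "\<phi> ` unit_sphere n \<subseteq> A"
    and disjoint: "\<phi> ` open_disk n \<inter> A = {}"
    and cover: "topspace X = A \<union> \<phi> ` open_disk n"
begin

text \<open>A neighbourhood of \<open>A\<close>: the centre of the cell is missing, so the rest can be pushed radially onto
  \<open>A\<close>, while the space between two collars leaves the room that excision needs.\<close>

definition collar :: "real \<Rightarrow> 'a set" where
  "collar r = A \<union> \<phi> ` annulus n r"

lemma closed_map_char: "closed_map (disk n) X \<phi>"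
  by (rule continuous_imp_closed_map [OF cont compact_space_disk Hausdorff])

lemma char_in_base_iff: "x \<in> topspace (disk n) \<Longrightarrow> \<phi> x \<in> A \<longleftrightarrow> x \<in> unit_sphere n"
  using sphere disjoint by (fastforce simp: unit_sphere_eq_annulus open_disk_eq_inner_disk annulus_def inner_disk_def)

lemma char_in_collar_iff:
  assumes "x \<in> topspace (disk n)" "r \<le> 1"
  shows "\<phi> x \<in> collar r \<longleftrightarrow> x \<in> annulus n r"
proof
  assume "\<phi> x \<in> collar r"
  then consider "\<phi> x \<in> A" | y where "y \<in> annulus n r" "\<phi> x = \<phi> y"
    by (auto simp: collar_def)
  then show "x \<in> annulus n r"
  proof cases
    case 1
    then show ?thesis using assms by (auto simp: char_in_base_iff unit_sphere_eq_annulus annulus_def)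
  next
    case 2
    show ?thesis
    proof (cases "\<phi> x \<in> A")
      case True
      then show ?thesis using assms by (auto simp: char_in_base_iff unit_sphere_eq_annulus annulus_def)
    next
      case False
      then have "x \<in> open_disk n" "y \<in> open_disk n"
        using 2 assms char_in_base_iff [of x] char_in_base_iff [of y]
        by (auto simp: unit_sphere_eq_annulus open_disk_eq_inner_disk annulus_def inner_disk_def)
      then show ?thesis using inj 2 by (auto dest: inj_onD)
    qed
  qed
qed (auto simp: collar_def)

lemma closedin_collar: "closedin X (collar r)"
  unfolding collar_def using closed_map_char closedin_annulus closed_base
  by (auto simp: closed_map_def)

text \<open>Since \<open>\<phi>\<close> identifies no point of the open disk with any other point of the disk, points of the cell
  remember their radius.\<close>

lemma topspace_diff_collar:
  assumes r: "r \<le> 1"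
  shows "topspace X - collar r = \<phi> ` inner_disk n r"
proof (intro subset_antisym subsetI)
  fix z assume z: "z \<in> topspace X - collar r"
  then obtain x where "x \<in> open_disk n" "z = \<phi> x"
    using cover by (auto simp: collar_def)
  with z have "x \<notin> annulus n r"
    by (auto simp: collar_def)
  with \<open>x \<in> open_disk n\<close> \<open>z = \<phi> x\<close> show "z \<in> \<phi> ` inner_disk n r"
    by (auto simp: open_disk_eq_inner_disk inner_disk_def annulus_def)
next
  fix z assume "z \<in> \<phi> ` inner_disk n r"
  then obtain x where x: "x \<in> inner_disk n r" "z = \<phi> x"
    by auto
  then have "\<phi> x \<in> topspace X"
    using cont by (auto simp: inner_disk_def continuous_map_def)
  with x r show "z \<in> topspace X - collar r"
    using char_in_collar_iff [of x r] by (auto simp: inner_disk_def annulus_def)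
qed

text \<open>For a point of radius \<open>\<rho> > 0\<close> the scaling factor is chosen so that the new radius is
  \<open>t \<cdot> \<rho> + (1 - t)\<close>: the identity at time \<open>1\<close>, and the projection to the sphere at time \<open>0\<close>.\<close>

definition radial_push :: "real \<Rightarrow> (nat \<Rightarrow> real) \<Rightarrow> nat \<Rightarrow> real" where
  "radial_push t y = (\<lambda>i. (t + (1 - t) / radius n y) * y i)"

lemma radial_push_in_annulus:
  assumes "0 < r" "y \<in> annulus n r" "t \<in> {0..1}"
  shows "radial_push t y \<in> annulus n r" and "radius n (radial_push t y) = t * radius n y + (1 - t)"
proof -
  have pos: "0 < radius n y" and y: "r \<le> radius n y" "radius n y \<le> 1"
    using assms by (auto simp: annulus_def topspace_disk)
  have nn: "0 \<le> t + (1 - t) / radius n y"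
    using assms pos by (auto intro!: add_nonneg_nonneg divide_nonneg_pos)
  show eq: "radius n (radial_push t y) = t * radius n y + (1 - t)"
    unfolding radial_push_def radius_scale [OF nn] using pos by (simp add: field_simps)
  have "t * radius n y \<le> t * 1" "(1 - t) * radius n y \<le> (1 - t) * 1"
    using assms(3) y(2) by (intro mult_left_mono; simp)+
  then have "radius n y \<le> t * radius n y + (1 - t)" "t * radius n y + (1 - t) \<le> 1"
    by (auto simp: algebra_simps)
  then show "radial_push t y \<in> annulus n r"
    using assms(2) y eq by (auto simp: annulus_def topspace_disk radial_push_def)
qed

lemma continuous_map_radial_push:
  assumes "0 < r"
  shows "continuous_map (prod_topology (top_of_set {0..1}) (subtopology (disk n) (annulus n r)))
           (disk n) (\<lambda>(t, y). radial_push t y)"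
proof -
  let ?P = "prod_topology (top_of_set {0..1::real}) (subtopology (disk n) (annulus n r))"
  have t: "continuous_map ?P euclideanreal fst"
    by (metis continuous_map_fst continuous_map_into_fulltopology)
  have y: "continuous_map ?P (subtopology (disk n) (annulus n r)) snd"
    by (rule continuous_map_snd)
  then have y': "continuous_map ?P (disk n) snd"
    using continuous_map_into_fulltopology by blast
  then have y'': "continuous_map ?P (Euclidean_space n) snd"
    unfolding disk_def using continuous_map_into_fulltopology by blast
  have rad: "continuous_map ?P euclideanreal (\<lambda>z. radius n (snd z))"
    using continuous_map_compose [OF y' continuous_map_radius] by (simp add: o_def)
  have nz: "radius n (snd z) \<noteq> 0" if "z \<in> topspace ?P" for z
    using that assms by (auto simp: annulus_def)
  have "continuous_map ?P (Euclidean_space n)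
      (\<lambda>z i. (fst z + (1 - fst z) / radius n (snd z)) * snd z i)"
    by (intro continuous_map_scale y'' continuous_map_add t continuous_map_real_divide
        continuous_map_diff rad nz) auto
  then have "continuous_map ?P (Euclidean_space n) (\<lambda>(t, y). radial_push t y)"
    by (simp add: radial_push_def case_prod_unfold)
  moreover have "(\<lambda>(t, y). radial_push t y) \<in> topspace ?P \<rightarrow> annulus n r"
    using radial_push_in_annulus [OF assms] by auto
  ultimately show ?thesis
    unfolding disk_def continuous_map_in_subtopology
    by (auto simp: annulus_def disk_def Pi_iff)
qed

text \<open>The radial push of the annulus descends along \<open>\<phi>\<close> to a deformation of the collar onto \<open>A\<close> that fixes
  \<open>A\<close>. Continuity is checked on the two closed pieces \<open>A\<close> and \<open>\<phi>(annulus)\<close> separately; on the second one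
  it suffices to check it upstairs, because \<open>\<phi>\<close> times the identity of the interval is a continuous map from
  a compact space to a Hausdorff space and therefore a quotient map.\<close>

lemma trivial_homology_collar:
  assumes r: "0 < r" "r \<le> 1"
  shows "trivial_group (relative_homology_group p (subtopology X (collar r)) A)"
proof -
  let ?I = "top_of_set {0..1::real}"
  let ?N = "subtopology X (collar r)"
  define h where "h = (\<lambda>(t, x). if x \<in> \<phi> ` inner_disk n 1 then \<phi> (radial_push t (inv_into (inner_disk n 1) \<phi> x)) else x)"
  have h_A: "h (t, x) = x" if "x \<in> A" for t x
    using that disjoint by (auto simp: h_def open_disk_eq_inner_disk)
  have h_ann: "h (t, \<phi> y) = \<phi> (radial_push t y)" if y: "y \<in> annulus n r" for t y
  proof (cases "y \<in> inner_disk n 1")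
    case True
    then show ?thesis
      using inj by (simp add: h_def open_disk_eq_inner_disk)
  next
    case False
    then have "y \<in> annulus n 1" "radius n y = 1"
      using y by (auto simp: annulus_def inner_disk_def topspace_disk)
    then have "\<phi> y \<in> A" "radial_push t y = y"
      using sphere by (auto simp: radial_push_def unit_sphere_eq_annulus)
    then show ?thesis
      by (simp add: h_A)
  qed
  have h_1: "h (1, x) = x" for x
    by (auto simp: h_def radial_push_def f_inv_into_f)
  have h_0: "h (0, x) \<in> A" if x: "x \<in> collar r" for x
  proof (cases "x \<in> A")
    case False
    then obtain y where y: "y \<in> annulus n r" "x = \<phi> y"
      using x by (auto simp: collar_def)
    then have "radial_push 0 y \<in> annulus n 1"
      using radial_push_in_annulus [OF r(1) y(1), of 0] by (auto simp: annulus_def)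
    then show ?thesis
      using y sphere by (auto simp: h_ann unit_sphere_eq_annulus)
  qed (simp add: h_A)
  have h_N: "h (t, x) \<in> collar r" if x: "x \<in> collar r" and t: "t \<in> {0..1}" for t x
  proof (cases "x \<in> A")
    case False
    then obtain y where y: "y \<in> annulus n r" "x = \<phi> y"
      using x by (auto simp: collar_def)
    then show ?thesis
      using radial_push_in_annulus [OF r(1) y(1) t] by (auto simp: h_ann collar_def)
  qed (simp add: h_A collar_def)
  have sub: "collar r \<subseteq> topspace X"
    using closedin_collar closedin_subset by blast
  have "continuous_map (prod_topology ?I ?N) X h"
  proof (rule pasting_lemma_closed [where I = "UNIV :: bool set" and f = "\<lambda>b. h"
        and T = "\<lambda>b. {0..1} \<times> (if b then A else \<phi> ` annulus n r)"])
    have cl: "closedin ?N A" "closedin ?N (\<phi> ` annulus n r)"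
      using closed_base closed_map_char closedin_annulus
      by (auto simp: closedin_subtopology_Int_closed collar_def closed_map_def intro!: closedin_subset_topspace)
    then show "closedin (prod_topology ?I ?N) ({0..1} \<times> (if b then A else \<phi> ` annulus n r))" for b
      by (auto simp: closedin_prod_Times_iff)
    show "continuous_map (subtopology (prod_topology ?I ?N) ({0..1} \<times> (if b then A else \<phi> ` annulus n r))) X h" for b
    proof (cases b)
      case True
      have "continuous_map (prod_topology ?I ?N) X snd"
        using continuous_map_into_fulltopology continuous_map_snd by blast
      then have "continuous_map (subtopology (prod_topology ?I ?N) ({0..1} \<times> A)) X snd"
        by (rule continuous_map_from_subtopology)
      then have "continuous_map (subtopology (prod_topology ?I ?N) ({0..1} \<times> A)) X h"
        by (rule continuous_map_eq) (auto simp: h_A)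
      with True show ?thesis by simp
    next
      case False
      let ?D = "subtopology (disk n) (annulus n r)"
      let ?E = "subtopology X (\<phi> ` annulus n r)"
      have E: "subtopology (prod_topology ?I ?N) ({0..1} \<times> \<phi> ` annulus n r) = prod_topology ?I ?E"
      proof -
        have "collar r \<inter> \<phi> ` annulus n r = \<phi> ` annulus n r"
          by (auto simp: collar_def)
        then show ?thesis
          by (simp only: subtopology_subtopology subtopology_Times Int_absorb)
      qed
      let ?q = "\<lambda>z. (fst z, \<phi> (snd z))"
      have Dn: "topspace ?D = annulus n r"
        by (auto simp: annulus_def)
      have \<phi>: "continuous_map ?D ?E \<phi>"
        using cont by (auto simp: continuous_map_in_subtopology continuous_map_from_subtopology Dn)
      have "quotient_map (prod_topology ?I ?D) (prod_topology ?I ?E) ?q"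
      proof (rule continuous_closed_imp_quotient_map)
        show c: "continuous_map (prod_topology ?I ?D) (prod_topology ?I ?E) ?q"
          using continuous_map_compose [OF continuous_map_snd \<phi>]
          by (auto intro!: continuous_map_pairedI continuous_map_fst simp: o_def)
        have "compact_space ?D"
          using closedin_compact_space [OF compact_space_disk closedin_annulus] compact_space_subtopology by blast
        then have "compact_space (prod_topology ?I ?D)"
          by (simp add: compact_space_prod_topology compact_space_subtopology)
        moreover have "Hausdorff_space (prod_topology ?I ?E)"
          using Hausdorff by (simp add: Hausdorff_space_prod_topology Hausdorff_space_subtopology)
        ultimately show "closed_map (prod_topology ?I ?D) (prod_topology ?I ?E) ?q"
          using c continuous_imp_closed_map by blast
        have "\<phi> ` annulus n r \<subseteq> topspace X"
          using sub by (auto simp: collar_def)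
        then have "topspace ?E = \<phi> ` annulus n r"
          by auto
        then show "?q ` topspace (prod_topology ?I ?D) = topspace (prod_topology ?I ?E)"
          unfolding topspace_prod_topology Dn by (force simp: image_iff)
      qed
      moreover have "continuous_map (prod_topology ?I ?D) X (h \<circ> ?q)"
      proof (rule continuous_map_eq)
        show "continuous_map (prod_topology ?I ?D) X (\<phi> \<circ> (\<lambda>(t, y). radial_push t y))"
          using continuous_map_compose [OF continuous_map_radial_push [OF r(1)] cont] .
        show "(\<phi> \<circ> (\<lambda>(t, y). radial_push t y)) z = (h \<circ> ?q) z" if "z \<in> topspace (prod_topology ?I ?D)" for z
          using that h_ann by (cases z) auto
      qed
      ultimately have "continuous_map (prod_topology ?I ?E) X h"
        by (rule continuous_compose_quotient_map)
      with False E show ?thesis by simp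
    qed
    show "\<exists>j. j \<in> UNIV \<and> x \<in> {0..1} \<times> (if j then A else \<phi> ` annulus n r) \<and> h x = h x"
      if "x \<in> topspace (prod_topology ?I ?N)" for x
      using that by (auto simp: collar_def split: if_splits intro: exI [of _ True] exI [of _ False])
  qed auto
  then have hN: "continuous_map (prod_topology ?I ?N) ?N h"
    using h_N by (auto simp: continuous_map_in_subtopology)
  show ?thesis
  proof (rule trivial_relative_homology_group_alt)
    have "continuous_map ?N ?N (h \<circ> (\<lambda>x. (0, x)))"
      by (rule continuous_map_compose [OF _ hN]) (auto intro!: continuous_map_pairedI)
    then show "continuous_map ?N (subtopology ?N A) (\<lambda>x. h (0, x))"
      using h_0 by (auto simp: continuous_map_in_subtopology o_def)
    show "homotopic_with (\<lambda>k. k ` A \<subseteq> A) ?N ?N (\<lambda>x. h (0, x)) id"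
      unfolding homotopic_with_def
      by (rule exI [of _ h]) (use hN in \<open>auto simp: h_1 h_A\<close>)
  qed
qed

text \<open>The exact sequence of the triple \<open>(X, collar, A)\<close>, in which the groups of \<open>(collar, A)\<close> vanish.\<close>

lemma iso_base_collar:
  assumes "0 < r" "r \<le> 1"
  shows "hom_induced p X A X (collar r) id
         \<in> iso (relative_homology_group p X A) (relative_homology_group p X (collar r))"
proof (rule very_short_exact_sequence)
  have "A \<subseteq> collar r"
    by (auto simp: collar_def)
  then show "exact_seq
     ([relative_homology_group (p - 1) (subtopology X (collar r)) A, relative_homology_group p X (collar r),
       relative_homology_group p X A, relative_homology_group p (subtopology X (collar r)) A],
      [hom_relboundary p X (collar r) A, hom_induced p X A X (collar r) id,
       hom_induced p (subtopology X (collar r)) A X A id])"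
    using homology_exactness_triple_1 homology_exactness_triple_3 by fastforce
qed (use trivial_homology_collar [OF assms] in auto)

text \<open>The smaller collar \<open>collar s\<close> is excised. It is closed, and it lies in the interior of \<open>collar r\<close>: the
  complement of the image of the compact disk of radius \<open>r\<close> is an open set between the two.\<close>

lemma iso_excise_collar:
  assumes "0 < r" "r < s" "s \<le> 1"
  shows "hom_induced p (subtopology X (\<phi> ` inner_disk n s)) (collar r - collar s) X (collar r) id
         \<in> iso (relative_homology_group p (subtopology X (\<phi> ` inner_disk n s)) (collar r - collar s))
               (relative_homology_group p X (collar r))"
proof -
  have "collar s \<subseteq> X interior_of collar r"
  proof (rule subset_trans)
    let ?K = "{x \<in> topspace (disk n). radius n x \<le> r}"
    have "closedin X (\<phi> ` ?K)"
      using closed_map_char closedin_small_disk by (auto simp: closed_map_def)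
    then have op: "openin X (topspace X - \<phi> ` ?K)"
      by blast
    show "collar s \<subseteq> topspace X - \<phi> ` ?K"
      using char_in_collar_iff [of _ s] closedin_subset [OF closedin_collar [of s]] assms
      by (auto simp: annulus_def)
    have "inner_disk n r \<subseteq> ?K"
      by (auto simp: inner_disk_def)
    then have "topspace X - \<phi> ` ?K \<subseteq> topspace X - (topspace X - collar r)"
      using topspace_diff_collar [of r] assms by (simp add: Diff_mono image_mono)
    then have "topspace X - \<phi> ` ?K \<subseteq> collar r"
      by blast
    then show "topspace X - \<phi> ` ?K \<subseteq> X interior_of collar r"
      using op by (simp add: interior_of_maximal)
  qed
  then have "X closure_of collar s \<subseteq> X interior_of collar r"
    by (simp add: closedin_collar closure_of_closedin)
  from homology_excision_axiom [OF this, of "topspace X" p]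
  show ?thesis
    using closedin_subset [OF closedin_collar [of r]] topspace_diff_collar [OF assms(3)] by simp
qed

text \<open>A closed map stays closed when it is restricted to the full preimage of a set, and an injective
  continuous closed map is a homeomorphism onto its image.\<close>

lemma homeomorphic_map_inner_disk:
  assumes "s \<le> 1"
  shows "homeomorphic_map (subtopology (disk n) (inner_disk n s)) (subtopology X (\<phi> ` inner_disk n s)) \<phi>"
proof -
  have top: "topspace (subtopology (disk n) (inner_disk n s)) = inner_disk n s"
    by (auto simp: inner_disk_def)
  have eq: "{x \<in> topspace (disk n). \<phi> x \<in> \<phi> ` inner_disk n s} = inner_disk n s"
  proof -
    have "x \<in> inner_disk n s" if "x \<in> topspace (disk n)" "\<phi> x \<in> \<phi> ` inner_disk n s" for x
    proof -
      have "\<phi> x \<notin> collar s"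
        using that topspace_diff_collar [OF assms] by blast
      then show ?thesis
        using that char_in_collar_iff [OF that(1) assms] by (auto simp: inner_disk_def annulus_def)
    qed
    then show ?thesis by (auto simp: inner_disk_def)
  qed
  have "inj_on \<phi> (inner_disk n s)"
    by (rule inj_on_subset [OF inj]) (use assms in \<open>auto simp: open_disk_eq_inner_disk inner_disk_def\<close>)
  moreover have "continuous_map (subtopology (disk n) (inner_disk n s)) (subtopology X (\<phi> ` inner_disk n s)) \<phi>"
    using cont top by (auto simp: continuous_map_in_subtopology continuous_map_from_subtopology)
  moreover have "closed_map (subtopology (disk n) (inner_disk n s)) (subtopology X (\<phi> ` inner_disk n s)) \<phi>"
    by (rule closed_map_restriction [OF closed_map_char eq])
  moreover have "topspace (subtopology X (\<phi> ` inner_disk n s)) = \<phi> ` inner_disk n s"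
    using continuous_map_image_subset_topspace [OF cont] by (auto simp: inner_disk_def)
  ultimately show ?thesis
    using top by (intro bijective_closed_imp_homeomorphic_map) auto
qed

end

text \<open>The disk arises from its boundary sphere by attaching one cell. This is the model with which an
  arbitrary attachment is compared.\<close>

lemma cell_attachment_disk: "cell_attachment (disk n) (unit_sphere n) n id"
proof
  show "closedin (disk n) (unit_sphere n)"
    by (simp add: unit_sphere_eq_annulus closedin_annulus)
qed (auto simp: Hausdorff_space_disk unit_sphere_eq_annulus open_disk_eq_inner_disk
      inner_disk_def annulus_def)

lemma iso_cancel_left:
  assumes "h \<circ> f \<in> iso G K" "h \<in> iso H K" "f \<in> hom G H"
  shows "f \<in> iso G H"
proof -
  have inj: "inj_on h (carrier H)" and surj: "h ` carrier H = carrier K"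
    and hf: "inj_on (h \<circ> f) (carrier G)" "(h \<circ> f) ` carrier G = carrier K"
    using assms by (auto simp: iso_iff)
  have f: "f ` carrier G \<subseteq> carrier H"
    using assms(3) by (auto simp: hom_def)
  have "f ` carrier G = carrier H"
  proof
    show "carrier H \<subseteq> f ` carrier G"
    proof
      fix y assume y: "y \<in> carrier H"
      then have "h y \<in> (h \<circ> f) ` carrier G"
        using hf surj by auto
      then obtain x where "x \<in> carrier G" "h y = h (f x)"
        by auto
      then show "y \<in> f ` carrier G"
        using inj y f by (auto dest: inj_onD)
    qed
  qed (rule f)
  moreover have "inj_on f (carrier G)"
    using hf(1) by (rule inj_on_imageI2)
  ultimately show ?thesis
    using assms(3) by (auto simp: iso_iff)
qed

lemma iso_cancel_right:
  assumes "h \<circ> f \<in> iso G K" "f \<in> iso G H" "h \<in> hom H K"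
  shows "h \<in> iso H K"
proof -
  have f: "inj_on f (carrier G)" "f ` carrier G = carrier H"
    and hf: "inj_on (h \<circ> f) (carrier G)" "(h \<circ> f) ` carrier G = carrier K"
    using assms by (auto simp: iso_iff)
  have "h ` carrier H = carrier K" "inj_on h (carrier H)"
    using f hf comp_inj_on_iff [OF f(1), of h] by (metis image_comp, metis)
  then show ?thesis
    using assms(3) by (auto simp: iso_iff)
qed

context cell_attachment begin

text \<open>For the disk as well as for \<open>X\<close>, the pair (space, base) has the homology of (space, collar), and this
  has the homology of (inner disk, part of the collar) by excision. The map \<open>\<phi>\<close> induces a ladder between
  these isomorphisms, and on the inner disk it is a homeomorphism of pairs.\<close>

lemma iso_hom_induced_char:
  "hom_induced p (disk n) (unit_sphere n) X A \<phi>
   \<in> iso (relative_homology_group p (disk n) (unit_sphere n)) (relative_homology_group p X A)"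
proof -
  \<comment> \<open>Any two radii \<open>0 < r < s < 1\<close> would do.\<close>
  define r s where "r = (1/2::real)" and "s = (3/4::real)"
  have rs: "0 < r" "r \<le> 1" "r < s" "s \<le> 1"
    by (auto simp: r_def s_def)
  interpret D: cell_attachment "disk n" "unit_sphere n" n id
    by (rule cell_attachment_disk)
  have Dcollar: "D.collar t = annulus n t" if "t \<le> 1" for t
    using that unfolding D.collar_def by (auto simp: unit_sphere_eq_annulus annulus_def)
  let ?U = "inner_disk n s"
  let ?DU = "subtopology (disk n) ?U" and ?XU = "subtopology X (\<phi> ` ?U)"
  let ?DA = "annulus n r - annulus n s" and ?XA = "collar r - collar s"
  have img: "\<phi> ` ?DA = ?XA"
  proof (intro subset_antisym subsetI)
    fix z assume z: "z \<in> ?XA"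
    then have "z \<in> \<phi> ` ?U"
      using topspace_diff_collar [OF rs(4)] closedin_subset [OF closedin_collar [of r]] by auto
    then obtain x where x: "x \<in> ?U" "z = \<phi> x"
      by auto
    with z have "x \<in> ?DA"
      using char_in_collar_iff [of x r] char_in_collar_iff [of x s] rs by (auto simp: inner_disk_def)
    with x show "z \<in> \<phi> ` ?DA" by blast
  next
    fix z assume "z \<in> \<phi> ` ?DA"
    then obtain x where "x \<in> ?DA" "z = \<phi> x"
      by auto
    then show "z \<in> ?XA"
      using char_in_collar_iff [of x r] char_in_collar_iff [of x s] rs by (auto simp: annulus_def)
  qed
  have DA: "?DA \<subseteq> topspace ?DU"
    by (auto simp: annulus_def inner_disk_def)
  have cU: "continuous_map ?DU ?XU \<phi>"
    using homeomorphic_map_inner_disk [OF rs(4)] homeomorphic_imp_continuous_map by blast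
  let ?a = "hom_induced p ?DU ?DA ?XU ?XA \<phi>"
  let ?b = "hom_induced p ?XU ?XA X (collar r) id"
  let ?c = "hom_induced p ?DU ?DA (disk n) (annulus n r) id"
  let ?d = "hom_induced p (disk n) (annulus n r) X (collar r) \<phi>"
  let ?e = "hom_induced p (disk n) (unit_sphere n) (disk n) (annulus n r) id"
  let ?f = "hom_induced p X A X (collar r) id"
  let ?g = "hom_induced p (disk n) (unit_sphere n) X A \<phi>"
  have a: "?a \<in> iso (relative_homology_group p ?DU ?DA) (relative_homology_group p ?XU ?XA)"
    by (rule homeomorphic_map_relative_homology_iso [OF homeomorphic_map_inner_disk [OF rs(4)] DA img])
  have b: "?b \<in> iso (relative_homology_group p ?XU ?XA) (relative_homology_group p X (collar r))"
    by (rule iso_excise_collar [OF rs(1,3,4)])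
  have c: "?c \<in> iso (relative_homology_group p ?DU ?DA) (relative_homology_group p (disk n) (annulus n r))"
    using D.iso_excise_collar [OF rs(1,3,4), of p] rs by (simp add: Dcollar)
  have e: "?e \<in> iso (relative_homology_group p (disk n) (unit_sphere n)) (relative_homology_group p (disk n) (annulus n r))"
    using D.iso_base_collar [OF rs(1,2), of p] rs by (simp add: Dcollar)
  have f: "?f \<in> iso (relative_homology_group p X A) (relative_homology_group p X (collar r))"
    by (rule iso_base_collar [OF rs(1,2)])
  have ann: "\<phi> ` annulus n r \<subseteq> collar r"
    by (auto simp: collar_def)
  have "?b \<circ> ?a = ?d \<circ> ?c"
    using cont cU img ann
    by (subst (1 2) hom_induced_compose [symmetric])
       (auto simp: continuous_map_from_subtopology image_subset_iff)
  moreover have "?b \<circ> ?a \<in> iso (relative_homology_group p ?DU ?DA) (relative_homology_group p X (collar r))"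
    using a b by (rule iso_set_trans)
  ultimately have "?d \<circ> ?c \<in> iso (relative_homology_group p ?DU ?DA) (relative_homology_group p X (collar r))"
    by metis
  then have d: "?d \<in> iso (relative_homology_group p (disk n) (annulus n r)) (relative_homology_group p X (collar r))"
    by (rule iso_cancel_right [OF _ c hom_induced_hom])
  have "?f \<circ> ?g = ?d \<circ> ?e"
    using cont sphere ann
    by (subst (1 2) hom_induced_compose [symmetric])
       (auto simp: image_subset_iff collar_def unit_sphere_eq_annulus annulus_def r_def)
  moreover have "?d \<circ> ?e \<in> iso (relative_homology_group p (disk n) (unit_sphere n)) (relative_homology_group p X (collar r))"
    using e d by (rule iso_set_trans)
  ultimately have "?f \<circ> ?g \<in> iso (relative_homology_group p (disk n) (unit_sphere n)) (relative_homology_group p X (collar r))"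
    by metis
  then show ?thesis
    by (rule iso_cancel_left [OF _ f hom_induced_hom])
qed

end

section \<open>Relative homology of a disk modulo its boundary sphere\<close>

text \<open>As the disk is contractible, the relative group in degree \<open>p\<close> is the reduced group of the sphere in
  degree \<open>p - 1\<close>. For \<open>n = 0\<close> the sphere is empty and the pair is a single point.\<close>

lemma relative_homology_disk_sphere:
  shows "relative_homology_group (int n) (disk n) (unit_sphere n) \<cong> integer_group"
    and "p \<noteq> int n \<Longrightarrow> trivial_group (relative_homology_group p (disk n) (unit_sphere n))"
proof -
  have "relative_homology_group (int n) (disk n) (unit_sphere n) \<cong> integer_group \<and>
    (p \<noteq> int n \<longrightarrow> trivial_group (relative_homology_group p (disk n) (unit_sphere n)))"
  proof (cases n)
    case 0
    have "topspace (disk 0) = {\<lambda>_. 0}"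
      by (auto simp: topspace_disk radius_def)
    moreover have "unit_sphere 0 = {}"
      by (auto simp: unit_sphere_def)
    ultimately show ?thesis
      using 0 homology_coefficients homology_dimension_axiom by (metis of_nat_0)
  next
    case (Suc m)
    have sph: "subtopology (disk n) (unit_sphere n) = nsphere m"
    proof -
      have "topspace (disk n) \<inter> unit_sphere n = topspace (Euclidean_space n) \<inter> {x. (\<Sum>i\<le>m. (x i)\<^sup>2) = 1}"
        by (auto simp: Suc disk_def unit_sphere_def lessThan_Suc_atMost)
      then show ?thesis
        unfolding disk_def nsphere_def Suc [symmetric]
        by (simp add: subtopology_subtopology) (metis Int_assoc inf.idem subtopology_restrict)
    qed
    then have "topspace (disk n) \<inter> unit_sphere n \<noteq> {}"
      using in_topspace_nsphere [of m] by (metis empty_iff topspace_subtopology)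
    then have iso: "relative_homology_group q (disk n) (unit_sphere n) \<cong> reduced_homology_group (q - 1) (nsphere m)" for q
      using isomorphic_group_relative_homology_of_contractible [OF contractible_space_disk] sph by metis
    have "int n - 1 = int m"
      by (simp add: Suc)
    then have "relative_homology_group (int n) (disk n) (unit_sphere n) \<cong> integer_group"
      using iso [of "int n"] reduced_homology_group_nsphere(1) [of m] iso_trans by metis
    moreover have "trivial_group (relative_homology_group p (disk n) (unit_sphere n))" if "p \<noteq> int n"
    proof -
      have "trivial_group (reduced_homology_group (p - 1) (nsphere m))"
        using that by (simp add: Suc trivial_reduced_homology_group_nsphere)
      then show ?thesis
        using iso [of p] isomorphic_group_triviality by (metis group_reduced_homology_group group_relative_homology_group)
    qed
    ultimately show ?thesis by blast
  qed
  then show "relative_homology_group (int n) (disk n) (unit_sphere n) \<cong> integer_group"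
    "p \<noteq> int n \<Longrightarrow> trivial_group (relative_homology_group p (disk n) (unit_sphere n))"
    by auto
qed

section \<open>Free generation of abelian groups\<close>

text \<open>Coefficient functions vanish outside of the index set, so that they are unique as functions. This is
  the form in which the incidence numbers are singled out.\<close>

definition freely_generates :: "('g, 'm) monoid_scheme \<Rightarrow> ('i \<Rightarrow> 'g) \<Rightarrow> 'i set \<Rightarrow> bool" where
  "freely_generates G f I \<longleftrightarrow> f \<in> I \<rightarrow> carrier G \<and>
     (\<forall>x\<in>carrier G. \<exists>!m::'i \<Rightarrow> int. (\<forall>i. i \<notin> I \<longrightarrow> m i = 0) \<and> x = finprod G (\<lambda>i. f i [^]\<^bsub>G\<^esub> m i) I)"

lemma hom_finprod:
  assumes "comm_group G" "comm_group H" "h \<in> hom G H" "f \<in> I \<rightarrow> carrier G"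
  shows "h (finprod G f I) = finprod H (\<lambda>i. h (f i)) I"
proof -
  interpret G: comm_group G by fact
  interpret H: comm_group H by fact
  interpret group_hom G H h
    using assms by (simp add: group_hom_def group_hom_axioms_def G.is_group H.is_group)
  show ?thesis
    using assms(4)
  proof (induction I rule: infinite_finite_induct)
    case (insert i I)
    then have "finprod G f (insert i I) = f i \<otimes>\<^bsub>G\<^esub> finprod G f I"
      by (intro G.finprod_insert) auto
    moreover have "finprod H (\<lambda>i. h (f i)) (insert i I) = h (f i) \<otimes>\<^bsub>H\<^esub> finprod H (\<lambda>i. h (f i)) I"
      using insert by (intro H.finprod_insert) (auto intro!: hom_closed)
    moreover have "f i \<in> carrier G" "finprod G f I \<in> carrier G"
      using insert by (auto intro!: G.finprod_closed)
    ultimately show ?case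
      using insert by (simp add: Pi_iff)
  qed auto
qed

text \<open>If the generator corresponds to \<open>u \<in> \<int>\<close>, then \<open>1\<close> is a multiple of \<open>u\<close>; hence \<open>u \<noteq> 0\<close> and the powers of
  the generator are distinct.\<close>

lemma freely_generates_singleton:
  assumes "comm_group G" "G \<cong> integer_group" "g \<in> carrier G" "subgroup_generated G {g} = G"
  shows "freely_generates G (\<lambda>_. g) {c}"
proof -
  interpret comm_group G by fact
  obtain h where h: "h \<in> iso integer_group G"
    using iso_sym [OF assms(2)] by (auto simp: is_iso_def)
  interpret h: group_hom integer_group G h
    using h by (auto simp: group_hom_def group_hom_axioms_def iso_def is_group)
  have carrier: "carrier G = range (\<lambda>k::int. g [^]\<^bsub>G\<^esub> k)"
    using assms(3,4) by (metis carrier_subgroup_generated_by_singleton)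
  obtain u where u: "g = h u"
    using h assms(3) by (auto simp: iso_iff)
  have "h 1 \<in> carrier G"
    by (metis UNIV_I carrier_integer_group h.hom_closed)
  then obtain k :: int where k: "h 1 = g [^]\<^bsub>G\<^esub> k"
    using carrier by auto
  have pow: "g [^]\<^bsub>G\<^esub> l = h (u * l)" for l :: int
    using h.hom_int_pow [of u l] by (simp add: u mult.commute)
  have injh: "inj h"
    using h by (auto simp: iso_iff)
  have "1 = u * k"
    using k injh unfolding pow by (auto dest: injD)
  then have "u \<noteq> 0" by auto
  then have inj: "inj (\<lambda>l::int. g [^]\<^bsub>G\<^esub> l)"
    unfolding pow using injh by (auto simp: inj_on_def) (metis mult_cancel_left)
  show ?thesis
    unfolding freely_generates_def
  proof (intro conjI ballI)
    fix x assume "x \<in> carrier G"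
    then obtain l :: int where l: "x = g [^]\<^bsub>G\<^esub> l"
      using carrier by auto
    show "\<exists>!m::_ \<Rightarrow> int. (\<forall>i. i \<notin> {c} \<longrightarrow> m i = 0) \<and> x = finprod G (\<lambda>i. g [^]\<^bsub>G\<^esub> m i) {c}"
    proof (rule ex1I [of _ "\<lambda>i. if i = c then l else 0"])
      fix m :: "_ \<Rightarrow> int" assume "(\<forall>i. i \<notin> {c} \<longrightarrow> m i = 0) \<and> x = finprod G (\<lambda>i. g [^]\<^bsub>G\<^esub> m i) {c}"
      then show "m = (\<lambda>i. if i = c then l else 0)"
        using l inj assms(3) by (auto simp: fun_eq_iff dest: injD)
    qed (use l assms(3) in auto)
  qed (use assms in auto)
qed

text \<open>For an exact sequence \<open>0 \<rightarrow> G\<^sub>1 \<rightarrow> G\<^sub>2 \<rightarrow> G\<^sub>3\<close>, a basis of \<open>G\<^sub>1\<close> together with one element of \<open>G\<^sub>2\<close> whose image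
  is a basis of \<open>G\<^sub>3\<close> forms a basis of \<open>G\<^sub>2\<close>.\<close>

lemma freely_generates_extend:
  assumes comm: "comm_group G1" "comm_group G2" "comm_group G3"
    and \<alpha>: "\<alpha> \<in> hom G1 G2" "inj_on \<alpha> (carrier G1)"
    and \<beta>: "\<beta> \<in> hom G2 G3" "kernel G2 G3 \<beta> = \<alpha> ` carrier G1"
    and I: "finite I" "c \<notin> I"
    and free1: "freely_generates G1 f I"
    and free3: "freely_generates G3 (\<lambda>_. \<beta> (f' c)) {c}"
    and f': "f' c \<in> carrier G2" "\<And>i. i \<in> I \<Longrightarrow> f' i = \<alpha> (f i)"
  shows "freely_generates G2 f' (insert c I)"
proof -
  interpret G1: comm_group G1 by fact
  interpret G2: comm_group G2 by fact
  interpret G3: comm_group G3 by fact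
  interpret \<alpha>: group_hom G1 G2 \<alpha>
    using \<alpha> by (simp add: group_hom_def group_hom_axioms_def G1.is_group G2.is_group)
  interpret \<beta>: group_hom G2 G3 \<beta>
    using \<beta> by (simp add: group_hom_def group_hom_axioms_def G3.is_group G2.is_group)
  have f: "f i \<in> carrier G1" if "i \<in> I" for i
    using free1 that by (auto simp: freely_generates_def)
  define P where "P m = finprod G1 (\<lambda>i. f i [^]\<^bsub>G1\<^esub> m i) I" for m :: "_ \<Rightarrow> int"
  have Pc: "P m \<in> carrier G1" for m
    unfolding P_def using f by (intro G1.finprod_closed) auto
  have fin: "finprod G2 (\<lambda>i. f' i [^]\<^bsub>G2\<^esub> m i) (insert c I) = f' c [^]\<^bsub>G2\<^esub> m c \<otimes>\<^bsub>G2\<^esub> \<alpha> (P m)" for m :: "_ \<Rightarrow> int"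
  proof -
    have "finprod G2 (\<lambda>i. f' i [^]\<^bsub>G2\<^esub> m i) (insert c I)
        = f' c [^]\<^bsub>G2\<^esub> m c \<otimes>\<^bsub>G2\<^esub> finprod G2 (\<lambda>i. f' i [^]\<^bsub>G2\<^esub> m i) I"
      using I f' f by (intro G2.finprod_insert) auto
    also have "finprod G2 (\<lambda>i. f' i [^]\<^bsub>G2\<^esub> m i) I = \<alpha> (P m)"
      unfolding P_def using f f' \<alpha>(1)
      by (subst hom_finprod [OF comm(1,2) \<alpha>(1)]) (auto intro!: G2.finprod_cong' simp: \<alpha>.hom_int_pow)
    finally show ?thesis .
  qed
  have \<beta>\<alpha>: "\<beta> (\<alpha> y) = \<one>\<^bsub>G3\<^esub>" if "y \<in> carrier G1" for y
    using \<beta>(2) that by (auto simp: kernel_def)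
  have \<beta>fin: "\<beta> (f' c [^]\<^bsub>G2\<^esub> k \<otimes>\<^bsub>G2\<^esub> \<alpha> (P m)) = \<beta> (f' c) [^]\<^bsub>G3\<^esub> k" for m and k :: int
    using f' Pc by (simp add: \<beta>.hom_int_pow \<beta>\<alpha>)
  have ex3: "\<exists>k::int. y = \<beta> (f' c) [^]\<^bsub>G3\<^esub> k" if "y \<in> carrier G3" for y
    using free3 that f'(1) by (fastforce simp: freely_generates_def)
  have uniq3: "k = l" if eq: "\<beta> (f' c) [^]\<^bsub>G3\<^esub> k = \<beta> (f' c) [^]\<^bsub>G3\<^esub> l" for k l :: int
  proof -
    let ?m = "\<lambda>k i. if i = c then k else (0::int)"
    have fp: "finprod G3 (\<lambda>i. \<beta> (f' c) [^]\<^bsub>G3\<^esub> (m i::int)) {c} = \<beta> (f' c) [^]\<^bsub>G3\<^esub> m c" for m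
      using f'(1) by simp
    have "\<beta> (f' c) [^]\<^bsub>G3\<^esub> k \<in> carrier G3"
      using f'(1) by simp
    define R where "R m \<longleftrightarrow> (\<forall>i. i \<notin> {c} \<longrightarrow> m i = 0) \<and> \<beta> (f' c) [^]\<^bsub>G3\<^esub> k = finprod G3 (\<lambda>i. \<beta> (f' c) [^]\<^bsub>G3\<^esub> (m i::int)) {c}"
      for m
    have "\<exists>!m. R m"
      using free3 \<open>\<beta> (f' c) [^]\<^bsub>G3\<^esub> k \<in> carrier G3\<close> unfolding freely_generates_def R_def by blast
    moreover have "R (?m k)" "R (?m l)"
      unfolding R_def fp by (simp_all add: eq)
    ultimately have "?m k = ?m l"
      by blast
    then have "?m k c = ?m l c" by (rule fun_cong)
    then show ?thesis by simp
  qed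
  show ?thesis
    unfolding freely_generates_def
  proof (intro conjI ballI)
    show "f' \<in> insert c I \<rightarrow> carrier G2"
      using f' f by auto
    fix x assume x: "x \<in> carrier G2"
    obtain k :: int where k: "\<beta> x = \<beta> (f' c) [^]\<^bsub>G3\<^esub> k"
      using ex3 [OF \<beta>.hom_closed [OF x]] by auto
    \<comment> \<open>The coefficient of the new element is read off in \<open>G\<^sub>3\<close>; the remainder comes from \<open>G\<^sub>1\<close>.\<close>
    let ?z = "inv\<^bsub>G2\<^esub> (f' c [^]\<^bsub>G2\<^esub> k) \<otimes>\<^bsub>G2\<^esub> x"
    have "\<beta> ?z = \<one>\<^bsub>G3\<^esub>"
      using x f'(1) k by (simp add: \<beta>.hom_int_pow)
    then have "?z \<in> \<alpha> ` carrier G1"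
      using x f'(1) by (auto simp: kernel_def simp flip: \<beta>(2))
    then obtain y where y: "y \<in> carrier G1" "?z = \<alpha> y"
      by auto
    have ex1: "\<exists>!m. (\<forall>i. i \<notin> I \<longrightarrow> m i = 0) \<and> y = P m"
      using free1 y(1) unfolding freely_generates_def P_def by blast
    define m where "m = (THE m. (\<forall>i. i \<notin> I \<longrightarrow> m i = 0) \<and> y = P m)"
    have m: "\<And>i. i \<notin> I \<Longrightarrow> m i = 0" "y = P m"
      using theI' [OF ex1] by (simp_all add: m_def)
    have um: "m' = m" if "(\<forall>i. i \<notin> I \<longrightarrow> m' i = 0) \<and> y = P m'" for m'
      using the1_equality [OF ex1, of m'] that by (auto simp: m_def)
    have xz: "x = f' c [^]\<^bsub>G2\<^esub> k \<otimes>\<^bsub>G2\<^esub> \<alpha> y"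
      using x f'(1) by (simp flip: y(2) G2.m_assoc)
    have Pupd: "P (m(c := j)) = P m" for m j
      unfolding P_def using I f by (intro G1.finprod_cong') auto
    show "\<exists>!m::_ \<Rightarrow> int. (\<forall>i. i \<notin> insert c I \<longrightarrow> m i = 0) \<and> x = finprod G2 (\<lambda>i. f' i [^]\<^bsub>G2\<^esub> m i) (insert c I)"
    proof (rule ex1I [of _ "m(c := k)"])
      show "(\<forall>i. i \<notin> insert c I \<longrightarrow> (m(c := k)) i = 0) \<and> x = finprod G2 (\<lambda>i. f' i [^]\<^bsub>G2\<^esub> (m(c := k)) i) (insert c I)"
        unfolding fin Pupd using m xz by auto
      fix m' :: "_ \<Rightarrow> int" assume m': "(\<forall>i. i \<notin> insert c I \<longrightarrow> m' i = 0) \<and> x = finprod G2 (\<lambda>i. f' i [^]\<^bsub>G2\<^esub> m' i) (insert c I)"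
      then have x': "x = f' c [^]\<^bsub>G2\<^esub> m' c \<otimes>\<^bsub>G2\<^esub> \<alpha> (P m')"
        by (simp add: fin)
      then have "\<beta> (f' c) [^]\<^bsub>G3\<^esub> m' c = \<beta> (f' c) [^]\<^bsub>G3\<^esub> k"
        using k \<beta>fin by metis
      then have mc: "m' c = k"
        by (rule uniq3)
      then have "\<alpha> (P m') = \<alpha> y"
        using x' xz f'(1) Pc y by simp
      then have "P m' = y"
        using \<alpha>(2) Pc y by (auto dest: inj_onD)
      then have "m'(c := 0) = m"
        using m' by (intro um) (auto simp: Pupd)
      then show "m' = m(c := k)"
        using mc by auto
    qed
  qed
qed

section \<open>Cellular chain groups\<close>

locale cell_structure =
  fixes X :: "('a, 'c) cell_complex"
  assumes finite_cells: "finite (cells X)"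
    and Hausdorff: "Hausdorff_space (underlying X)"
    and cont: "\<And>c. c \<in> cells X \<Longrightarrow> continuous_map (disk (cell_dim X c)) (underlying X) (char_map X c)"
    and inj: "\<And>c. c \<in> cells X \<Longrightarrow> inj_on (char_map X c) (open_disk (cell_dim X c))"
    and disjoint: "disjoint_family_on (open_cell X) (cells X)"
    and sphere: "\<And>c. c \<in> cells X \<Longrightarrow> char_map X c ` unit_sphere (cell_dim X c)
        \<subseteq> (\<Union>d\<in>{d \<in> cells X. cell_dim X d < cell_dim X c}. open_cell X d)"

lemma cell_structure_of_finite_CW_complex:
  assumes "finite_CW_complex X"
  shows "cell_structure X"
proof
  fix c assume c: "c \<in> cells X"
  then have "homeomorphic_map (subtopology (disk (cell_dim X c)) (open_disk (cell_dim X c)))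
      (subtopology (underlying X) (open_cell X c)) (char_map X c)"
    using assms by (simp add: finite_CW_complex_def)
  then have "inj_on (char_map X c) (topspace (subtopology (disk (cell_dim X c)) (open_disk (cell_dim X c))))"
    by (rule homeomorphic_imp_injective_map)
  then show "inj_on (char_map X c) (open_disk (cell_dim X c))"
    by (rule inj_on_subset) (auto simp: open_disk_eq_inner_disk inner_disk_def)
qed (use assms in \<open>simp_all add: finite_CW_complex_def\<close>)

lemma disk_generator:
  "disk_generator n \<in> carrier (relative_homology_group (int n) (disk n) (unit_sphere n))"
  "subgroup_generated (relative_homology_group (int n) (disk n) (unit_sphere n)) {disk_generator n}
    = relative_homology_group (int n) (disk n) (unit_sphere n)"
proof -
  have "cyclic_group (relative_homology_group (int n) (disk n) (unit_sphere n))"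
    using isomorphic_group_cyclicity [OF relative_homology_disk_sphere(1) [of n]] by simp
  then have "\<exists>g. g \<in> carrier (relative_homology_group (int n) (disk n) (unit_sphere n)) \<and>
        subgroup_generated (relative_homology_group (int n) (disk n) (unit_sphere n)) {g}
          = relative_homology_group (int n) (disk n) (unit_sphere n)"
    by (auto simp: cyclic_group_def)
  from someI_ex [OF this] show
    "disk_generator n \<in> carrier (relative_homology_group (int n) (disk n) (unit_sphere n))"
    "subgroup_generated (relative_homology_group (int n) (disk n) (unit_sphere n)) {disk_generator n}
      = relative_homology_group (int n) (disk n) (unit_sphere n)"
    by (simp_all add: disk_generator_def)
qed

context cell_structure begin

definition union_of_cells :: "'c set \<Rightarrow> 'a set" where
  "union_of_cells S = (\<Union>c\<in>S. open_cell X c)"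

lemma topspace_disk_eq: "topspace (disk n) = open_disk n \<union> unit_sphere n"
  by (auto simp: open_disk_eq_inner_disk unit_sphere_eq_annulus inner_disk_def annulus_def)

lemma image_topspace_disk:
  "char_map X c ` topspace (disk (cell_dim X c)) = open_cell X c \<union> char_map X c ` unit_sphere (cell_dim X c)"
  by (auto simp: topspace_disk_eq open_cell_def)

lemma closed_cell_subset:
  "c \<in> cells X \<Longrightarrow> char_map X c ` topspace (disk (cell_dim X c))
     \<subseteq> open_cell X c \<union> union_of_cells {d \<in> cells X. cell_dim X d < cell_dim X c}"
  using sphere [of c] by (auto simp: image_topspace_disk union_of_cells_def)

lemma closedin_closed_cell:
  assumes "c \<in> cells X"
  shows "closedin (underlying X) (char_map X c ` topspace (disk (cell_dim X c)))"
proof -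
  have "compactin (underlying X) (char_map X c ` topspace (disk (cell_dim X c)))"
    using image_compactin [OF _ cont [OF assms]] compact_space_disk by (simp add: compact_space_def)
  then show ?thesis
    using Hausdorff compactin_imp_closedin by blast
qed

text \<open>A closed cell is the image of a compact disk in a Hausdorff space, hence closed, and there are only
  finitely many cells.\<close>

lemma closedin_union_of_cells:
  assumes S: "S \<subseteq> cells X" "\<And>c. c \<in> S \<Longrightarrow> char_map X c ` topspace (disk (cell_dim X c)) \<subseteq> union_of_cells S"
  shows "closedin (underlying X) (union_of_cells S)"
proof -
  have "open_cell X c \<subseteq> char_map X c ` topspace (disk (cell_dim X c))" for c
    by (auto simp: image_topspace_disk)
  then have "union_of_cells S = (\<Union>c\<in>S. char_map X c ` topspace (disk (cell_dim X c)))"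
    using S(2) by (fastforce simp: union_of_cells_def)
  moreover have "closedin (underlying X) (\<Union>c\<in>S. char_map X c ` topspace (disk (cell_dim X c)))"
    using S(1) finite_subset [OF S(1) finite_cells] by (auto intro!: closedin_Union closedin_closed_cell)
  ultimately show ?thesis by simp
qed

text \<open>The \<open>(n - 1)\<close>-skeleton with the \<open>n\<close>-cells in \<open>S\<close>: a filtration between consecutive skeleta in
  which the cells are added one by one.\<close>

definition stage :: "nat \<Rightarrow> 'c set \<Rightarrow> 'a set" where
  "stage n S = union_of_cells ({c \<in> cells X. cell_dim X c < n} \<union> S)"

lemma stage_empty: "stage n {} = skeleton_set X (int n - 1)"
proof -
  have "{c \<in> cells X. cell_dim X c < n} = {c \<in> cells X. int (cell_dim X c) \<le> int n - 1}"
    by auto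
  then show ?thesis
    by (simp add: stage_def union_of_cells_def skeleton_set_def)
qed

lemma stage_full: "stage n (cells_of_dim X n) = skeleton_set X (int n)"
proof -
  have "{c \<in> cells X. cell_dim X c < n} \<union> cells_of_dim X n = {c \<in> cells X. int (cell_dim X c) \<le> int n}"
    by (auto simp: cells_of_dim_def)
  then show ?thesis
    by (simp add: stage_def union_of_cells_def skeleton_set_def)
qed

lemma stage_insert: "stage n (insert c S) = stage n S \<union> open_cell X c"
  by (auto simp: stage_def union_of_cells_def)

lemma stage_mono: "S \<subseteq> T \<Longrightarrow> stage n S \<subseteq> stage n T"
  by (auto simp: stage_def union_of_cells_def)

lemma closed_cell_subset_stage:
  assumes "c \<in> cells X" "cell_dim X c < n \<or> (c \<in> S \<and> cell_dim X c = n)"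
  shows "char_map X c ` topspace (disk (cell_dim X c)) \<subseteq> stage n S"
  using closed_cell_subset [OF assms(1)] assms by (fastforce simp: stage_def union_of_cells_def)

lemma closedin_stage:
  assumes "S \<subseteq> cells_of_dim X n"
  shows "closedin (underlying X) (stage n S)"
  unfolding stage_def
proof (rule closedin_union_of_cells)
  fix c assume "c \<in> {c \<in> cells X. cell_dim X c < n} \<union> S"
  then show "char_map X c ` topspace (disk (cell_dim X c)) \<subseteq> union_of_cells ({c \<in> cells X. cell_dim X c < n} \<union> S)"
    using closed_cell_subset_stage [of c n S] assms by (auto simp: stage_def cells_of_dim_def)
qed (use assms in \<open>auto simp: cells_of_dim_def\<close>)

lemma sphere_subset_stage:
  assumes "c \<in> cells_of_dim X n"
  shows "char_map X c ` unit_sphere n \<subseteq> stage n S"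
  using sphere [of c] assms by (auto simp: cells_of_dim_def stage_def union_of_cells_def)

lemma cell_attachment_stage:
  assumes S: "S \<subseteq> cells_of_dim X n" and c: "c \<in> cells_of_dim X n" "c \<notin> S"
  shows "cell_attachment (subtopology (underlying X) (stage n (insert c S))) (stage n S) n (char_map X c)"
proof
  have c': "c \<in> cells X" "cell_dim X c = n"
    using c by (auto simp: cells_of_dim_def)
  show "Hausdorff_space (subtopology (underlying X) (stage n (insert c S)))"
    by (simp add: Hausdorff Hausdorff_space_subtopology)
  show "closedin (subtopology (underlying X) (stage n (insert c S))) (stage n S)"
    using closedin_stage [OF S] stage_mono [of S "insert c S"] by (auto intro: closedin_subset_topspace)
  show "continuous_map (disk n) (subtopology (underlying X) (stage n (insert c S))) (char_map X c)"
    using cont [OF c'(1)] closed_cell_subset_stage [OF c'(1), of n "insert c S"] c'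
    by (auto simp: continuous_map_in_subtopology image_subset_iff)
  show "inj_on (char_map X c) (open_disk n)"
    using inj [OF c'(1)] c' by simp
  show "char_map X c ` unit_sphere n \<subseteq> stage n S"
    by (rule sphere_subset_stage [OF c(1)])
  have "open_cell X c \<inter> open_cell X d = {}" if "d \<in> cells X" "d \<noteq> c" for d
    using disjoint that c' by (auto simp: disjoint_family_on_def)
  then have "open_cell X c \<inter> stage n S = {}"
    using S c c' by (auto simp: stage_def union_of_cells_def cells_of_dim_def)
  then show "char_map X c ` open_disk n \<inter> stage n S = {}"
    using c' by (simp add: open_cell_def)
  have "stage n (insert c S) \<subseteq> topspace (underlying X)"
    using closedin_subset [OF closedin_stage [of "insert c S" n]] S c by simp
  then show "topspace (subtopology (underlying X) (stage n (insert c S))) = stage n S \<union> char_map X c ` open_disk n"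
    using stage_insert [of n c S] c' by (auto simp: open_cell_def)
qed

abbreviation stage_class :: "nat \<Rightarrow> 'c set \<Rightarrow> 'c \<Rightarrow> 'a chain set" where
  "stage_class n S c \<equiv> hom_induced (int n) (disk n) (unit_sphere n)
     (subtopology (underlying X) (stage n S)) (stage n {}) (char_map X c) (disk_generator n)"

text \<open>When the cell \<open>c\<close> is added to the stage \<open>A\<close>, giving \<open>Y\<close>, the pair \<open>(Y, A)\<close> has the homology of
  \<open>(D\<^sup>n, S\<^bsup>n-1\<^esup>)\<close>: it is trivial in degree \<open>n + 1\<close>, and in degree \<open>n\<close> it is freely generated by the class of
  \<open>c\<close>. The exact sequence of the triple \<open>(Y, A, B)\<close>, with \<open>B\<close> the \<open>(n - 1)\<close>-skeleton, therefore adds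
  exactly one free generator.\<close>

lemma freely_generates_stage:
  assumes "S \<subseteq> cells_of_dim X n"
  shows "freely_generates (relative_homology_group (int n) (subtopology (underlying X) (stage n S)) (stage n {}))
           (stage_class n S) S"
proof -
  have "finite S"
    using assms finite_cells by (auto simp: cells_of_dim_def intro: finite_subset)
  then show ?thesis
    using assms
  proof (induction S rule: finite_induct)
    case empty
    let ?G = "relative_homology_group (int n) (subtopology (underlying X) (stage n {})) (stage n {})"
    have "topspace (subtopology (underlying X) (stage n {})) = stage n {}"
      using closedin_subset [OF closedin_stage [of "{}" n]] by auto
    then have "trivial_group ?G"
      using trivial_relative_homology_group_topspace [of "int n" "subtopology (underlying X) (stage n {})"] by simp
    then have one: "x = \<one>\<^bsub>?G\<^esub>" if "x \<in> carrier ?G" for x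
      using that by (auto simp: trivial_group_def)
    have "\<exists>!m::'c \<Rightarrow> int. (\<forall>i. i \<notin> {} \<longrightarrow> m i = 0) \<and> x = finprod ?G (\<lambda>i. stage_class n {} i [^]\<^bsub>?G\<^esub> m i) {}"
      if "x \<in> carrier ?G" for x
    proof (rule ex1I [of _ "\<lambda>_. 0"])
      fix m :: "'c \<Rightarrow> int"
      assume "(\<forall>i. i \<notin> {} \<longrightarrow> m i = 0) \<and> x = finprod ?G (\<lambda>i. stage_class n {} i [^]\<^bsub>?G\<^esub> m i) {}"
      then have "\<forall>i. i \<notin> {} \<longrightarrow> m i = 0" by (rule conjunct1)
      then show "m = (\<lambda>_. 0)" by (simp add: fun_eq_iff)
    next
      show "(\<forall>i. i \<notin> {} \<longrightarrow> (0::int) = 0) \<and> x = finprod ?G (\<lambda>i. stage_class n {} i [^]\<^bsub>?G\<^esub> (0::int)) {}"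
        by (simp only: simp_thms one [OF that] comm_monoid.finprod_empty [OF comm_group.axioms(1) [OF abelian_relative_homology_group]])
    qed
    note * = this
    show ?case
      unfolding freely_generates_def by (intro conjI ballI *) simp_all
  next
    case (insert c S)
    let ?Y = "subtopology (underlying X) (stage n (insert c S))"
    let ?Z = "subtopology (underlying X) (stage n S)"
    let ?A = "stage n S" and ?B = "stage n {}"
    have c: "c \<in> cells_of_dim X n" "c \<in> cells X" "cell_dim X c = n"
      using insert by (auto simp: cells_of_dim_def)
    have S: "S \<subseteq> cells_of_dim X n"
      using insert by simp
    have YA: "subtopology ?Y ?A = ?Z"
      using stage_mono [of S "insert c S" n] by (simp add: subtopology_subtopology Int_absorb1 subset_insertI)
    have BA: "?B \<subseteq> ?A"
      by (rule stage_mono) auto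
    interpret cell_attachment ?Y ?A n "char_map X c"
      by (rule cell_attachment_stage [OF S c(1) insert(2)])
    let ?i = "\<lambda>p. hom_induced p (disk n) (unit_sphere n) ?Y ?A (char_map X c)"
    have iso: "?i p \<in> iso (relative_homology_group p (disk n) (unit_sphere n)) (relative_homology_group p ?Y ?A)" for p
      by (rule iso_hom_induced_char)
    have triv: "trivial_group (relative_homology_group (int n + 1) ?Y ?A)"
      using iso [of "int n + 1"] relative_homology_disk_sphere(2) [of "int n + 1" n] isomorphic_group_triviality
      by (metis add_cancel_left_right group_relative_homology_group is_isoI zero_neq_one)
    let ?G1 = "relative_homology_group (int n) ?Z ?B"
    let ?G2 = "relative_homology_group (int n) ?Y ?B"
    let ?G3 = "relative_homology_group (int n) ?Y ?A"
    let ?\<alpha> = "hom_induced (int n) ?Z ?B ?Y ?B id"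
    let ?\<beta> = "hom_induced (int n) ?Y ?B ?Y ?A id"
    have "exact_seq ([?G3, ?G2, ?G1], [?\<beta>, ?\<alpha>])"
      using homology_exactness_triple_3 [OF BA, of "int n" ?Y] by (simp only: YA)
    then have ker: "kernel ?G2 ?G3 ?\<beta> = ?\<alpha> ` carrier ?G1"
      by simp
    have "exact_seq ([?G2, ?G1, relative_homology_group (int n + 1) ?Y ?A],
        [?\<alpha>, hom_relboundary (int n + 1) ?Y ?A ?B])"
      using homology_exactness_triple_2 [OF BA, of "int n + 1" ?Y] by (simp add: YA)
    then have "kernel ?G1 ?G2 ?\<alpha> = hom_relboundary (int n + 1) ?Y ?A ?B ` carrier (relative_homology_group (int n + 1) ?Y ?A)"
      and hom1: "group_hom (relative_homology_group (int n + 1) ?Y ?A) ?G1 (hom_relboundary (int n + 1) ?Y ?A ?B)"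
      by simp_all
    then have "kernel ?G1 ?G2 ?\<alpha> = {\<one>\<^bsub>?G1\<^esub>}"
      using triv group_hom.hom_one [OF hom1] by (auto simp: trivial_group_def)
    moreover have gh: "group_hom ?G1 ?G2 ?\<alpha>"
      by (simp add: group_hom_def group_hom_axioms_def hom_induced_hom)
    ultimately have inj\<alpha>: "inj_on ?\<alpha> (carrier ?G1)"
      using group_hom.trivial_ker_imp_inj by blast
    have gen3: "freely_generates ?G3 (\<lambda>_. ?\<beta> (stage_class n (insert c S) c)) {c}"
    proof -
      have eq: "?\<beta> (stage_class n (insert c S) c) = ?i (int n) (disk_generator n)"
        using cont sphere_subset_stage [OF c(1), of "{}"] BA
        by (subst hom_induced_compose') (auto simp: image_subset_iff)
      have g: "?i (int n) (disk_generator n) \<in> carrier ?G3"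
        by (rule hom_induced_carrier)
      let ?D = "relative_homology_group (int n) (disk n) (unit_sphere n)"
      have I: "?i (int n) \<in> hom ?D ?G3" "?i (int n) ` carrier ?D = carrier ?G3"
        using iso [of "int n"] by (auto simp: iso_iff)
      have "carrier ?D = range (\<lambda>k::int. disk_generator n [^]\<^bsub>?D\<^esub> k)"
        using disk_generator [of n] group.carrier_subgroup_generated_by_singleton [OF group_relative_homology_group]
        by metis
      then have "carrier ?G3 = range (\<lambda>k::int. ?i (int n) (disk_generator n) [^]\<^bsub>?G3\<^esub> k)"
        using I disk_generator(1) [of n] hom_int_pow [OF I(1) disk_generator(1)]
        by (auto simp: image_image simp flip: I(2))
      then have "carrier (subgroup_generated ?G3 {?i (int n) (disk_generator n)}) = carrier ?G3"
        using group.carrier_subgroup_generated_by_singleton [OF group_relative_homology_group g] by metis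
      then have sg: "subgroup_generated ?G3 {?i (int n) (disk_generator n)} = ?G3"
        by (simp add: group.subgroup_generated_group_carrier subgroup_generated_def)
      have "?G3 \<cong> integer_group"
        using iso [of "int n"] relative_homology_disk_sphere(1) [of n]
        by (meson group.iso_sym group_relative_homology_group is_isoI iso_trans)
      then show ?thesis
        unfolding eq using g sg by (intro freely_generates_singleton) auto
    qed
    show ?case
    proof (rule freely_generates_extend [where f = "stage_class n S" and \<alpha> = ?\<alpha> and \<beta> = ?\<beta>])
      show "freely_generates ?G1 (stage_class n S) S"
        by (rule insert.IH [OF S])
      fix d assume d: "d \<in> S"
      then have d': "d \<in> cells_of_dim X n" "d \<in> cells X" "cell_dim X d = n"
        using S by (auto simp: cells_of_dim_def)
      have "continuous_map (disk n) ?Z (char_map X d)"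
        using cell_structure.cont [OF cell_structure_axioms d'(2)] closed_cell_subset_stage [OF d'(2), of n S] d d'
        by (auto simp: continuous_map_in_subtopology image_subset_iff)
      then show "stage_class n (insert c S) d = ?\<alpha> (stage_class n S d)"
        using sphere_subset_stage [OF d'(1), of "{}"] stage_mono [OF subset_insertI, of n S c]
        by (subst hom_induced_compose') (auto simp: image_subset_iff continuous_map_in_subtopology)
    qed (use insert.hyps inj\<alpha> ker gen3 in \<open>auto simp: hom_induced_hom hom_induced_carrier\<close>)
  qed
qed

lemma freely_generates_cell_class:
  "freely_generates (relative_homology_group (int n) (skeleton_top X (int n)) (skeleton_set X (int n - 1)))
     (cell_class X) (cells_of_dim X n)"
proof -
  let ?G = "relative_homology_group (int n) (skeleton_top X (int n)) (skeleton_set X (int n - 1))"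
  have eq: "cell_class X c = stage_class n (cells_of_dim X n) c" if "c \<in> cells_of_dim X n" for c
  proof -
    have "cell_dim X c = n"
      using that by (simp add: cells_of_dim_def)
    then show ?thesis
      by (simp add: cell_class_def stage_full stage_empty skeleton_top_def)
  qed
  have gen: "freely_generates ?G (stage_class n (cells_of_dim X n)) (cells_of_dim X n)"
    using freely_generates_stage [OF subset_refl, of n]
    by (simp add: stage_full stage_empty skeleton_top_def)
  have "finprod ?G (\<lambda>i. cell_class X i [^]\<^bsub>?G\<^esub> m i) (cells_of_dim X n)
      = finprod ?G (\<lambda>i. stage_class n (cells_of_dim X n) i [^]\<^bsub>?G\<^esub> m i) (cells_of_dim X n)" for m :: "'c \<Rightarrow> int"
    using gen eq
    by (intro comm_monoid.finprod_cong' comm_group.axioms(1) abelian_relative_homology_group)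
       (auto simp: freely_generates_def intro!: group.int_pow_closed)
  then show ?thesis
    using gen eq by (simp add: freely_generates_def Pi_iff)
qed

end

section \<open>Incidence numbers and the cellular boundary\<close>

lemma finprod_int_pow:
  assumes "comm_group G" "f \<in> I \<rightarrow> carrier G"
  shows "finprod G f I [^]\<^bsub>G\<^esub> (k::int) = finprod G (\<lambda>i. f i [^]\<^bsub>G\<^esub> k) I"
proof -
  interpret comm_group G by fact
  have "(\<lambda>x. x [^]\<^bsub>G\<^esub> k) \<in> hom G G"
    by (auto simp: hom_def int_pow_distrib)
  from hom_finprod [OF assms(1,1) this assms(2)] show ?thesis .
qed

lemma finprod_finprod_int_pow:
  fixes a :: "'j \<Rightarrow> int" and b :: "'j \<Rightarrow> 'i \<Rightarrow> int"
  assumes "comm_group G" "f \<in> I \<rightarrow> carrier G" "finite J"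
  shows "finprod G (\<lambda>j. finprod G (\<lambda>i. f i [^]\<^bsub>G\<^esub> b j i) I [^]\<^bsub>G\<^esub> a j) J
       = finprod G (\<lambda>i. f i [^]\<^bsub>G\<^esub> (\<Sum>j\<in>J. a j * b j i)) I"
  using assms(3)
proof (induction J rule: finite_induct)
  case empty
  interpret comm_group G by fact
  show ?case by (simp add: finprod_one_eqI)
next
  case (insert j J)
  interpret comm_group G by fact
  have f: "f i \<in> carrier G" if "i \<in> I" for i
    using assms(2) that by blast
  have c: "finprod G (\<lambda>i. f i [^]\<^bsub>G\<^esub> m i) I \<in> carrier G" for m :: "'i \<Rightarrow> int"
    using assms(2) by (intro finprod_closed) auto
  have "finprod G (\<lambda>j. finprod G (\<lambda>i. f i [^]\<^bsub>G\<^esub> b j i) I [^]\<^bsub>G\<^esub> a j) (insert j J)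
      = finprod G (\<lambda>i. f i [^]\<^bsub>G\<^esub> b j i) I [^]\<^bsub>G\<^esub> a j \<otimes>\<^bsub>G\<^esub> finprod G (\<lambda>i. f i [^]\<^bsub>G\<^esub> (\<Sum>j\<in>J. a j * b j i)) I"
    using insert c by (subst finprod_insert) (auto simp: int_pow_closed)
  also have "finprod G (\<lambda>i. f i [^]\<^bsub>G\<^esub> b j i) I [^]\<^bsub>G\<^esub> a j = finprod G (\<lambda>i. f i [^]\<^bsub>G\<^esub> (a j * b j i)) I"
    using assms(2) by (subst finprod_int_pow [OF assms(1)])
      (auto intro!: finprod_cong' simp: f int_pow_pow mult.commute)
  also have "\<dots> \<otimes>\<^bsub>G\<^esub> finprod G (\<lambda>i. f i [^]\<^bsub>G\<^esub> (\<Sum>j\<in>J. a j * b j i)) I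
      = finprod G (\<lambda>i. f i [^]\<^bsub>G\<^esub> (\<Sum>j\<in>insert j J. a j * b j i)) I"
  proof (subst finprod_multf [symmetric])
    show "finprod G (\<lambda>i. f i [^]\<^bsub>G\<^esub> (a j * b j i) \<otimes>\<^bsub>G\<^esub> f i [^]\<^bsub>G\<^esub> (\<Sum>j\<in>J. a j * b j i)) I
      = finprod G (\<lambda>i. f i [^]\<^bsub>G\<^esub> (\<Sum>j\<in>insert j J. a j * b j i)) I"
      using insert.hyps by (intro finprod_cong') (auto simp: f int_pow_mult)
  qed (auto simp: f)
  finally show ?case .
qed

text \<open>The composition contains two consecutive maps \<open>H(Y) \<rightarrow> H(Y, T) \<rightarrow> H(T)\<close> of the exact sequence of a pair.\<close>

lemma hom_relboundary_hom_relboundary: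
  "hom_relboundary (p - 1) (subtopology X S) T U (hom_relboundary p X S T x)
   = \<one>\<^bsub>relative_homology_group (p - 1 - 1) (subtopology (subtopology X S) T) U\<^esub>"
proof -
  let ?Y = "subtopology X S"
  define y where "y = hom_boundary p X S x"
  have y: "y \<in> carrier (homology_group (p - 1) ?Y)"
    unfolding y_def by (rule hom_boundary_carrier)
  have "exact_seq ([homology_group (p - 1 - 1) (subtopology ?Y T), relative_homology_group (p - 1) ?Y T, homology_group (p - 1) ?Y],
              [hom_boundary (p - 1) ?Y T, hom_induced (p - 1) ?Y {} ?Y T id])"
    by (rule homology_exactness_axiom_1)
  then have "hom_induced (p - 1) ?Y {} ?Y T id y \<in> kernel (relative_homology_group (p - 1) ?Y T)
      (homology_group (p - 1 - 1) (subtopology ?Y T)) (hom_boundary (p - 1) ?Y T)"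
    using y by simp
  then have *: "hom_boundary (p - 1) ?Y T (hom_induced (p - 1) ?Y {} ?Y T id y)
      = \<one>\<^bsub>homology_group (p - 1 - 1) (subtopology ?Y T)\<^esub>"
    by (simp add: kernel_def)
  have "hom_induced (p - 1 - 1) (subtopology ?Y T) {} (subtopology ?Y T) U id
      \<one>\<^bsub>homology_group (p - 1 - 1) (subtopology ?Y T)\<^esub>
    = \<one>\<^bsub>relative_homology_group (p - 1 - 1) (subtopology ?Y T) U\<^esub>"
    by (rule hom_one [OF hom_induced_hom]) auto
  then show ?thesis
    unfolding hom_relboundary_def o_apply y_def [symmetric] * by simp
qed

context cell_structure begin

abbreviation cell_group :: "nat \<Rightarrow> 'a chain set monoid" where
  "cell_group n \<equiv> relative_homology_group (int n) (skeleton_top X (int n)) (skeleton_set X (int n - 1))"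

abbreviation cell_boundary :: "nat \<Rightarrow> 'a chain set \<Rightarrow> 'a chain set" where
  "cell_boundary n \<equiv> hom_relboundary (int (Suc n)) (skeleton_top X (int (Suc n)))
     (skeleton_set X (int n)) (skeleton_set X (int n - 1))"

lemma skeleton_set_mono: "j \<le> k \<Longrightarrow> skeleton_set X j \<subseteq> skeleton_set X k"
  by (auto simp: skeleton_set_def)

lemma subtopology_skeleton_top:
  "j \<le> k \<Longrightarrow> subtopology (skeleton_top X k) (skeleton_set X j) = skeleton_top X j"
  using skeleton_set_mono by (simp add: skeleton_top_def subtopology_subtopology Int_absorb1)

lemma incidence_eq_THE:
  assumes "cell_dim X c = Suc n"
  shows "incidence X c = (THE m. (\<forall>d. d \<notin> cells_of_dim X n \<longrightarrow> m d = 0) \<and>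
     cell_boundary n (cell_class X c)
       = finprod (cell_group n) (\<lambda>d. cell_class X d [^]\<^bsub>cell_group n\<^esub> m d) (cells_of_dim X n))"
proof -
  have *: "int (Suc n) - 1 = int n" "int (Suc n) - 2 = int n - 1" "Suc n - 1 = n"
    by auto
  show ?thesis
    unfolding incidence_def Let_def assms * ..
qed

lemma cell_boundary_hom: "cell_boundary n \<in> hom (cell_group (Suc n)) (cell_group n)"
  using group_homomorphism_hom_relboundary [of "int (Suc n)" "skeleton_top X (int (Suc n))"
      "skeleton_set X (int n)" "skeleton_set X (int n - 1)"]
  by (simp add: subtopology_skeleton_top)

lemma cell_class_in_carrier: "c \<in> cells_of_dim X n \<Longrightarrow> cell_class X c \<in> carrier (cell_group n)"
  using freely_generates_cell_class [of n] by (auto simp: freely_generates_def)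

text \<open>By free generation, exactly one coefficient function fits the description of the incidence numbers.\<close>

lemma incidence:
  assumes "c \<in> cells_of_dim X (Suc n)"
  shows "d \<notin> cells_of_dim X n \<Longrightarrow> incidence X c d = 0"
    and "cell_boundary n (cell_class X c)
      = finprod (cell_group n) (\<lambda>d. cell_class X d [^]\<^bsub>cell_group n\<^esub> incidence X c d) (cells_of_dim X n)"
proof -
  have dim: "cell_dim X c = Suc n"
    using assms by (simp add: cells_of_dim_def)
  have "cell_boundary n (cell_class X c) \<in> carrier (cell_group n)"
    using cell_boundary_hom cell_class_in_carrier [OF assms] by (rule hom_in_carrier)
  then have "\<exists>!m. (\<forall>d. d \<notin> cells_of_dim X n \<longrightarrow> m d = 0) \<and> cell_boundary n (cell_class X c)
     = finprod (cell_group n) (\<lambda>d. cell_class X d [^]\<^bsub>cell_group n\<^esub> (m d :: int)) (cells_of_dim X n)"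
    using freely_generates_cell_class [of n] unfolding freely_generates_def by (elim conjE) (rule bspec)
  from theI' [OF this, folded incidence_eq_THE [OF dim]]
  show "d \<notin> cells_of_dim X n \<Longrightarrow> incidence X c d = 0"
    and "cell_boundary n (cell_class X c)
      = finprod (cell_group n) (\<lambda>d. cell_class X d [^]\<^bsub>cell_group n\<^esub> incidence X c d) (cells_of_dim X n)"
    by simp_all
qed

text \<open>The sum is the coefficient of \<open>e\<close> in \<open>\<partial>\<partial>c\<close>, and the coefficients of the trivial element are unique.\<close>

lemma sum_incidence_incidence:
  assumes c: "c \<in> cells_of_dim X (Suc (Suc n))"
  shows "(\<Sum>d\<in>cells_of_dim X (Suc n). incidence X c d * incidence X d e) = 0"
proof -
  let ?G = "cell_group n" and ?H = "cell_group (Suc n)"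
  let ?C = "cells_of_dim X n" and ?D = "cells_of_dim X (Suc n)"
  define m where "m e = (\<Sum>d\<in>?D. incidence X c d * incidence X d e)" for e
  have fin: "finite ?D"
    using finite_cells by (simp add: cells_of_dim_def)
  have cls: "cell_class X \<in> ?C \<rightarrow> carrier ?G"
    using cell_class_in_carrier by blast
  have "cell_boundary n (cell_boundary (Suc n) (cell_class X c)) = \<one>\<^bsub>?G\<^esub>"
    using hom_relboundary_hom_relboundary [of "int (Suc (Suc n))" "skeleton_top X (int (Suc (Suc n)))"
        "skeleton_set X (int (Suc n))" "skeleton_set X (int n)" "skeleton_set X (int n - 1)" "cell_class X c"]
    by (simp add: subtopology_skeleton_top)
  also have "cell_boundary (Suc n) (cell_class X c) = finprod ?H (\<lambda>d. cell_class X d [^]\<^bsub>?H\<^esub> incidence X c d) ?D"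
    by (rule incidence(2) [OF c])
  also have "cell_boundary n \<dots> = finprod ?G (\<lambda>d. cell_boundary n (cell_class X d [^]\<^bsub>?H\<^esub> incidence X c d)) ?D"
    by (intro hom_finprod cell_boundary_hom abelian_relative_homology_group Pi_I
        group.int_pow_closed group_relative_homology_group cell_class_in_carrier)
  also have "\<dots> = finprod ?G (\<lambda>d. finprod ?G (\<lambda>e. cell_class X e [^]\<^bsub>?G\<^esub> incidence X d e) ?C [^]\<^bsub>?G\<^esub> incidence X c d) ?D"
  proof (intro comm_monoid.finprod_cong' comm_group.axioms(1) abelian_relative_homology_group refl)
    show "(\<lambda>d. finprod ?G (\<lambda>e. cell_class X e [^]\<^bsub>?G\<^esub> incidence X d e) ?C [^]\<^bsub>?G\<^esub> incidence X c d) \<in> ?D \<rightarrow> carrier ?G"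
      using cls by (auto intro!: group.int_pow_closed comm_monoid.finprod_closed comm_group.axioms(1))
    fix d assume d: "d \<in> ?D"
    show "cell_boundary n (cell_class X d [^]\<^bsub>?H\<^esub> incidence X c d)
      = finprod ?G (\<lambda>e. cell_class X e [^]\<^bsub>?G\<^esub> incidence X d e) ?C [^]\<^bsub>?G\<^esub> incidence X c d"
      unfolding incidence(2) [OF d, symmetric]
      by (rule hom_int_pow [OF cell_boundary_hom cell_class_in_carrier [OF d]]) auto
  qed
  also have "\<dots> = finprod ?G (\<lambda>e. cell_class X e [^]\<^bsub>?G\<^esub> m e) ?C"
    unfolding m_def by (rule finprod_finprod_int_pow [OF abelian_relative_homology_group cls fin])
  finally have one: "\<one>\<^bsub>?G\<^esub> = finprod ?G (\<lambda>e. cell_class X e [^]\<^bsub>?G\<^esub> m e) ?C" by (rule sym)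
  have one': "\<one>\<^bsub>?G\<^esub> = finprod ?G (\<lambda>e. cell_class X e [^]\<^bsub>?G\<^esub> (0::int)) ?C"
    by (rule sym, rule comm_monoid.finprod_one_eqI [OF comm_group.axioms(1) [OF abelian_relative_homology_group]]) simp
  have "m e = 0" if "e \<notin> ?C" for e
    unfolding m_def using that incidence(1) by (auto intro!: sum.neutral)
  \<comment> \<open>The property that has a unique solution is folded into a predicate, to instantiate uniqueness with
     \<open>m\<close> and with zero.\<close>
  moreover define R where "R m \<longleftrightarrow> (\<forall>i. i \<notin> ?C \<longrightarrow> m i = 0) \<and> \<one>\<^bsub>?G\<^esub> = finprod ?G (\<lambda>e. cell_class X e [^]\<^bsub>?G\<^esub> (m e :: int)) ?C" for m
  ultimately have "R m" "R (\<lambda>_. 0)"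
    using one one' by simp_all
  moreover have "\<one>\<^bsub>?G\<^esub> \<in> carrier ?G"
    by (rule monoid.one_closed) (simp add: group.is_monoid)
  then have "\<exists>!m. R m"
    using freely_generates_cell_class [of n] unfolding freely_generates_def R_def by (elim conjE) (rule bspec)
  ultimately have "m = (\<lambda>_. 0)"
    by blast
  then show ?thesis
    by (simp add: m_def fun_eq_iff)
qed

end

lemma bdry_bdry:
  fixes v :: "'r::comm_ring_1 ^ 'c::finite"
  assumes "cell_structure X"
  shows "bdry X (bdry X v) = 0"
proof -
  interpret cell_structure X by fact
  have "bdry X (bdry X v) $ e = 0" for e
  proof (cases "e \<in> cells X")
    case True
    let ?n = "cell_dim X e"
    let ?D = "cells_of_dim X (Suc ?n)" and ?C = "cells_of_dim X (Suc (Suc ?n))"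
    have "bdry X (bdry X v) $ e = (\<Sum>d\<in>?D. of_int (incidence X d e) * bdry X v $ d)"
      using True by (simp add: bdry_def)
    also have "\<dots> = (\<Sum>d\<in>?D. \<Sum>c\<in>?C. of_int (incidence X c d * incidence X d e) * v $ c)"
      by (intro sum.cong) (auto simp: bdry_def cells_of_dim_def sum_distrib_left mult_ac)
    also have "\<dots> = (\<Sum>c\<in>?C. of_int (\<Sum>d\<in>?D. incidence X c d * incidence X d e) * v $ c)"
      by (subst sum.swap) (simp add: sum_distrib_right)
    also have "\<dots> = 0"
      by (simp add: sum_incidence_incidence)
    finally show ?thesis .
  qed (simp add: bdry_def)
  then show ?thesis
    by (simp add: Finite_Cartesian_Product.vec_eq_iff)
qed

section \<open>Incidence numbers of subcomplexes\<close>

lemma restrict_cells_sel [simp]: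
  "cells (restrict_cells X S) = S" "cell_dim (restrict_cells X S) = cell_dim X"
  "char_map (restrict_cells X S) = char_map X"
  "underlying (restrict_cells X S) = subtopology (underlying X) (\<Union>c\<in>S. open_cell X c)"
  by (simp_all add: restrict_cells_def)

lemma open_cell_restrict_cells [simp]: "open_cell (restrict_cells X S) = open_cell X"
  by (simp add: open_cell_def fun_eq_iff)

text \<open>The shape of a spanning tree of the \<open>(k + 1)\<close>-skeleton.\<close>

locale full_subcomplex = cell_structure X for X :: "('a, 'c) cell_complex" +
  fixes S :: "'c set" and k :: nat
  assumes lower: "\<And>c. c \<in> cells X \<Longrightarrow> cell_dim X c \<le> k \<Longrightarrow> c \<in> S"
    and upper: "S \<subseteq> {c \<in> cells X. cell_dim X c \<le> Suc k}"
begin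

abbreviation "T \<equiv> restrict_cells X S"

lemma cells_of_dim_T: "j \<le> k \<Longrightarrow> cells_of_dim T j = cells_of_dim X j"
  using lower upper by (auto simp: cells_of_dim_def)

lemma skeleton_set_T: "j \<le> int k \<Longrightarrow> skeleton_set T j = skeleton_set X j"
proof -
  assume "j \<le> int k"
  then have "{c \<in> S. int (cell_dim X c) \<le> j} = {c \<in> cells X. int (cell_dim X c) \<le> j}"
    using lower upper by auto
  then show ?thesis by (simp add: skeleton_set_def)
qed

lemma skeleton_top_T: "skeleton_top T j = subtopology (underlying X) (skeleton_set T j)"
proof -
  have "skeleton_set T j \<subseteq> (\<Union>c\<in>S. open_cell X c)"
    by (auto simp: skeleton_set_def)
  then show ?thesis
    by (simp add: skeleton_top_def subtopology_subtopology Int_absorb1)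
qed

lemma cell_class_T: "cell_dim X c \<le> k \<Longrightarrow> cell_class T c = cell_class X c"
  unfolding cell_class_def Let_def restrict_cells_sel skeleton_top_T
  by (simp add: skeleton_set_T skeleton_top_def)

text \<open>The inclusion of the skeleton of \<open>T\<close> into that of \<open>X\<close> takes the class of \<open>c\<close> to the class of \<open>c\<close>. The
  boundary is natural and its target is the same for \<open>T\<close> and \<open>X\<close>, whose skeleta agree up to dimension
  \<open>n \<le> k\<close>.\<close>

lemma incidence_T:
  assumes "c \<in> S" "cell_dim X c = Suc n"
  shows "incidence T c = incidence X c"
proof -
  have n: "n \<le> k" and c: "c \<in> cells X" "c \<in> cells_of_dim X (Suc n)"
    using assms upper by (auto simp: cells_of_dim_def)
  let ?A = "skeleton_set X (int n)" and ?B = "skeleton_set X (int n - 1)"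
  let ?Y = "skeleton_top T (int (Suc n))" and ?Z = "skeleton_top X (int (Suc n))"
  have sets: "skeleton_set T (int n) = ?A" "skeleton_set T (int n - 1) = ?B"
    using n by (simp_all add: skeleton_set_T)
  have tops: "skeleton_top T (int n) = skeleton_top X (int n)"
    unfolding skeleton_top_T using n by (simp add: skeleton_set_T skeleton_top_def)
  have TX: "skeleton_set T j \<subseteq> skeleton_set X j" for j
    using upper by (auto simp: skeleton_set_def)
  have AY: "?A \<subseteq> skeleton_set T (int (Suc n))"
    unfolding sets(1) [symmetric] by (auto simp: skeleton_set_def)
  have YA: "subtopology ?Y ?A = skeleton_top X (int n)"
    unfolding skeleton_top_T using AY by (simp add: subtopology_subtopology Int_absorb1 skeleton_top_def)
  have ZA: "subtopology ?Z ?A = skeleton_top X (int n)"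
    by (simp add: subtopology_skeleton_top)
  have idYZ: "continuous_map ?Y ?Z id"
    unfolding skeleton_top_T using TX [of "int (Suc n)"]
    by (auto simp: skeleton_top_def continuous_map_in_subtopology continuous_map_from_subtopology)
  have sph: "char_map X c ` unit_sphere (Suc n) \<subseteq> ?A"
    using sphere_subset_stage [OF c(2), of "{}"] by (simp add: stage_empty)
  have "open_cell X c \<subseteq> skeleton_set T (int (Suc n))"
    using assms by (auto simp: skeleton_set_def)
  then have "char_map X c ` topspace (disk (Suc n)) \<subseteq> skeleton_set T (int (Suc n))"
    using sph AY image_topspace_disk [of c] assms(2) by auto
  then have contc: "continuous_map (disk (Suc n)) ?Y (char_map X c)"
    using cont [OF c(1)] assms(2) by (auto simp: skeleton_top_T continuous_map_in_subtopology image_subset_iff)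
  have push: "hom_induced (int (Suc n)) ?Y ?A ?Z ?A id (cell_class T c) = cell_class X c"
  proof -
    have T: "cell_class T c = hom_induced (int (Suc n)) (disk (Suc n)) (unit_sphere (Suc n)) ?Y ?A (char_map X c) (disk_generator (Suc n))"
      by (simp add: cell_class_def Let_def assms(2) sets)
    have X: "cell_class X c = hom_induced (int (Suc n)) (disk (Suc n)) (unit_sphere (Suc n)) ?Z ?A (char_map X c) (disk_generator (Suc n))"
      by (simp add: cell_class_def Let_def assms(2))
    show ?thesis
      unfolding T X using contc sph idYZ by (subst hom_induced_compose') (auto simp: image_subset_iff)
  qed
  have bd: "hom_relboundary (int (Suc n)) ?Y ?A ?B (cell_class T c) = cell_boundary n (cell_class X c)"
  proof -
    let ?b = "hom_relboundary (int (Suc n)) ?Y ?A ?B (cell_class T c)"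
    have "hom_relboundary (int (Suc n)) ?Z ?A ?B (hom_induced (int (Suc n)) ?Y ?A ?Z ?A id (cell_class T c))
       = hom_induced (int (Suc n) - 1) (subtopology ?Y ?A) ?B (subtopology ?Z ?A) ?B id ?b"
      using fun_cong [OF naturality_hom_induced_relboundary [OF idYZ, of ?A ?A ?B ?B "int (Suc n)"], of "cell_class T c"]
      by simp
    also have "\<dots> = ?b"
      unfolding ZA by (subst (1) YA, rule hom_induced_id) (metis YA hom_relboundary)
    finally show ?thesis
      unfolding push by (rule sym)
  qed
  have *: "int (Suc n) - 1 = int n" "int (Suc n) - 2 = int n - 1" "Suc n - 1 = n"
    by auto
  have dimT: "cell_dim T c = Suc n" using assms by simp
  have fp: "finprod (cell_group n) (\<lambda>d. cell_class T d [^]\<^bsub>cell_group n\<^esub> m d) (cells_of_dim X n)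
     = finprod (cell_group n) (\<lambda>d. cell_class X d [^]\<^bsub>cell_group n\<^esub> m d) (cells_of_dim X n)" for m :: "'c \<Rightarrow> int"
    using n cell_class_in_carrier [of _ n]
    by (intro comm_monoid.finprod_cong' comm_group.axioms(1) abelian_relative_homology_group)
       (auto intro!: group.int_pow_closed simp: cell_class_T cells_of_dim_def)
  show ?thesis
    unfolding incidence_eq_THE [OF assms(2)]
    unfolding incidence_def Let_def dimT * sets tops cells_of_dim_T [OF n] fp bd ..
qed

end

section \<open>Gram determinants\<close>

text \<open>Families of vectors are lists, so that the entries of matrices and the coefficients of combinations
  have the same index, and a repeated vector counts as a dependence.\<close>

definition lincomb :: "(nat \<Rightarrow> real) \<Rightarrow> 'v::real_vector list \<Rightarrow> 'v" where
  "lincomb a xs = (\<Sum>i<length xs. a i *\<^sub>R xs ! i)"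

definition lin_indep :: "'v::real_vector list \<Rightarrow> bool" where
  "lin_indep xs \<longleftrightarrow> (\<forall>a. lincomb a xs = 0 \<longrightarrow> (\<forall>i<length xs. a i = 0))"

lemma lincomb_append:
  "lincomb a (xs @ ys) = lincomb a xs + lincomb (\<lambda>i. a (length xs + i)) ys"
proof -
  have "lincomb a (xs @ ys) = (\<Sum>i<length xs. a i *\<^sub>R (xs @ ys) ! i) + (\<Sum>i\<in>{length xs..<length xs + length ys}. a i *\<^sub>R (xs @ ys) ! i)"
    by (simp add: lincomb_def lessThan_atLeast0 sum.atLeastLessThan_concat)
  also have "(\<Sum>i\<in>{length xs..<length xs + length ys}. a i *\<^sub>R (xs @ ys) ! i) = lincomb (\<lambda>i. a (length xs + i)) ys"
    unfolding lincomb_def lessThan_atLeast0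
    using sum.shift_bounds_nat_ivl [of "\<lambda>i. a i *\<^sub>R (xs @ ys) ! i" 0 "length xs" "length ys"]
    by (simp add: add.commute nth_append)
  finally show ?thesis
    by (simp add: lincomb_def nth_append)
qed

lemma lincomb_snoc: "lincomb a (xs @ [v]) = lincomb a xs + a (length xs) *\<^sub>R v"
  by (simp add: lincomb_append) (simp add: lincomb_def)

lemma lincomb_cong: "(\<And>i. i < length xs \<Longrightarrow> a i = b i) \<Longrightarrow> lincomb a xs = lincomb b xs"
  by (simp add: lincomb_def)

lemma lincomb_add: "lincomb (\<lambda>i. a i + b i) xs = lincomb a xs + lincomb b xs"
  by (simp add: lincomb_def scaleR_add_left sum.distrib)

lemma lincomb_diff: "lincomb (\<lambda>i. a i - b i) xs = lincomb a xs - lincomb b xs"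
  by (simp add: lincomb_def scaleR_diff_left sum_subtractf)

lemma lincomb_scale: "lincomb (\<lambda>i. r * a i) xs = r *\<^sub>R lincomb a xs"
  by (simp add: lincomb_def scaleR_sum_right)

lemma lincomb_zero [simp]: "lincomb (\<lambda>i. 0) xs = 0"
  by (simp add: lincomb_def)

lemma lincomb_unit: "j < length xs \<Longrightarrow> lincomb (\<lambda>i. if i = j then 1 else 0) xs = xs ! j"
  by (simp add: lincomb_def if_distrib [of "\<lambda>r. r *\<^sub>R _"] sum.delta cong: if_cong)

lemma lincomb_map:
  assumes "linear f" shows "lincomb a (map f xs) = f (lincomb a xs)"
  using assms by (simp add: lincomb_def linear_sum linear_scale)

lemma span_set_eq_lincomb: "span (set xs) = range (\<lambda>a. lincomb a xs)"
proof
  show "range (\<lambda>a. lincomb a xs) \<subseteq> span (set xs)"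
    unfolding lincomb_def by (auto intro!: span_sum span_scale intro: span_base)
  show "span (set xs) \<subseteq> range (\<lambda>a. lincomb a xs)"
  proof (rule span_minimal)
    show "set xs \<subseteq> range (\<lambda>a. lincomb a xs)"
      by (auto simp: in_set_conv_nth) (metis lincomb_unit rangeI)
    show "subspace (range (\<lambda>a. lincomb a xs))"
      unfolding subspace_def
    proof (intro conjI ballI allI)
      show "0 \<in> range (\<lambda>a. lincomb a xs)"
        by (metis lincomb_zero rangeI)
      fix x y assume "x \<in> range (\<lambda>a. lincomb a xs)" "y \<in> range (\<lambda>a. lincomb a xs)"
      then show "x + y \<in> range (\<lambda>a. lincomb a xs)"
        by (auto simp flip: lincomb_add)
    next
      fix c x assume "x \<in> range (\<lambda>a. lincomb a xs)"
      then show "c *\<^sub>R x \<in> range (\<lambda>a. lincomb a xs)"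
        by (auto simp flip: lincomb_scale)
    qed
  qed
qed

lemma lincomb_in_span: "lincomb a xs \<in> span (set xs)"
  by (simp add: span_set_eq_lincomb)

lemma lin_indepD: "lin_indep xs \<Longrightarrow> lincomb a xs = 0 \<Longrightarrow> i < length xs \<Longrightarrow> a i = 0"
  by (auto simp: lin_indep_def)

lemma lin_indep_unique:
  assumes "lin_indep xs" "lincomb a xs = lincomb b xs" "i < length xs"
  shows "a i = b i"
  using lin_indepD [OF assms(1) _ assms(3), of "\<lambda>i. a i - b i"] assms(2)
  by (simp add: lincomb_diff)

lemma lin_indep_iff: "lin_indep xs \<longleftrightarrow> distinct xs \<and> independent (set xs)"
proof
  assume li: "lin_indep xs"
  have d: "distinct xs"
    unfolding distinct_conv_nth
  proof (intro allI impI notI)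
    fix i j assume ij: "i < length xs" "j < length xs" "i \<noteq> j" "xs ! i = xs ! j"
    have "lincomb (\<lambda>l. (if l = i then 1 else 0) - (if l = j then 1 else 0)) xs = 0"
      using ij by (simp add: lincomb_diff lincomb_unit)
    from lin_indepD [OF li this ij(1)] ij(3) show False by simp
  qed
  have "independent (set xs)"
  proof (rule independent_if_scalars_zero)
    fix u x assume u: "(\<Sum>x\<in>set xs. u x *\<^sub>R x) = 0" and x: "x \<in> set xs"
    have "(\<Sum>x\<in>set xs. u x *\<^sub>R x) = lincomb (\<lambda>i. u (xs ! i)) xs"
      unfolding lincomb_def using bij_betw_nth [OF d refl refl]
      by (rule sum.reindex_bij_betw [symmetric])
    with u have "lincomb (\<lambda>i. u (xs ! i)) xs = 0" by simp
    with x li show "u x = 0"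
      by (auto simp: in_set_conv_nth dest: lin_indepD)
  qed simp
  with d show "distinct xs \<and> independent (set xs)" ..
next
  assume di: "distinct xs \<and> independent (set xs)"
  show "lin_indep xs"
    unfolding lin_indep_def
  proof (intro allI impI)
    fix a i assume a: "lincomb a xs = 0" and i: "i < length xs"
    have b: "bij_betw ((!) xs) {..<length xs} (set xs)"
      using di by (simp add: bij_betw_nth)
    define g where "g = inv_into {..<length xs} ((!) xs)"
    have g: "g (xs ! j) = j" if "j < length xs" for j
      using b that by (simp add: g_def bij_betw_inv_into_left)
    have "(\<Sum>x\<in>set xs. a (g x) *\<^sub>R x) = (\<Sum>j<length xs. a (g (xs ! j)) *\<^sub>R xs ! j)"
      using b by (rule sum.reindex_bij_betw [symmetric])
    also have "\<dots> = 0"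
      using a g by (simp add: lincomb_def)
    finally have "a (g (xs ! i)) = 0"
      using di i independentD [of "set xs" "set xs" "\<lambda>x. a (g x)" "xs ! i"] by simp
    then show "a i = 0" using g i by simp
  qed
qed

lemma length_eq_dim:
  fixes xs :: "'v::euclidean_space list"
  shows "lin_indep xs \<Longrightarrow> length xs = dim (span (set xs))"
  by (simp add: lin_indep_iff distinct_card dim_eq_card_independent del: dim_span) (simp add: dim_eq_card_independent distinct_card)

lemma lin_indep_snoc:
  "lin_indep (xs @ [v]) \<longleftrightarrow> lin_indep xs \<and> v \<notin> span (set xs)"
  by (auto simp: lin_indep_iff independent_insert span_base)

text \<open>The squared volume of the parallelepiped spanned by the list. The empty list has volume \<open>1\<close>.\<close>

definition gram :: "'v::euclidean_space list \<Rightarrow> real" where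
  "gram xs = Determinant.det (Matrix.mat (length xs) (length xs) (\<lambda>(i, j). inner (xs ! i) (xs ! j)))"

lemma gram_Nil [simp]: "gram [] = 1"
  by (simp add: gram_def)

lemma gram_singleton [simp]: "gram [x] = inner x x"
  by (simp add: gram_def det_single)

lemma inner_lincomb_left: "inner (lincomb a xs) y = (\<Sum>i<length xs. a i * inner (xs ! i) y)"
  by (simp add: lincomb_def inner_sum_left)

lemma inner_lincomb_right: "inner y (lincomb a xs) = (\<Sum>i<length xs. a i * inner y (xs ! i))"
  by (simp add: lincomb_def inner_sum_right)

text \<open>If \<open>A\<close> is the matrix of coefficients, the Gram matrices are related by \<open>G' = A\<^sup>T G A\<close>.\<close>

lemma gram_change_of_basis:
  assumes len: "length zs = length ys"
    and zs: "\<And>j. j < length ys \<Longrightarrow> zs ! j = lincomb (\<lambda>i. A i j) ys"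
  shows "gram zs = (Determinant.det (Matrix.mat (length ys) (length ys) (\<lambda>(i, j). A i j)))\<^sup>2 * gram ys"
proof -
  let ?n = "length ys"
  let ?A = "Matrix.mat ?n ?n (\<lambda>(i, j). A i j)"
  let ?G = "Matrix.mat ?n ?n (\<lambda>(i, j). inner (ys ! i) (ys ! j))"
  have "Matrix.mat ?n ?n (\<lambda>(i, j). inner (zs ! i) (zs ! j)) = transpose_mat ?A * (?G * ?A)"
    (is "?L = ?R")
  proof (rule eq_matI)
    fix i j assume "i < dim_row ?R" "j < dim_col ?R"
    then have ij: "i < ?n" "j < ?n" by auto
    have "inner (zs ! i) (zs ! j) = (\<Sum>k<?n. A k i * inner (ys ! k) (zs ! j))"
      using ij by (simp add: zs [of i] inner_lincomb_left)
    also have "\<dots> = (\<Sum>k<?n. A k i * (\<Sum>l<?n. A l j * inner (ys ! k) (ys ! l)))"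
      using ij by (simp add: zs [of j] inner_lincomb_right)
    finally show "?L $$ (i, j) = ?R $$ (i, j)"
      using ij by (simp add: scalar_prod_def lessThan_atLeast0 mult.commute)
  qed auto
  then have "gram zs = Determinant.det (transpose_mat ?A * (?G * ?A))"
    by (simp add: gram_def len)
  also have "\<dots> = Determinant.det (transpose_mat ?A) * (Determinant.det ?G * Determinant.det ?A)"
  proof -
    have c: "?A \<in> carrier_mat ?n ?n" "?G \<in> carrier_mat ?n ?n"
      "transpose_mat ?A \<in> carrier_mat ?n ?n" "?G * ?A \<in> carrier_mat ?n ?n"
      by auto
    show ?thesis
      using Determinant.det_mult [OF c(3,4)] Determinant.det_mult [OF c(2,1)] by simp
  qed
  also have "\<dots> = (Determinant.det ?A)\<^sup>2 * gram ys"
    by (simp add: Determinant.det_transpose [of _ ?n] gram_def power2_eq_square)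
  finally show ?thesis .
qed

lemma gram_append_orthogonal:
  assumes orth: "\<And>x y. x \<in> set xs \<Longrightarrow> y \<in> set ys \<Longrightarrow> inner x y = 0"
  shows "gram (xs @ ys) = gram xs * gram ys"
proof -
  let ?n = "length xs" and ?m = "length ys"
  let ?A = "Matrix.mat ?n ?n (\<lambda>(i, j). inner (xs ! i) (xs ! j))"
  let ?D = "Matrix.mat ?m ?m (\<lambda>(i, j). inner (ys ! i) (ys ! j))"
  have "Matrix.mat (?n + ?m) (?n + ?m) (\<lambda>(i, j). inner ((xs @ ys) ! i) ((xs @ ys) ! j))
      = four_block_mat ?A (0\<^sub>m ?n ?m) (0\<^sub>m ?m ?n) ?D"
    using orth by (intro eq_matI) (auto simp: nth_append inner_commute)
  then show ?thesis
    by (simp add: gram_def det_four_block_mat_lower_left_zero [of _ ?n _ ?m])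
qed

text \<open>Changing the later vectors by combinations of the earlier ones is a unitriangular change of basis, and
  afterwards the two blocks are orthogonal.\<close>

lemma gram_append:
  assumes len: "length ys' = length ys"
    and diff: "\<And>j. j < length ys \<Longrightarrow> ys ! j - ys' ! j \<in> span (set xs)"
    and orth: "\<And>x y. x \<in> set xs \<Longrightarrow> y \<in> set ys' \<Longrightarrow> inner x y = 0"
  shows "gram (xs @ ys) = gram xs * gram ys'"
proof -
  let ?n = "length xs" and ?m = "length ys"
  have "\<forall>j<?m. \<exists>a. ys ! j - ys' ! j = lincomb a xs"
    using diff by (auto simp: span_set_eq_lincomb)
  then obtain c where c: "\<And>j. j < ?m \<Longrightarrow> ys ! j - ys' ! j = lincomb (c j) xs"
    by metis
  define A :: "nat \<Rightarrow> nat \<Rightarrow> real"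
    where "A i j = (if i = j then 1 else if i < ?n \<and> ?n \<le> j then c (j - ?n) i else 0)" for i j
  have "gram (xs @ ys) = (Determinant.det (Matrix.mat (length (xs @ ys')) (length (xs @ ys')) (\<lambda>(i, j). A i j)))\<^sup>2 * gram (xs @ ys')"
  proof (rule gram_change_of_basis)
    fix j assume "j < length (xs @ ys')"
    then have j: "j < ?n + ?m" by (simp add: len)
    show "(xs @ ys) ! j = lincomb (\<lambda>i. A i j) (xs @ ys')"
    proof (cases "j < ?n")
      case True
      then have "(\<lambda>i. A i j) = (\<lambda>i. if i = j then 1 else 0)"
        by (auto simp: A_def)
      then show ?thesis
        using True j lincomb_unit [of j "xs @ ys'"] by (simp add: nth_append)
    next
      case False
      define l where "l = j - ?n"
      have l: "l < ?m" "j = ?n + l" using False j by (auto simp: l_def)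
      have "lincomb (\<lambda>i. A i j) xs = lincomb (c l) xs"
        by (rule lincomb_cong) (auto simp: A_def l)
      moreover have "(\<lambda>i. A (?n + i) j) = (\<lambda>i. if i = l then 1 else 0)"
        by (auto simp: A_def l)
      ultimately have "lincomb (\<lambda>i. A i j) (xs @ ys') = lincomb (c l) xs + ys' ! l"
        using l len lincomb_unit [of l ys'] by (simp add: lincomb_append)
      then show ?thesis
        using l c [of l] by (simp add: nth_append algebra_simps)
    qed
  qed (simp add: len)
  also have "Determinant.det (Matrix.mat (length (xs @ ys')) (length (xs @ ys')) (\<lambda>(i, j). A i j)) = 1"
  proof -
    let ?N = "length (xs @ ys')"
    have "upper_triangular (Matrix.mat ?N ?N (\<lambda>(i, j). A i j))"
      by (auto simp: upper_triangular_def A_def)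
    then have "Determinant.det (Matrix.mat ?N ?N (\<lambda>(i, j). A i j)) = prod_list (diag_mat (Matrix.mat ?N ?N (\<lambda>(i, j). A i j)))"
      by (rule det_upper_triangular) auto
    also have "diag_mat (Matrix.mat ?N ?N (\<lambda>(i, j). A i j)) = map (\<lambda>i. 1) [0..<?N]"
      unfolding diag_mat_def by (auto simp: A_def)
    finally show ?thesis
      by (simp add: map_replicate_const)
  qed
  finally show ?thesis
    using gram_append_orthogonal [of xs ys'] orth by simp
qed

text \<open>A vector \<open>a\<close> in the kernel of the Gram matrix gives a combination that is orthogonal to each of the
  vectors, hence to itself.\<close>

lemma gram_eq_0_iff: "gram xs = 0 \<longleftrightarrow> \<not> lin_indep xs"
proof -
  let ?n = "length xs"
  let ?G = "Matrix.mat ?n ?n (\<lambda>(i, j). inner (xs ! i) (xs ! j))"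
  have G: "?G \<in> carrier_mat ?n ?n" by simp
  have Gv: "(?G *\<^sub>v Matrix.vec ?n a = 0\<^sub>v ?n) \<longleftrightarrow> lincomb a xs = 0" for a
  proof -
    have "(?G *\<^sub>v Matrix.vec ?n a = 0\<^sub>v ?n) \<longleftrightarrow> (\<forall>i<?n. inner (xs ! i) (lincomb a xs) = 0)"
      by (auto simp: Matrix.vec_eq_iff scalar_prod_def inner_lincomb_right lessThan_atLeast0 mult.commute)
    also have "\<dots> \<longleftrightarrow> lincomb a xs = 0"
    proof
      assume "\<forall>i<?n. inner (xs ! i) (lincomb a xs) = 0"
      then have "inner (lincomb a xs) (lincomb a xs) = 0"
        by (subst inner_lincomb_left) simp
      then show "lincomb a xs = 0" by simp
    qed simp
    finally show ?thesis .
  qed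
  have "gram xs = 0 \<longleftrightarrow> (\<exists>v. v \<in> carrier_vec ?n \<and> v \<noteq> 0\<^sub>v ?n \<and> ?G *\<^sub>v v = 0\<^sub>v ?n)"
    unfolding gram_def by (rule det_0_iff_vec_prod_zero [OF G])
  also have "\<dots> \<longleftrightarrow> (\<exists>a. (\<exists>i<?n. a i \<noteq> 0) \<and> lincomb a xs = 0)"
  proof
    assume "\<exists>v. v \<in> carrier_vec ?n \<and> v \<noteq> 0\<^sub>v ?n \<and> ?G *\<^sub>v v = 0\<^sub>v ?n"
    then obtain v where v: "v \<in> carrier_vec ?n" "v \<noteq> 0\<^sub>v ?n" "?G *\<^sub>v v = 0\<^sub>v ?n" by blast
    define a where "a = vec_index v"
    have va: "v = Matrix.vec ?n a"
      using v by (auto simp: a_def)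
    then have "lincomb a xs = 0"
      using v(3) Gv [of a] by simp
    moreover have "\<exists>i<?n. a i \<noteq> 0"
      using v(2) unfolding va by (auto simp: Matrix.vec_eq_iff)
    ultimately show "\<exists>a. (\<exists>i<?n. a i \<noteq> 0) \<and> lincomb a xs = 0"
      by blast
  next
    assume "\<exists>a. (\<exists>i<?n. a i \<noteq> 0) \<and> lincomb a xs = 0"
    then obtain a where "\<exists>i<?n. a i \<noteq> 0" "lincomb a xs = 0" by blast
    then show "\<exists>v. v \<in> carrier_vec ?n \<and> v \<noteq> 0\<^sub>v ?n \<and> ?G *\<^sub>v v = 0\<^sub>v ?n"
      using Gv [of a] by (intro exI [of _ "Matrix.vec ?n a"]) (auto simp: Matrix.vec_eq_iff)
  qed
  also have "\<dots> \<longleftrightarrow> \<not> lin_indep xs"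
    by (auto simp: lin_indep_def)
  finally show ?thesis .
qed

text \<open>Volume is the volume of the base times the height \<open>w\<close>.\<close>

lemma gram_snoc:
  fixes v :: "'v::euclidean_space"
  obtains w where "v - w \<in> span (set xs)" "\<And>x. x \<in> span (set xs) \<Longrightarrow> inner x w = 0"
    "gram (xs @ [v]) = gram xs * inner w w"
proof -
  obtain y w where "y \<in> span (set xs)" and w: "\<And>x. x \<in> span (set xs) \<Longrightarrow> real_inner_class.orthogonal w x" and "v = y + w"
    using orthogonal_subspace_decomp_exists [of "set xs" v] by metis
  moreover have "gram (xs @ [v]) = gram xs * gram [w]"
    using calculation by (intro gram_append) (auto simp: real_inner_class.orthogonal_def inner_commute span_base)
  ultimately show thesis
    using that [of w] by (auto simp: real_inner_class.orthogonal_def inner_commute)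
qed

lemma gram_nonneg: "0 \<le> gram xs"
proof (induction xs rule: rev_induct)
  case (snoc v xs)
  show ?case
  proof (rule gram_snoc [of v xs])
    fix w assume "gram (xs @ [v]) = gram xs * inner w w"
    with snoc show ?thesis by simp
  qed
qed simp

lemma gram_pos: "lin_indep xs \<Longrightarrow> 0 < gram xs"
  using gram_nonneg [of xs] gram_eq_0_iff [of xs] by linarith

section \<open>Lattices and their covolumes\<close>

definition add_subgroup :: "'v::ab_group_add set \<Rightarrow> bool" where
  "add_subgroup L \<longleftrightarrow> 0 \<in> L \<and> (\<forall>x\<in>L. \<forall>y\<in>L. x - y \<in> L)"

lemma add_subgroup_zero: "add_subgroup L \<Longrightarrow> 0 \<in> L"
  by (simp add: add_subgroup_def)

lemma add_subgroup_diff: "add_subgroup L \<Longrightarrow> x \<in> L \<Longrightarrow> y \<in> L \<Longrightarrow> x - y \<in> L"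
  by (simp add: add_subgroup_def)

lemma add_subgroup_uminus: "add_subgroup L \<Longrightarrow> x \<in> L \<Longrightarrow> - x \<in> L"
  using add_subgroup_diff [of L 0 x] add_subgroup_zero by auto

lemma add_subgroup_add: "add_subgroup L \<Longrightarrow> x \<in> L \<Longrightarrow> y \<in> L \<Longrightarrow> x + y \<in> L"
  using add_subgroup_diff [of L x "- y"] add_subgroup_uminus by auto

lemma add_subgroup_of_int:
  fixes L :: "'v::real_vector set"
  assumes "add_subgroup L" "x \<in> L"
  shows "of_int n *\<^sub>R x \<in> L"
proof -
  have nat: "of_nat k *\<^sub>R x \<in> L" for k
    by (induction k) (use assms in \<open>auto simp: add_subgroup_zero scaleR_add_left intro: add_subgroup_add\<close>)
  show ?thesis
    using nat [of "nat n"] add_subgroup_uminus [OF assms(1) nat [of "nat (- n)"]]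
    by (cases "0 \<le> n") auto
qed

lemma add_subgroup_sum:
  assumes "add_subgroup L" "\<And>i. i \<in> I \<Longrightarrow> f i \<in> L"
  shows "sum f I \<in> L"
  using assms(2)
  by (induction I rule: infinite_finite_induct) (auto simp: add_subgroup_zero assms intro: add_subgroup_add [OF assms(1)])

lemma additive_group_simps [simp]:
  "carrier (additive_group L) = L" "x \<otimes>\<^bsub>additive_group L\<^esub> y = x + y" "\<one>\<^bsub>additive_group L\<^esub> = 0"
  by (simp_all add: additive_group_def)

lemma comm_group_additive_group:
  assumes "add_subgroup L" shows "comm_group (additive_group L)"
proof (rule comm_groupI)
  fix x assume "x \<in> carrier (additive_group L)"
  then show "\<exists>y\<in>carrier (additive_group L). y \<otimes>\<^bsub>additive_group L\<^esub> x = \<one>\<^bsub>additive_group L\<^esub>"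
    using add_subgroup_uminus [OF assms, of x] by (intro bexI [of _ "- x"]) auto
qed (use assms in \<open>auto simp: add.assoc add.commute intro: add_subgroup_add add_subgroup_zero\<close>)

lemma Z_combination_hom:
  assumes "comm_group G" "comm_group H" "f \<in> hom G H" "set xs \<subseteq> carrier G"
  shows "Z_combination H (map f xs) m = f (Z_combination G xs m)"
proof -
  interpret G: comm_group G by fact
  interpret H: comm_group H by fact
  interpret group_hom G H f
    using assms by (simp add: group_hom_def group_hom_axioms_def G.is_group H.is_group)
  have xs: "xs ! i \<in> carrier G" if "i < length xs" for i
    using assms(4) that by auto
  have "finprod H (\<lambda>i. (map f xs ! i) [^]\<^bsub>H\<^esub> m i) {..<length xs} = finprod H (\<lambda>i. f ((xs ! i) [^]\<^bsub>G\<^esub> m i)) {..<length xs}"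
    using xs by (intro H.finprod_cong') (auto simp: hom_int_pow)
  also have "\<dots> = f (finprod G (\<lambda>i. (xs ! i) [^]\<^bsub>G\<^esub> m i) {..<length xs})"
    using xs by (intro hom_finprod [OF assms(1-3), symmetric]) auto
  finally show ?thesis
    by (simp add: Z_combination_def)
qed

lemma int_pow_additive_group:
  fixes x :: "'v::real_vector"
  shows "x [^]\<^bsub>additive_group UNIV\<^esub> (n::int) = of_int n *\<^sub>R x"
proof -
  interpret comm_group "additive_group (UNIV :: 'v set)"
    by (rule comm_group_additive_group) (simp add: add_subgroup_def)
  have nat: "x [^]\<^bsub>additive_group UNIV\<^esub> (k::nat) = of_nat k *\<^sub>R x" for k
    by (induction k) (auto simp: scaleR_add_left)
  have inv: "inv\<^bsub>additive_group UNIV\<^esub> y = - y" for y :: 'v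
    by (rule inv_equality) auto
  show ?thesis
    by (cases "0 \<le> n") (auto simp: int_pow_def2 nat inv)
qed

lemma finprod_additive_group:
  fixes f :: "'i \<Rightarrow> 'v::ab_group_add"
  shows "finprod (additive_group UNIV) f I = sum f I"
proof -
  interpret comm_group "additive_group (UNIV :: 'v set)"
    by (rule comm_group_additive_group) (simp add: add_subgroup_def)
  show ?thesis
    by (induction I rule: infinite_finite_induct) auto
qed

lemma Z_combination_UNIV: "Z_combination (additive_group UNIV) xs m = lincomb (\<lambda>i. of_int (m i)) xs"
  by (simp add: Z_combination_def int_pow_additive_group finprod_additive_group lincomb_def)

lemma Z_combination_additive_group:
  fixes L :: "'v::real_vector set"
  assumes "add_subgroup L" "set xs \<subseteq> L"
  shows "Z_combination (additive_group L) xs m = lincomb (\<lambda>i. of_int (m i)) xs"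
proof -
  have "(\<lambda>x. x) \<in> hom (additive_group L) (additive_group UNIV)"
    by (auto simp: hom_def)
  from Z_combination_hom [OF comm_group_additive_group [OF assms(1)] comm_group_additive_group this, of xs m] assms
  show ?thesis
    by (simp add: Z_combination_UNIV add_subgroup_def)
qed

definition lattice_basis :: "'v::real_vector set \<Rightarrow> 'v list \<Rightarrow> bool" where
  "lattice_basis L xs \<longleftrightarrow> set xs \<subseteq> L \<and>
     (\<forall>m::nat \<Rightarrow> int. lincomb (\<lambda>i. of_int (m i)) xs = 0 \<longrightarrow> (\<forall>i<length xs. m i = 0)) \<and>
     (\<forall>x\<in>L. \<exists>m::nat \<Rightarrow> int. x = lincomb (\<lambda>i. of_int (m i)) xs)"

lemma Z_basis_additive_group:
  "add_subgroup L \<Longrightarrow> Z_basis (additive_group L) xs \<longleftrightarrow> lattice_basis L xs"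
  by (auto simp: Z_basis_def Z_independent_def lattice_basis_def Z_combination_additive_group)

text \<open>Two bases are related by integer matrices \<open>A\<close> and \<open>B\<close> inverse to each other, so their determinants
  are \<open>1\<close> or \<open>-1\<close>.\<close>

lemma lattice_basis_unique:
  assumes "lattice_basis L xs" "lattice_basis L ys"
  shows "length xs = length ys" "gram xs = gram ys"
proof -
  let ?n = "length xs" and ?m = "length ys"
  have trans: "\<exists>A::nat \<Rightarrow> nat \<Rightarrow> int. \<forall>j<length us. us ! j = lincomb (\<lambda>i. of_int (A i j)) vs"
    if "lattice_basis L us" "lattice_basis L vs" for us vs :: "'a list"
  proof -
    have us: "set us \<subseteq> L" and vs: "\<And>x. x \<in> L \<Longrightarrow> \<exists>m::nat \<Rightarrow> int. x = lincomb (\<lambda>i. of_int (m i)) vs"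
      using that by (auto simp: lattice_basis_def)
    have "\<exists>m::nat \<Rightarrow> int. j < length us \<longrightarrow> us ! j = lincomb (\<lambda>i. of_int (m i)) vs" for j
    proof (cases "j < length us")
      case True
      then have "us ! j \<in> L" using us by auto
      from vs [OF this] show ?thesis by auto
    qed simp
    then obtain M :: "nat \<Rightarrow> nat \<Rightarrow> int" where "\<forall>j. j < length us \<longrightarrow> us ! j = lincomb (\<lambda>i. of_int (M j i)) vs"
      by metis
    then show ?thesis by (intro exI [of _ "\<lambda>i j. M j i"]) auto
  qed
  have inv: "(\<Sum>i<length vs. B l i * A i j) = (if l = j then 1 else 0)"
    if us: "lattice_basis L us"
      and A: "\<forall>j<length us. us ! j = lincomb (\<lambda>i. of_int (A i j)) vs"
      and B: "\<forall>j<length vs. vs ! j = lincomb (\<lambda>i. of_int (B i j)) us"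
      and lj: "l < length us" "j < length us"
    for us vs and A B :: "nat \<Rightarrow> nat \<Rightarrow> int" and l j
  proof -
    have "us ! j = (\<Sum>i<length vs. of_int (A i j) *\<^sub>R lincomb (\<lambda>l. of_int (B l i)) us)"
      using A B lj by (simp add: lincomb_def)
    also have "\<dots> = lincomb (\<lambda>l. of_int (\<Sum>i<length vs. B l i * A i j)) us"
      unfolding lincomb_def scaleR_sum_right
      by (subst sum.swap) (simp add: scaleR_sum_left mult.commute)
    finally have "lincomb (\<lambda>l. of_int ((\<Sum>i<length vs. B l i * A i j) - (if l = j then 1 else 0))) us = 0"
      using lincomb_unit [OF lj(2)] by (simp add: lincomb_diff if_distrib [of of_int] cong: if_cong)
    moreover have "\<And>m::nat \<Rightarrow> int. lincomb (\<lambda>i. of_int (m i)) us = 0 \<Longrightarrow> \<forall>i<length us. m i = 0"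
      using us by (simp add: lattice_basis_def)
    from this [of "\<lambda>l. (\<Sum>i<length vs. B l i * A i j) - (if l = j then 1 else 0)"] calculation
    have "\<forall>l<length us. (\<Sum>i<length vs. B l i * A i j) - (if l = j then 1 else 0) = 0"
      by blast
    with lj(1) have "(\<Sum>i<length vs. B l i * A i j) - (if l = j then 1 else 0) = 0" by blast
    then show ?thesis by simp
  qed
  obtain A :: "nat \<Rightarrow> nat \<Rightarrow> int" where A: "\<forall>j<?n. xs ! j = lincomb (\<lambda>i. of_int (A i j)) ys"
    using trans [OF assms] by blast
  obtain B :: "nat \<Rightarrow> nat \<Rightarrow> int" where B: "\<forall>j<?m. ys ! j = lincomb (\<lambda>i. of_int (B i j)) xs"
    using trans [OF assms(2,1)] by blast
  have BA: "(\<Sum>i<?m. B l i * A i j) = (if l = j then 1 else 0)" if "l < ?n" "j < ?n" for l j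
    by (rule inv [OF assms(1) A B that])
  have AB: "(\<Sum>i<?n. A l i * B i j) = (if l = j then 1 else 0)" if "l < ?m" "j < ?m" for l j
    by (rule inv [OF assms(2) B A that])
  \<comment> \<open>The matrices are not yet known to be square: their sizes are the traces of \<open>BA\<close> and \<open>AB\<close>, which agree.\<close>
  have "int ?n = (\<Sum>j<?n. \<Sum>i<?m. B j i * A i j)"
    using BA by simp
  also have "\<dots> = (\<Sum>i<?m. \<Sum>j<?n. A i j * B j i)"
    by (subst sum.swap) (simp add: mult.commute)
  also have "\<dots> = int ?m"
    using AB by simp
  finally show len: "?n = ?m" by simp
  let ?A = "Matrix.mat ?n ?n (\<lambda>(i, j). A i j)" and ?B = "Matrix.mat ?n ?n (\<lambda>(i, j). B i j)"
  have "?B * ?A = 1\<^sub>m ?n"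
    using BA len by (intro eq_matI) (auto simp: scalar_prod_def lessThan_atLeast0)
  moreover have cA: "?A \<in> carrier_mat ?n ?n" and cB: "?B \<in> carrier_mat ?n ?n"
    by auto
  ultimately have "Determinant.det ?B * Determinant.det ?A = 1"
    using Determinant.det_mult [OF cB cA] by simp
  then have "\<bar>Determinant.det ?A\<bar> = 1"
    using zmult_eq_1_iff by fastforce
  then have A1: "(Determinant.det ?A)\<^sup>2 = 1"
    by (metis power2_abs power_one)
  have "Matrix.mat ?n ?n (\<lambda>(i, j). real_of_int (A i j)) = map_mat of_int ?A"
    by (intro eq_matI) auto
  then have "Determinant.det (Matrix.mat ?n ?n (\<lambda>(i, j). real_of_int (A i j))) = of_int (Determinant.det ?A)"
    by (simp add: of_int_hom.hom_det)
  moreover have "gram xs = (Determinant.det (Matrix.mat ?m ?m (\<lambda>(i, j). real_of_int (A i j))))\<^sup>2 * gram ys"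
    using A len by (intro gram_change_of_basis) auto
  ultimately have "gram xs = of_int ((Determinant.det ?A)\<^sup>2) * gram ys"
    using len by simp
  then show "gram xs = gram ys"
    by (simp only: A1)
qed

lemma covolume_squared:
  assumes "add_subgroup L" "lattice_basis L xs"
  shows "(covolume L)\<^sup>2 = gram xs"
proof -
  have "covolume L = sqrt (gram xs)"
    unfolding covolume_def Z_basis_additive_group [OF assms(1)] gram_def [symmetric]
    using assms(2) lattice_basis_unique(2) by (intro the_equality) auto
  then show ?thesis
    by (simp add: gram_nonneg)
qed

definition Z_span :: "'v::real_vector list \<Rightarrow> 'v set" where
  "Z_span xs = range (\<lambda>m::nat \<Rightarrow> int. lincomb (\<lambda>i. of_int (m i)) xs)"

lemma Z_spanI: "x = lincomb (\<lambda>i. of_int (m i)) xs \<Longrightarrow> x \<in> Z_span xs"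
  unfolding Z_span_def by blast

lemma Z_span_subset_span: "Z_span xs \<subseteq> span (set xs)"
  by (auto simp: Z_span_def span_set_eq_lincomb)

lemma Z_span_snoc: "Z_span (xs @ [v]) = {y + of_int n *\<^sub>R v | y n. y \<in> Z_span xs}"
proof (intro subset_antisym subsetI)
  fix x assume "x \<in> {y + of_int n *\<^sub>R v | y n. y \<in> Z_span xs}"
  then obtain m :: "nat \<Rightarrow> int" and n where x: "x = lincomb (\<lambda>i. of_int (m i)) xs + of_int n *\<^sub>R v"
    by (auto simp: Z_span_def)
  have "lincomb (\<lambda>i. of_int ((m(length xs := n)) i)) xs = lincomb (\<lambda>i. of_int (m i)) xs"
    by (rule lincomb_cong) simp
  then have "x = lincomb (\<lambda>i. of_int ((m(length xs := n)) i)) (xs @ [v])"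
    by (simp add: x lincomb_snoc)
  then show "x \<in> Z_span (xs @ [v])"
    unfolding Z_span_def by blast
qed (force simp: Z_span_def lincomb_snoc)

lemma add_subgroup_Z_span: "add_subgroup (Z_span xs)"
proof -
  have "0 \<in> Z_span xs"
    by (rule Z_spanI [of _ "\<lambda>_. 0"]) simp
  moreover have "x - y \<in> Z_span xs" if "x \<in> Z_span xs" "y \<in> Z_span xs" for x y
  proof -
    obtain m :: "nat \<Rightarrow> int" where "x = lincomb (\<lambda>i. of_int (m i)) xs"
      using \<open>x \<in> Z_span xs\<close> unfolding Z_span_def by blast
    moreover obtain m' :: "nat \<Rightarrow> int" where "y = lincomb (\<lambda>i. of_int (m' i)) xs"
      using \<open>y \<in> Z_span xs\<close> unfolding Z_span_def by blast
    ultimately show ?thesis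
      by (intro Z_spanI [of _ "\<lambda>i. m i - m' i"]) (simp add: lincomb_diff)
  qed
  ultimately show ?thesis
    by (simp add: add_subgroup_def)
qed

lemma lattice_basis_Z_span: "lin_indep xs \<Longrightarrow> lattice_basis (Z_span xs) xs"
proof -
  assume li: "lin_indep xs"
  have "xs ! j \<in> Z_span xs" if "j < length xs" for j
  proof -
    have "xs ! j = lincomb (\<lambda>i. of_int (if i = j then 1 else 0)) xs"
      using lincomb_unit [OF that] by (simp add: if_distrib [of of_int] cong: if_cong)
    then show ?thesis by (rule Z_spanI)
  qed
  then have "set xs \<subseteq> Z_span xs"
    by (auto simp: in_set_conv_nth)
  then show ?thesis
    using lin_indepD [OF li] by (force simp: lattice_basis_def Z_span_def)
qed

lemma lattice_basis_eq_Z_span: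
  assumes "add_subgroup L" "lattice_basis L xs"
  shows "L = Z_span xs"
proof
  show "L \<subseteq> Z_span xs"
    using assms(2) by (auto simp: lattice_basis_def Z_span_def)
  show "Z_span xs \<subseteq> L"
    using assms
    by (auto simp: lattice_basis_def Z_span_def lincomb_def intro!: add_subgroup_sum add_subgroup_of_int)
qed

text \<open>A system of representatives of \<open>L\<close> modulo \<open>M\<close>, whose cardinality is the index of \<open>M\<close> in \<open>L\<close>.\<close>

definition transversal :: "'v::ab_group_add set \<Rightarrow> 'v set \<Rightarrow> 'v set \<Rightarrow> bool" where
  "transversal R L M \<longleftrightarrow> R \<subseteq> L \<and> (\<forall>x\<in>L. \<exists>\<rho>\<in>R. x - \<rho> \<in> M) \<and>
     (\<forall>\<rho>\<in>R. \<forall>\<rho>'\<in>R. \<rho> - \<rho>' \<in> M \<longrightarrow> \<rho> = \<rho>')"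

text \<open>The Hermite normal form of a sublattice, by induction on the rank of the ambient lattice. Let \<open>v\<close> be
  the last basis vector. The coefficients of \<open>v\<close> in elements of \<open>M\<close> form a subgroup \<open>d\<int>\<close> of \<open>\<int>\<close>. If \<open>d = 0\<close>,
  then \<open>M\<close> lies in a lattice of smaller rank. Otherwise a basis of the part without \<open>v\<close> is completed by an
  element \<open>u\<close> of \<open>M\<close> with coefficient \<open>d\<close>. This multiplies the index by \<open>d\<close>, as the multiples \<open>j \<cdot> v\<close> with
  \<open>0 \<le> j < d\<close> can be added to representatives, and the Gram determinant by an extra factor \<open>d\<^sup>2\<close>, as the
  height of \<open>u\<close> is \<open>d\<close> times that of \<open>v\<close>.\<close>

lemma sublattice_basis:
  fixes M :: "'v::euclidean_space set"
  assumes "lin_indep \<sigma>" "M \<subseteq> Z_span \<sigma>" "add_subgroup M"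
  shows "\<exists>ys. lattice_basis M ys \<and> lin_indep ys \<and> length ys \<le> length \<sigma> \<and>
    (length ys = length \<sigma> \<longrightarrow> (\<exists>R. finite R \<and> transversal R (Z_span \<sigma>) M \<and> gram ys = (real (card R))\<^sup>2 * gram \<sigma>))"
  using assms
proof (induction \<sigma> arbitrary: M rule: rev_induct)
  case Nil
  have "Z_span ([] :: 'v list) = {0}"
    by (auto simp: Z_span_def lincomb_def)
  then have M: "M = {0}"
    using Nil by (auto simp: add_subgroup_zero)
  have "lattice_basis M []" "lin_indep ([] :: 'v list)"
    by (auto simp: lattice_basis_def M lincomb_def lin_indep_def)
  moreover have "transversal {0} (Z_span []) M"
    by (auto simp: transversal_def M Z_span_def lincomb_def)
  ultimately show ?case
    by (intro exI [of _ "[]"]) (auto intro!: exI [of _ "{0}"])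
next
  case (snoc v \<sigma>)
  let ?L = "Z_span \<sigma>"
  have li: "lin_indep \<sigma>" and v: "v \<notin> span (set \<sigma>)"
    using snoc.prems(1) by (auto simp: lin_indep_snoc)
  have coord: "n = n'" if "y - y' \<in> span (set \<sigma>)" "y + of_int n *\<^sub>R v - (y' + of_int n' *\<^sub>R v) \<in> span (set \<sigma>)" for y y' n n'
  proof (rule ccontr)
    assume "n \<noteq> n'"
    then have ne: "real_of_int (n - n') \<noteq> 0" by simp
    have "(y + of_int n *\<^sub>R v - (y' + of_int n' *\<^sub>R v)) - (y - y') \<in> span (set \<sigma>)"
      using span_diff [OF that(2,1)] .
    then have "real_of_int (n - n') *\<^sub>R v \<in> span (set \<sigma>)"
      by (simp add: algebra_simps)
    then have "inverse (real_of_int (n - n')) *\<^sub>R (real_of_int (n - n') *\<^sub>R v) \<in> span (set \<sigma>)"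
      by (rule span_scale)
    with v ne show False by simp
  qed
  define N where "N = {n. \<exists>y\<in>?L. y + of_int n *\<^sub>R v \<in> M}"
  define M0 where "M0 = M \<inter> ?L"
  have M0: "add_subgroup M0" "M0 \<subseteq> ?L"
    using snoc.prems(3) add_subgroup_Z_span [of \<sigma>] by (auto simp: add_subgroup_def M0_def)
  obtain ys where ys: "lattice_basis M0 ys" "lin_indep ys" "length ys \<le> length \<sigma>"
    and trans: "length ys = length \<sigma> \<longrightarrow> (\<exists>R. finite R \<and> transversal R ?L M0 \<and> gram ys = (real (card R))\<^sup>2 * gram \<sigma>)"
    using snoc.IH [OF li M0(2,1)] by blast
  have Mdecomp: "\<exists>y n. y \<in> ?L \<and> n \<in> N \<and> x = y + of_int n *\<^sub>R v" if "x \<in> M" for x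
    using snoc.prems(2) that unfolding Z_span_snoc N_def by blast
  show ?case
  proof (cases "N \<subseteq> {0}")
    case True
    then have "M \<subseteq> ?L"
      using Mdecomp by fastforce
    then have "M0 = M" by (auto simp: M0_def)
    then show ?thesis
      using ys by (intro exI [of _ ys]) auto
  next
    case False
    have Nsub: "n - k * n' \<in> N" if nn: "n \<in> N" "n' \<in> N" for n n' k
    proof -
      obtain y y' where y: "y \<in> ?L" "y + of_int n *\<^sub>R v \<in> M" and y': "y' \<in> ?L" "y' + of_int n' *\<^sub>R v \<in> M"
        using nn by (auto simp: N_def)
      have "y - of_int k *\<^sub>R y' \<in> ?L"
        using y y' add_subgroup_Z_span by (intro add_subgroup_diff add_subgroup_of_int)
      moreover have "(y + of_int n *\<^sub>R v) - of_int k *\<^sub>R (y' + of_int n' *\<^sub>R v) \<in> M"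
        using y y' snoc.prems(3) by (intro add_subgroup_diff add_subgroup_of_int)
      then have "(y - of_int k *\<^sub>R y') + of_int (n - k * n') *\<^sub>R v \<in> M"
        by (simp add: algebra_simps)
      ultimately show ?thesis by (auto simp: N_def)
    qed
    obtain n0 where n0: "n0 \<in> N" "n0 \<noteq> 0"
      using False by blast
    have "0 \<in> N" using Nsub [OF n0(1) n0(1), of 1] by simp
    then have "- n0 \<in> N" using Nsub [of 0 n0 1] n0 by simp
    with n0 have "\<exists>k>0. int k \<in> N"
      by (intro exI [of _ "nat \<bar>n0\<bar>"]) (auto simp: abs_if)
    note ex = this
    define d where "d = (LEAST k. 0 < k \<and> int k \<in> N)"
    have d: "0 < d" "int d \<in> N"
      using LeastI_ex [OF ex] by (simp_all add: d_def)
    have least: "d \<le> k" if "0 < k" "int k \<in> N" for k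
      unfolding d_def using that by (intro Least_le) simp
    have dvd: "int d dvd n" if "n \<in> N" for n
    proof -
      have "n mod int d \<in> N"
        using Nsub [OF that d(2), of "n div int d"] by (simp add: minus_div_mult_eq_mod)
      moreover have "0 \<le> n mod int d" "n mod int d < int d"
        using d by auto
      ultimately have "n mod int d = 0"
        using least [of "nat (n mod int d)"] by force
      then show ?thesis by auto
    qed
    \<comment> \<open>The new basis vector \<open>u\<close> has the smallest positive coefficient of \<open>v\<close>.\<close>
    obtain y0 where y0: "y0 \<in> ?L" "y0 + of_int (int d) *\<^sub>R v \<in> M"
      using d(2) by (auto simp: N_def)
    define u where "u = y0 + of_int (int d) *\<^sub>R v"
    have u: "u \<in> M" using y0 by (simp add: u_def)
    have reduce: "\<exists>q::int. \<exists>z\<in>M0. x = z + of_int q *\<^sub>R u" if "x \<in> M" for x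
    proof -
      obtain y n where yn: "y \<in> ?L" "n \<in> N" "x = y + of_int n *\<^sub>R v"
        using Mdecomp [OF \<open>x \<in> M\<close>] by blast
      obtain q where q: "n = int d * q" using dvd [OF yn(2)] by auto
      have "x - of_int q *\<^sub>R u \<in> M"
        using snoc.prems(3) u \<open>x \<in> M\<close> by (intro add_subgroup_diff add_subgroup_of_int)
      moreover have "x - of_int q *\<^sub>R u = y - of_int q *\<^sub>R y0"
        by (simp add: yn q u_def algebra_simps)
      moreover have "y - of_int q *\<^sub>R y0 \<in> ?L"
        using yn y0 add_subgroup_Z_span by (intro add_subgroup_diff add_subgroup_of_int)
      ultimately have "x - of_int q *\<^sub>R u \<in> M0" by (simp add: M0_def)
      then show ?thesis by (intro exI [of _ q] bexI [of _ "x - of_int q *\<^sub>R u"]) auto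
    qed
    have ysL: "set ys \<subseteq> ?L" using ys(1) by (auto simp: lattice_basis_def M0_def)
    then have span_ys: "span (set ys) \<subseteq> span (set \<sigma>)"
      using Z_span_subset_span by (meson span_minimal subspace_span subset_trans)
    have y0span: "y0 \<in> span (set \<sigma>)" using y0 Z_span_subset_span by blast
    have "u \<notin> span (set ys)"
    proof
      assume "u \<in> span (set ys)"
      then have "0 + of_int (int d) *\<^sub>R v - (0 + of_int 0 *\<^sub>R v) \<in> span (set \<sigma>)"
        using span_ys y0span span_diff [of u "set \<sigma>" y0] by (auto simp: u_def)
      with coord [of 0 0 "int d" 0] d show False by (auto simp: span_zero)
    qed
    then have li': "lin_indep (ys @ [u])"
      using ys(2) by (simp add: lin_indep_snoc)
    have "M \<subseteq> Z_span (ys @ [u])"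
    proof
      fix x assume "x \<in> M"
      then obtain q z where z: "z \<in> M0" "x = z + of_int q *\<^sub>R u"
        using reduce by blast
      then have "z \<in> Z_span ys" using ys(1) by (auto simp: lattice_basis_def Z_span_def)
      then show "x \<in> Z_span (ys @ [u])" using z unfolding Z_span_snoc by blast
    qed
    moreover have "set (ys @ [u]) \<subseteq> M"
      using ys(1) u by (auto simp: lattice_basis_def M0_def)
    ultimately have basis: "lattice_basis M (ys @ [u])"
      using li' by (auto simp: lattice_basis_def Z_span_def dest: lin_indepD)
    have "\<exists>R. finite R \<and> transversal R (Z_span (\<sigma> @ [v])) M \<and> gram (ys @ [u]) = (real (card R))\<^sup>2 * gram (\<sigma> @ [v])"
      if len: "length (ys @ [u]) = length (\<sigma> @ [v])"
    proof -
      obtain R0 where R0: "finite R0" "transversal R0 ?L M0" "gram ys = (real (card R0))\<^sup>2 * gram \<sigma>"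
        using trans len by auto
      define R where "R = (\<lambda>(\<rho>, j). \<rho> + of_int (int j) *\<^sub>R v) ` (R0 \<times> {..<d})"
      have R0L: "R0 \<subseteq> ?L" using R0(2) by (simp add: transversal_def)
      have eqR: "\<rho> = \<rho>' \<and> j = j'"
        if "\<rho> \<in> R0" "\<rho>' \<in> R0" "j < d" "j' < d"
          and m: "(\<rho> + of_int (int j) *\<^sub>R v) - (\<rho>' + of_int (int j') *\<^sub>R v) \<in> M" for \<rho> \<rho>' j j'
      proof -
        have \<rho>\<rho>: "\<rho> - \<rho>' \<in> ?L"
          using that R0L add_subgroup_Z_span by (intro add_subgroup_diff) auto
        have "(\<rho> - \<rho>') + of_int (int j - int j') *\<^sub>R v \<in> M"
          using m by (simp add: algebra_simps)
        then have "int j - int j' \<in> N"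
          using \<rho>\<rho> by (auto simp: N_def)
        then have "int d dvd int j - int j'" by (rule dvd)
        then have jj: "j = j'"
          using that(3,4) dvd_imp_le_int [of "int j - int j'" "int d"] by (cases "j = j'") auto
        with m have "\<rho> - \<rho>' \<in> M0" using \<rho>\<rho> by (simp add: M0_def)
        then show ?thesis using R0(2) that jj by (auto simp: transversal_def)
      qed
      have card: "card R = card R0 * d"
      proof -
        have "inj_on (\<lambda>(\<rho>, j). \<rho> + of_int (int j) *\<^sub>R v) (R0 \<times> {..<d})"
        proof (rule inj_onI)
          fix a b assume ab: "a \<in> R0 \<times> {..<d}" "b \<in> R0 \<times> {..<d}"
            "(case a of (\<rho>, j) \<Rightarrow> \<rho> + of_int (int j) *\<^sub>R v) = (case b of (\<rho>, j) \<Rightarrow> \<rho> + of_int (int j) *\<^sub>R v)"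
          obtain \<rho> j \<rho>' j' where "a = (\<rho>, j)" "b = (\<rho>', j')"
            by (cases a, cases b)
          with ab show "a = b"
            using eqR [of \<rho> \<rho>' j j'] add_subgroup_zero [OF snoc.prems(3)] by auto
        qed
        then show ?thesis
          by (simp add: R_def card_image card_cartesian_product)
      qed
      have "transversal R (Z_span (\<sigma> @ [v])) M"
        unfolding transversal_def
      proof (intro conjI ballI impI)
        show "R \<subseteq> Z_span (\<sigma> @ [v])"
        proof
          fix a assume "a \<in> R"
          then obtain \<rho> j where "\<rho> \<in> R0" "a = \<rho> + of_int (int j) *\<^sub>R v"
            by (auto simp: R_def)
          then show "a \<in> Z_span (\<sigma> @ [v])"
            using R0L unfolding Z_span_snoc by blast
        qed
        fix x assume "x \<in> Z_span (\<sigma> @ [v])"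
        then obtain y n where yn: "y \<in> ?L" "x = y + of_int n *\<^sub>R v"
          unfolding Z_span_snoc by blast
        \<comment> \<open>Subtracting \<open>q\<close> times \<open>u\<close> brings the coefficient of \<open>v\<close> into the range \<open>0 \<le> j < d\<close>.\<close>
        define q where "q = n div int d"
        define j where "j = nat (n mod int d)"
        have j: "int j = n - q * int d" "j < d"
          using d by (auto simp: j_def q_def minus_div_mult_eq_mod nat_less_iff)
        have "y - of_int q *\<^sub>R y0 \<in> ?L"
          using yn y0 add_subgroup_Z_span by (intro add_subgroup_diff add_subgroup_of_int)
        then obtain \<rho> where \<rho>: "\<rho> \<in> R0" "y - of_int q *\<^sub>R y0 - \<rho> \<in> M0"
          using R0(2) by (auto simp: transversal_def)
        then have "(y - of_int q *\<^sub>R y0 - \<rho>) + of_int q *\<^sub>R u \<in> M"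
          using snoc.prems(3) u by (intro add_subgroup_add add_subgroup_of_int) (auto simp: M0_def)
        moreover have "x - (\<rho> + of_int (int j) *\<^sub>R v) = (y - of_int q *\<^sub>R y0 - \<rho>) + of_int q *\<^sub>R u"
          unfolding j(1) by (simp add: yn u_def algebra_simps)
        ultimately have "x - (\<rho> + of_int (int j) *\<^sub>R v) \<in> M" by metis
        moreover have "\<rho> + of_int (int j) *\<^sub>R v \<in> R"
          unfolding R_def using \<rho>(1) j(2) by (intro image_eqI [of _ _ "(\<rho>, j)"]) auto
        ultimately show "\<exists>\<rho>\<in>R. x - \<rho> \<in> M" by blast
      next
        fix a b assume "a \<in> R" "b \<in> R" "a - b \<in> M"
        then show "a = b"
          using eqR unfolding R_def by clarsimp blast
      qed
      moreover have "gram (ys @ [u]) = (real (card R))\<^sup>2 * gram (\<sigma> @ [v])"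
      proof -
        have "span (set ys) = span (set \<sigma>)"
        proof (rule subspace_dim_equal [OF subspace_span subspace_span span_ys])
          show "dim (span (set \<sigma>)) \<le> dim (span (set ys))"
            using length_eq_dim [OF ys(2)] length_eq_dim [OF li] len by simp
        qed
        moreover obtain w where w: "v - w \<in> span (set \<sigma>)" "\<And>x. x \<in> span (set \<sigma>) \<Longrightarrow> inner x w = 0"
          "gram (\<sigma> @ [v]) = gram \<sigma> * inner w w"
          using gram_snoc [of v \<sigma>] by metis
        moreover have "u - real d *\<^sub>R w \<in> span (set \<sigma>)"
        proof -
          have "y0 + real d *\<^sub>R (v - w) \<in> span (set \<sigma>)"
            using w(1) y0span by (intro span_add span_scale)
          then show ?thesis by (simp add: u_def algebra_simps)
        qed
        moreover have "x \<in> span (set \<sigma>)" if "x \<in> set ys" for x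
          using that span_ys span_base by blast
        ultimately have "gram (ys @ [u]) = gram ys * gram [real d *\<^sub>R w]"
          by (intro gram_append) auto
        then show ?thesis
          using R0(3) w(3) card by (simp add: power2_eq_square)
      qed
      moreover have "finite R" using R0(1) by (simp add: R_def)
      ultimately show ?thesis by blast
    qed
    with li' basis ys(3) show ?thesis
      by (intro exI [of _ "ys @ [u]"]) auto
  qed
qed

section \<open>Integral vectors\<close>

lemma real_vec_nth [simp]: "real_vec z $ c = of_int (z $ c)"
  by (simp add: real_vec_def)

lemma real_vec_simps [simp]:
  "real_vec 0 = 0" "real_vec (x + y) = real_vec x + real_vec y"
  "real_vec (x - y) = real_vec x - real_vec y" "real_vec (- x) = - real_vec x"
  by (simp_all add: Finite_Cartesian_Product.vec_eq_iff)

lemma real_vec_inj: "real_vec x = real_vec y \<longleftrightarrow> x = y"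
  by (simp add: Finite_Cartesian_Product.vec_eq_iff)

lemma inj_real_vec: "inj real_vec"
  by (simp add: inj_def real_vec_inj)

lemma real_vec_mem_image: "real_vec z \<in> real_vec ` L \<longleftrightarrow> z \<in> L"
  by (rule inj_image_mem_iff [OF inj_real_vec])

lemma add_subgroup_real_vec: "add_subgroup L \<Longrightarrow> add_subgroup (real_vec ` L)"
  unfolding add_subgroup_def by (auto simp flip: real_vec_simps)

lemma add_subgroup_range_real_vec: "add_subgroup (range real_vec)"
  by (rule add_subgroup_real_vec) (simp add: add_subgroup_def)

lemma integral_vector_small:
  fixes x :: "real ^ 'c::finite"
  assumes "x \<in> range real_vec" "\<And>c. \<bar>x $ c\<bar> < 1"
  shows "x = 0"
proof -
  obtain z where z: "x = real_vec z" using assms(1) by auto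
  have "z $ c = 0" for c
    using assms(2) [of c] by (simp add: z)
  then show ?thesis
    by (simp add: z Finite_Cartesian_Product.vec_eq_iff)
qed

lemma integral_basis:
  obtains es :: "(real ^ 'c::finite) list" where "lin_indep es" "Z_span es = range real_vec"
proof -
  obtain cs :: "'c list" where cs: "distinct cs" "set cs = UNIV"
    using finite_distinct_list [OF finite [of "UNIV :: 'c set"]] by blast
  define es :: "(real ^ 'c) list" where "es = map (\<lambda>c. axis c 1) cs"
  have lc: "lincomb a es $ (cs ! j) = a j" if j: "j < length cs" for a j
  proof -
    have "lincomb a es $ (cs ! j) = (\<Sum>i<length cs. a i * (if i = j then 1 else 0))"
      using cs(1) j by (auto simp: lincomb_def es_def axis_def nth_eq_iff_index_eq intro!: sum.cong)
    then show ?thesis using j by (simp add: if_distrib [of "\<lambda>x. _ * x"] cong: if_cong)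
  qed
  have cov: "\<exists>j<length cs. c = cs ! j" for c
    using cs(2) by (metis UNIV_I in_set_conv_nth)
  have "lin_indep es"
    unfolding lin_indep_def
    using lc by (auto simp: es_def) (metis zero_index)
  moreover have "Z_span es = range real_vec"
  proof (intro subset_antisym subsetI)
    fix x assume "x \<in> Z_span es"
    then obtain m :: "nat \<Rightarrow> int" where x: "x = lincomb (\<lambda>i. of_int (m i)) es"
      unfolding Z_span_def by blast
    have "set es \<subseteq> range real_vec"
    proof -
      have "axis c (1::real) = real_vec (axis c 1)" for c :: 'c
        by (simp add: Finite_Cartesian_Product.vec_eq_iff axis_def)
      then show ?thesis unfolding es_def by (auto simp: image_iff)
    qed
    then show "x \<in> range real_vec"
      unfolding x lincomb_def
      by (intro add_subgroup_sum add_subgroup_of_int add_subgroup_range_real_vec) auto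
  next
    fix x :: "real ^ 'c" assume "x \<in> range real_vec"
    then obtain z where z: "x = real_vec z" by auto
    have "x = lincomb (\<lambda>i. of_int (z $ (cs ! i))) es"
      unfolding Finite_Cartesian_Product.vec_eq_iff using cov lc by (metis z real_vec_nth)
    then show "x \<in> Z_span es" by (rule Z_spanI)
  qed
  ultimately show thesis using that by blast
qed

lemma integral_lattice_basis:
  fixes L :: "(real ^ 'c::finite) set"
  assumes "add_subgroup L" "L \<subseteq> range real_vec"
  obtains ys where "lattice_basis L ys" "lin_indep ys"
proof -
  obtain es :: "(real ^ 'c) list" where "lin_indep es" "Z_span es = range real_vec"
    using integral_basis by blast
  then show thesis
    using sublattice_basis [of es L] assms that by auto
qed

text \<open>Normalise a real relation so that some coefficient is \<open>1\<close>, and approximate the coefficients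
  simultaneously by fractions \<open>p\<^sub>i / q\<close>. The integral combination with coefficients \<open>p\<^sub>i\<close> is then an integral
  vector of norm less than \<open>1\<close>, hence zero, so that all \<open>p\<^sub>i\<close> vanish. But the one that approximates
  \<open>q \<cdot> 1\<close> does not.\<close>

lemma lin_indep_of_int_indep:
  fixes xs :: "(real ^ 'c::finite) list"
  assumes int: "set xs \<subseteq> range real_vec"
    and indep: "\<And>m::nat \<Rightarrow> int. lincomb (\<lambda>i. of_int (m i)) xs = 0 \<Longrightarrow> \<forall>i<length xs. m i = 0"
  shows "lin_indep xs"
  unfolding lin_indep_def
proof (intro allI impI, rule ccontr)
  fix a j assume a: "lincomb a xs = 0" and j: "j < length xs" and aj: "a j \<noteq> 0"
  define \<theta> where "\<theta> i = a i / a j" for i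
  have \<theta>: "lincomb \<theta> xs = 0"
    using lincomb_scale [of "inverse (a j)" a xs] a by (simp add: \<theta>_def [abs_def] field_simps)
  \<comment> \<open>The approximation error \<open>1 / N\<close> per coefficient gives a vector of norm at most \<open>K / N\<close>.\<close>
  define K where "K = (\<Sum>i<length xs. norm (xs ! i))"
  have K: "0 \<le> K" by (simp add: K_def sum_nonneg)
  obtain N :: nat where N: "K + 1 < real N"
    using reals_Archimedean2 by blast
  then have N0: "0 < N" using K by (auto intro: gr0I)
  obtain q p where q: "0 < q" and p: "\<And>i. i < length xs \<Longrightarrow> \<bar>of_int q * \<theta> i - of_int (p i)\<bar> < 1 / real N"
    using Dirichlet_approx_simult [OF N0, of "length xs" \<theta>] by metis
  define x where "x = lincomb (\<lambda>i. of_int (p i)) xs"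
  have x: "x = lincomb (\<lambda>i. of_int (p i) - of_int q * \<theta> i) xs"
    by (simp add: x_def lincomb_diff lincomb_scale \<theta>)
  have "norm x \<le> (\<Sum>i<length xs. (1 / real N) * norm (xs ! i))"
    unfolding x lincomb_def
  proof (intro order_trans [OF norm_sum] sum_mono)
    fix i assume "i \<in> {..<length xs}"
    then have "\<bar>of_int (p i) - of_int q * \<theta> i\<bar> \<le> 1 / real N"
      using p [of i] by (simp add: abs_minus_commute less_imp_le)
    then show "norm ((of_int (p i) - of_int q * \<theta> i) *\<^sub>R xs ! i) \<le> 1 / real N * norm (xs ! i)"
      by (simp only: norm_scaleR) (rule mult_right_mono, simp_all)
  qed
  also have "\<dots> = K / real N"
    by (simp add: K_def sum_divide_distrib)
  also have "\<dots> < 1"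
    using N N0 by (simp add: field_simps)
  finally have "norm x < 1" .
  then have "\<bar>x $ c\<bar> < 1" for c
    using component_le_norm_cart [of x c] by simp
  moreover have "x \<in> range real_vec"
    unfolding x_def lincomb_def using int
    by (intro add_subgroup_sum add_subgroup_of_int add_subgroup_range_real_vec) auto
  ultimately have "x = 0"
    using integral_vector_small by blast
  then have "p j = 0"
    using indep [of p] j by (simp add: x_def)
  moreover have "\<theta> j = 1" using aj by (simp add: \<theta>_def)
  ultimately have "real_of_int q < 1 / real N"
    using p [OF j] q by simp
  also have "\<dots> \<le> 1" using N0 by simp
  finally show False using q by simp
qed

lemma lattice_basis_lin_indep:
  fixes L :: "(real ^ 'c::finite) set"
  assumes "lattice_basis L xs" "L \<subseteq> range real_vec"
  shows "lin_indep xs"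
  using assms by (intro lin_indep_of_int_indep) (auto simp: lattice_basis_def)

lemma span_lattice_basis:
  assumes "add_subgroup L" "lattice_basis L xs"
  shows "span (set xs) = span L"
proof
  show "span (set xs) \<subseteq> span L"
    using assms(2) by (intro span_mono) (simp add: lattice_basis_def)
  have "L \<subseteq> span (set xs)"
    using lattice_basis_eq_Z_span [OF assms] Z_span_subset_span by metis
  then show "span L \<subseteq> span (set xs)"
    by (simp add: span_minimal)
qed

text \<open>A kernel vector \<open>v\<close> is the limit of vectors \<open>z / q\<close> with \<open>z\<close> integral and \<open>z - q \<cdot> v\<close> arbitrarily small.
  Then \<open>f(z) = f(z - q \<cdot> v)\<close> is integral and of norm less than \<open>1\<close>, so \<open>z\<close> lies in the kernel; in the same way
  its coordinates in \<open>S\<close> vanish. So \<open>v\<close> lies in the closure of the span of integral kernel vectors, and a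
  subspace is closed.\<close>

lemma rational_kernel:
  fixes f :: "real ^ 'c::finite \<Rightarrow> real ^ 'd::finite"
  assumes f: "linear f" and int: "\<And>z. f (real_vec z) \<in> range real_vec"
    and v: "f v = 0" "\<And>c. c \<in> S \<Longrightarrow> v $ c = 0"
  shows "v \<in> span (real_vec ` {z. f (real_vec z) = 0 \<and> (\<forall>c\<in>S. z $ c = 0)})"
    (is "v \<in> span ?K")
proof -
  have "v \<in> closure (span ?K)"
    unfolding closure_approachable
  proof (intro allI impI)
    fix e :: real assume e: "0 < e"
    obtain B where B: "0 < B" "\<And>x. norm (f x) \<le> B * norm x"
      using linear_bounded_pos [OF f] by blast
    define C where "C = real CARD('c)"
    have C: "0 < C" by (simp add: C_def)
    \<comment> \<open>The error vector has norm at most \<open>C / N\<close>. The first bound makes its image shorter than \<open>1\<close>, the second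
       one makes the approximation better than \<open>e\<close>.\<close>
    obtain N :: nat where N: "max (B * C) (C / e) < real N"
      using reals_Archimedean2 by blast
    have "0 < B * C" using B C by simp
    then have "0 < real N" using N by linarith
    then have N0: "0 < N" by simp
    obtain g where g: "bij_betw g {..<CARD('c)} (UNIV :: 'c set)"
      using ex_bij_betw_nat_finite [of "UNIV :: 'c set"] by (auto simp: lessThan_atLeast0)
    define h where "h = inv_into {..<CARD('c)} g"
    have h: "h c < CARD('c)" "g (h c) = c" for c
      using g bij_betw_inv_into [OF g] by (auto simp: h_def bij_betw_def f_inv_into_f)
    obtain q p where q: "0 < q" and p: "\<And>i. i < CARD('c) \<Longrightarrow> \<bar>of_int q * v $ g i - of_int (p i)\<bar> < 1 / real N"
      using Dirichlet_approx_simult [OF N0, of "CARD('c)" "\<lambda>i. v $ g i"] by metis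
    define z :: "int ^ 'c" where "z = (\<chi> c. p (h c))"
    define w where "w = real_vec z - of_int q *\<^sub>R v"
    have wc: "\<bar>w $ c\<bar> < 1 / real N" for c
      using p [OF h(1) [of c]] by (simp add: w_def z_def h abs_minus_commute)
    have "norm w \<le> (\<Sum>c\<in>UNIV. \<bar>w $ c\<bar>)"
      by (rule norm_le_l1_cart)
    also have "\<dots> \<le> (\<Sum>c\<in>(UNIV :: 'c set). 1 / real N)"
      using wc by (intro sum_mono) (simp add: less_imp_le)
    finally have w: "norm w \<le> C / real N" by (simp add: C_def)
    have "f (real_vec z) = f w"
      using f v by (simp add: w_def linear_diff linear_scale)
    moreover have "norm (f w) < 1"
    proof -
      have "norm (f w) \<le> B * (C / real N)"
        using B(2) [of w] w B(1) by (meson mult_left_mono less_imp_le order_trans)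
      also have "\<dots> < 1" using N N0 by (simp add: field_simps)
      finally show ?thesis .
    qed
    ultimately have "f (real_vec z) = 0"
      using int [of z] component_le_norm_cart [of "f w"] by (intro integral_vector_small) (auto intro: le_less_trans)
    moreover have "z $ c = 0" if "c \<in> S" for c
    proof -
      have "\<bar>of_int (z $ c)\<bar> < 1 / real N"
        using wc [of c] v(2) [OF that] by (simp add: w_def)
      also have "\<dots> \<le> 1" using N0 by simp
      finally show ?thesis by simp
    qed
    ultimately have "real_vec z \<in> ?K" by blast
    then have "inverse (of_int q) *\<^sub>R real_vec z \<in> span ?K"
      by (intro span_scale span_base)
    moreover have "dist (inverse (of_int q) *\<^sub>R real_vec z) v < e"
    proof -
      have "inverse (of_int q) *\<^sub>R real_vec z - v = inverse (of_int q) *\<^sub>R w"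
        using q by (simp add: w_def algebra_simps)
      then have "dist (inverse (of_int q) *\<^sub>R real_vec z) v = norm w / of_int q"
        using q by (simp add: dist_norm divide_inverse_commute)
      also have "\<dots> \<le> norm w / 1"
        using q by (intro divide_left_mono) auto
      also have "\<dots> \<le> C / real N" using w by simp
      also have "\<dots> < e" using N N0 e by (simp add: field_simps)
      finally show ?thesis .
    qed
    ultimately show "\<exists>y\<in>span ?K. dist y v < e" by blast
  qed
  then show ?thesis
    by (simp add: closed_subspace closure_closed)
qed

section \<open>The Cauchy-Binet formula for Gram determinants\<close>

lemma supported_expand:
  fixes v :: "real ^ 'c::finite"
  assumes "\<And>c. c \<notin> V \<Longrightarrow> v $ c = 0"
  shows "v = (\<Sum>c\<in>V. v $ c *\<^sub>R axis c 1)"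
proof -
  have "v = (\<Sum>c\<in>UNIV. v $ c *\<^sub>R axis c 1)"
    using basis_expansion [of v] by (simp add: scalar_mult_eq_scaleR)
  also have "\<dots> = (\<Sum>c\<in>V. v $ c *\<^sub>R axis c 1)"
    using assms by (intro sum.mono_neutral_right) auto
  finally show ?thesis .
qed

text \<open>The Gram determinant of the \<open>r\<close> rows of \<open>E\<close> after deleting the columns outside of \<open>S\<close>.\<close>

definition minor_gram :: "nat \<Rightarrow> (nat \<Rightarrow> 'c \<Rightarrow> real) \<Rightarrow> 'c set \<Rightarrow> real" where
  "minor_gram r E S = Determinant.det (Matrix.mat r r (\<lambda>(i, j). \<Sum>c\<in>S. E i c * E j c))"

text \<open>Leibniz expansion, with the product of sums over columns multiplied out. A choice of columns that is
  not injective contributes a determinant with two equal rows.\<close>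

lemma minor_gram_expand:
  assumes "finite S"
  shows "minor_gram r E S = (\<Sum>f\<in>{f \<in> {0..<r} \<rightarrow>\<^sub>E S. inj_on f {0..<r}}.
     (\<Prod>i = 0..<r. E i (f i)) * Determinant.det (Matrix.mat r r (\<lambda>(i, j). E j (f i))))"
proof -
  let ?I = "{0..<r}"
  let ?T = "\<lambda>f. (\<Prod>i\<in>?I. E i (f i)) * Determinant.det (Matrix.mat r r (\<lambda>(i, j). E j (f i)))"
  have perm: "p i < r" if "p permutes ?I" "i < r" for p i
    using permutes_in_image [OF that(1), of i] that(2) by simp
  have "minor_gram r E S = (\<Sum>p\<in>{p. p permutes ?I}. signof p * (\<Prod>i\<in>?I. \<Sum>c\<in>S. E i c * E (p i) c))"
    unfolding minor_gram_def by (subst det_def' [of _ r]) (auto intro!: sum.cong prod.cong simp: perm)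
  also have "\<dots> = (\<Sum>p\<in>{p. p permutes ?I}. signof p * (\<Sum>f\<in>?I \<rightarrow>\<^sub>E S. \<Prod>i\<in>?I. E i (f i) * E (p i) (f i)))"
    using assms by (simp add: prod_sum_PiE)
  also have "\<dots> = (\<Sum>f\<in>?I \<rightarrow>\<^sub>E S. \<Sum>p\<in>{p. p permutes ?I}. signof p * (\<Prod>i\<in>?I. E i (f i) * E (p i) (f i)))"
    by (simp only: sum_distrib_left) (rule sum.swap)
  also have "\<dots> = (\<Sum>f\<in>?I \<rightarrow>\<^sub>E S. ?T f)"
  proof (rule sum.cong [OF refl])
    fix f
    have "Determinant.det (Matrix.mat r r (\<lambda>(i, j). E j (f i)))
        = (\<Sum>p\<in>{p. p permutes ?I}. signof p * (\<Prod>i\<in>?I. E (p i) (f i)))"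
      by (subst det_def' [of _ r]) (auto intro!: sum.cong prod.cong simp: perm)
    then show "(\<Sum>p\<in>{p. p permutes ?I}. signof p * (\<Prod>i\<in>?I. E i (f i) * E (p i) (f i))) = ?T f"
      by (simp add: prod.distrib sum_distrib_left mult_ac)
  qed
  also have "\<dots> = (\<Sum>f\<in>{f \<in> ?I \<rightarrow>\<^sub>E S. inj_on f ?I}. ?T f)"
  proof (rule sum.mono_neutral_right)
    show "finite (?I \<rightarrow>\<^sub>E S)" using assms by (intro finite_PiE) auto
    show "\<forall>f\<in>(?I \<rightarrow>\<^sub>E S) - {f \<in> ?I \<rightarrow>\<^sub>E S. inj_on f ?I}. ?T f = 0"
    proof
      fix f assume "f \<in> (?I \<rightarrow>\<^sub>E S) - {f \<in> ?I \<rightarrow>\<^sub>E S. inj_on f ?I}"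
      then obtain i j where ij: "i < r" "j < r" "i \<noteq> j" "f i = f j"
        by (auto simp: inj_on_def)
      then have "Determinant.det (Matrix.mat r r (\<lambda>(i, j). E j (f i))) = 0"
        by (intro det_identical_rows [of _ r i j]) auto
      then show "?T f = 0" by simp
    qed
  qed auto
  finally show ?thesis .
qed

text \<open>The injective choices of columns are grouped by their image.\<close>

lemma Cauchy_Binet_gram:
  assumes "finite V"
  shows "minor_gram r E V = (\<Sum>S\<in>{S. S \<subseteq> V \<and> card S = r}. minor_gram r E S)"
proof -
  let ?I = "{0..<r}"
  let ?T = "\<lambda>f. (\<Prod>i\<in>?I. E i (f i)) * Determinant.det (Matrix.mat r r (\<lambda>(i, j). E j (f i)))"
  let ?A = "\<lambda>S. {f \<in> ?I \<rightarrow>\<^sub>E S. inj_on f ?I}"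
  have fin: "finite (?A S)" if "S \<subseteq> V" for S
    using finite_subset [OF that assms] by (simp add: finite_PiE)
  have img: "f ` ?I = S" if "f \<in> ?A S" "S \<subseteq> V" "card S = r" for f S
    using that finite_subset [OF that(2) assms] by (intro card_subset_eq) (auto simp: card_image)
  have "?A V = (\<Union>S\<in>{S. S \<subseteq> V \<and> card S = r}. ?A S)"
  proof (intro subset_antisym subsetI)
    fix f assume f: "f \<in> ?A V"
    then have "f \<in> ?A (f ` ?I)" by (auto simp: PiE_iff)
    moreover have "f ` ?I \<subseteq> V" "card (f ` ?I) = r"
      using f by (auto simp: card_image)
    ultimately show "f \<in> (\<Union>S\<in>{S. S \<subseteq> V \<and> card S = r}. ?A S)" by blast
  qed (auto simp: PiE_iff)
  then have "minor_gram r E V = (\<Sum>f\<in>(\<Union>S\<in>{S. S \<subseteq> V \<and> card S = r}. ?A S). ?T f)"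
    by (simp only: minor_gram_expand [OF assms])
  also have "\<dots> = (\<Sum>S\<in>{S. S \<subseteq> V \<and> card S = r}. \<Sum>f\<in>?A S. ?T f)"
  proof (rule sum.UNION_disjoint)
    show "finite {S. S \<subseteq> V \<and> card S = r}" using assms by simp
    show "\<forall>S\<in>{S. S \<subseteq> V \<and> card S = r}. finite (?A S)" using fin by blast
    show "\<forall>S\<in>{S. S \<subseteq> V \<and> card S = r}. \<forall>S'\<in>{S. S \<subseteq> V \<and> card S = r}. S \<noteq> S' \<longrightarrow> ?A S \<inter> ?A S' = {}"
    proof (intro ballI impI equals0I)
      fix S S' f
      assume S: "S \<in> {S. S \<subseteq> V \<and> card S = r}" "S' \<in> {S. S \<subseteq> V \<and> card S = r}" "S \<noteq> S'"
        and f: "f \<in> ?A S \<inter> ?A S'"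
      have "f ` ?I = S" "f ` ?I = S'"
        using S f by (intro img; blast)+
      with S(3) show False by simp
    qed
  qed
  also have "\<dots> = (\<Sum>S\<in>{S. S \<subseteq> V \<and> card S = r}. minor_gram r E S)"
    using finite_subset [OF _ assms] by (intro sum.cong) (auto simp: minor_gram_expand)
  finally show ?thesis .
qed

lemma minor_gram_square:
  assumes "distinct cs" "length cs = r"
  shows "minor_gram r E (set cs) = (Determinant.det (Matrix.mat r r (\<lambda>(i, j). E i (cs ! j))))\<^sup>2"
proof -
  let ?M = "Matrix.mat r r (\<lambda>(i, j). E i (cs ! j))"
  have c: "?M \<in> carrier_mat r r" "transpose_mat ?M \<in> carrier_mat r r" by auto
  have "Matrix.mat r r (\<lambda>(i, j). \<Sum>c\<in>set cs. E i c * E j c) = ?M * transpose_mat ?M"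
  proof (rule eq_matI)
    fix i j assume "i < dim_row (?M * transpose_mat ?M)" "j < dim_col (?M * transpose_mat ?M)"
    moreover have "(\<Sum>c\<in>set cs. E i c * E j c) = (\<Sum>l<r. E i (cs ! l) * E j (cs ! l))"
      using sum.reindex_bij_betw [OF bij_betw_nth [OF assms(1) refl refl], of "\<lambda>c. E i c * E j c"] assms(2)
      by simp
    ultimately show "Matrix.mat r r (\<lambda>(i, j). \<Sum>c\<in>set cs. E i c * E j c) $$ (i, j) = (?M * transpose_mat ?M) $$ (i, j)"
      by (simp add: scalar_prod_def lessThan_atLeast0)
  qed auto
  then show ?thesis
    using Determinant.det_mult [OF c] Determinant.det_transpose [OF c(1)]
    by (simp add: minor_gram_def power2_eq_square)
qed

text \<open>Families indexed by a finite set of cells are turned into lists. Their Gram determinants do not depend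
  on the order.\<close>

definition enum :: "'c set \<Rightarrow> 'c list" where
  "enum S = (SOME cs. distinct cs \<and> set cs = S)"

lemma enum: "finite S \<Longrightarrow> distinct (enum S)" "finite S \<Longrightarrow> set (enum S) = S"
proof -
  assume "finite S"
  then have "\<exists>cs. distinct cs \<and> set cs = S"
    using finite_distinct_list by blast
  from someI_ex [OF this] show "distinct (enum S)" "set (enum S) = S"
    by (simp_all add: enum_def)
qed

lemma length_enum: "finite S \<Longrightarrow> length (enum S) = card S"
  using enum distinct_card by metis

text \<open>Let \<open>e\<^sub>i\<close> be the vector supported on \<open>V\<close> for which \<open>\<langle>e\<^sub>i, v\<rangle>\<close> is the coefficient of \<open>b\<^sub>i\<close> in \<open>D v\<close>, for
  \<open>v\<close> supported on \<open>V\<close>. The family \<open>e\<close> is dual to \<open>u\<close>, and it lies in the span of \<open>u\<close> because both are orthogonal to the kernel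
  of \<open>D\<close> on the vectors supported on \<open>V\<close>. So the Gram matrices of \<open>e\<close> and \<open>u\<close> are inverse to each other. By the Cauchy-Binet formula, \<open>gram(e)\<close>
  is the sum of the squared minors of the matrix with rows \<open>e\<^sub>i\<close>, and each of these, multiplied by
  \<open>gram(b)\<close>, is the Gram determinant of the corresponding columns of \<open>D\<close>.\<close>

lemma sum_gram_columns:
  fixes D :: "real ^ 'c::finite \<Rightarrow> real ^ 'd::finite" and b :: "(real ^ 'd) list" and u :: "(real ^ 'c) list"
  assumes D: "linear D" and b: "lin_indep b" "length u = length b"
    and range: "\<And>c. c \<in> V \<Longrightarrow> D (axis c 1) \<in> span (set b)"
    and u: "\<And>j c. j < length b \<Longrightarrow> c \<notin> V \<Longrightarrow> u ! j $ c = 0" "\<And>j. j < length b \<Longrightarrow> D (u ! j) = b ! j"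
    and orth: "\<And>j z. j < length b \<Longrightarrow> D z = 0 \<Longrightarrow> (\<And>c. c \<notin> V \<Longrightarrow> z $ c = 0) \<Longrightarrow> inner (u ! j) z = 0"
  shows "(\<Sum>S\<in>{S. S \<subseteq> V \<and> card S = length b}. gram (map (\<lambda>c. D (axis c 1)) (enum S))) * gram u = gram b"
proof -
  let ?r = "length b"
  have "\<exists>a. c \<in> V \<longrightarrow> D (axis c 1) = lincomb a b" for c
    using range [of c] by (auto simp: span_set_eq_lincomb)
  then obtain A where A: "\<And>c. c \<in> V \<Longrightarrow> D (axis c 1) = lincomb (A c) b"
    by metis
  define E where "E i c = A c i" for i c
  define e where "e i = (\<chi> c. if c \<in> V then E i c else 0)" for i
  have inner_e: "inner (e i) v = (\<Sum>c\<in>V. E i c * v $ c)" for i v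
  proof -
    have "inner (e i) v = (\<Sum>c\<in>UNIV. (if c \<in> V then E i c * v $ c else 0))"
      by (auto simp: inner_vec_def e_def intro!: sum.cong)
    then show ?thesis by (simp add: sum.If_cases)
  qed
  have Dv: "D v = lincomb (\<lambda>i. inner (e i) v) b" if v: "\<And>c. c \<notin> V \<Longrightarrow> v $ c = 0" for v
  proof -
    have "v = (\<Sum>c\<in>V. v $ c *\<^sub>R axis c 1)"
      using v by (rule supported_expand)
    then have "D v = (\<Sum>c\<in>V. v $ c *\<^sub>R D (axis c 1))"
      using D by (metis (no_types, lifting) linear_scale linear_sum sum.cong)
    also have "\<dots> = (\<Sum>c\<in>V. \<Sum>i<?r. (E i c * v $ c) *\<^sub>R b ! i)"
      using A by (intro sum.cong refl) (simp add: lincomb_def E_def scaleR_sum_right mult.commute)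
    also have "\<dots> = lincomb (\<lambda>i. inner (e i) v) b"
      unfolding lincomb_def inner_e by (subst sum.swap) (simp add: scaleR_sum_left)
    finally show ?thesis .
  qed
  have eu: "inner (e i) (u ! j) = (if i = j then 1 else 0)" if "i < ?r" "j < ?r" for i j
  proof -
    have "lincomb (\<lambda>i. inner (e i) (u ! j)) b = lincomb (\<lambda>i. if i = j then 1 else 0) b"
      using Dv [of "u ! j"] u that lincomb_unit [of j b] by simp
    from lin_indep_unique [OF b(1) this that(1)] show ?thesis by simp
  qed
  have e_supp: "e i $ c = 0" if "c \<notin> V" for i c
    using that by (simp add: e_def)
  have e_expand: "e i = (\<Sum>j<?r. inner (e i) (e j) *\<^sub>R u ! j)" if i: "i < ?r" for i
  proof -
    \<comment> \<open>The difference \<open>x\<close> lies in the kernel of \<open>D\<close>, to which \<open>e\<^sub>i\<close> and all \<open>u\<^sub>j\<close> are orthogonal; so \<open>x\<close> is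
       orthogonal to itself.\<close>
    define x where "x = e i - (\<Sum>j<?r. inner (e i) (e j) *\<^sub>R u ! j)"
    have supp: "x $ c = 0" if "c \<notin> V" for c
      using that u(1) e_supp by (simp add: x_def)
    have "inner (e l) x = 0" if l: "l < ?r" for l
    proof -
      have "inner (e l) x = inner (e l) (e i) - (\<Sum>j<?r. inner (e i) (e j) * inner (e l) (u ! j))"
        by (simp add: x_def inner_diff_right inner_sum_right)
      also have "(\<Sum>j<?r. inner (e i) (e j) * inner (e l) (u ! j)) = (\<Sum>j<?r. if l = j then inner (e i) (e j) else 0)"
        using l by (intro sum.cong) (auto simp: eu)
      also have "\<dots> = inner (e l) (e i)"
        using l by (simp add: inner_commute)
      finally show ?thesis by simp
    qed
    then have "lincomb (\<lambda>i. inner (e i) x) b = lincomb (\<lambda>i. 0) b"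
      by (intro lincomb_cong)
    then have Dx: "D x = 0"
      using Dv [OF supp] by simp
    have "lincomb (\<lambda>i. inner (e i) x) b = 0"
      using Dv [OF supp] Dx by simp
    then have "inner (e i) x = 0"
      using lin_indepD [OF b(1)] i by blast
    moreover have "inner (u ! j) x = 0" if "j < ?r" for j
      using orth [OF that Dx supp] .
    ultimately have "inner x x = 0"
      by (subst (1) x_def) (simp add: inner_diff_left inner_sum_left)
    then show ?thesis by (simp add: x_def)
  qed
  let ?Ge = "Matrix.mat ?r ?r (\<lambda>(i, j). inner (e i) (e j))"
  let ?Gu = "Matrix.mat ?r ?r (\<lambda>(i, j). inner (u ! i) (u ! j))"
  have "?Ge * ?Gu = 1\<^sub>m ?r"
  proof (rule eq_matI)
    fix i l assume "i < dim_row (1\<^sub>m ?r :: real Matrix.mat)" "l < dim_col (1\<^sub>m ?r :: real Matrix.mat)"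
    then have il: "i < ?r" "l < ?r" by auto
    have "(?Ge * ?Gu) $$ (i, l) = inner (\<Sum>j<?r. inner (e i) (e j) *\<^sub>R u ! j) (u ! l)"
      using il by (simp add: scalar_prod_def lessThan_atLeast0 inner_sum_left)
    also have "\<dots> = inner (e i) (u ! l)"
      using e_expand [OF il(1)] by simp
    finally show "(?Ge * ?Gu) $$ (i, l) = (1\<^sub>m ?r :: real Matrix.mat) $$ (i, l)"
      using il by (simp add: eu)
  qed auto
  moreover have "?Ge \<in> carrier_mat ?r ?r" "?Gu \<in> carrier_mat ?r ?r" by auto
  ultimately have "Determinant.det ?Ge * Determinant.det ?Gu = 1"
    using Determinant.det_mult [of ?Ge ?r ?Gu] by simp
  moreover have "Determinant.det ?Gu = gram u"
    by (simp add: gram_def b(2))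
  moreover have "inner (e i) (e j) = (\<Sum>c\<in>V. E i c * E j c)" for i j
    by (subst inner_e) (auto simp: e_def intro!: sum.cong)
  ultimately have one: "minor_gram ?r E V * gram u = 1"
    by (simp add: minor_gram_def)
  have "gram (map (\<lambda>c. D (axis c 1)) (enum S)) = minor_gram ?r E S * gram b"
    if S: "S \<subseteq> V" "card S = ?r" for S
  proof -
    have len: "length (enum S) = ?r" and set: "set (enum S) = S" and dist: "distinct (enum S)"
      using S by (simp_all add: length_enum enum)
    have "gram (map (\<lambda>c. D (axis c 1)) (enum S))
        = (Determinant.det (Matrix.mat ?r ?r (\<lambda>(i, j). E i (enum S ! j))))\<^sup>2 * gram b"
    proof (rule gram_change_of_basis)
      fix j assume j: "j < ?r"
      then have "enum S ! j \<in> V"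
        using S(1) set len by (metis nth_mem subsetD)
      then show "map (\<lambda>c. D (axis c 1)) (enum S) ! j = lincomb (\<lambda>i. E i (enum S ! j)) b"
        using j len A by (simp add: E_def)
    qed (simp add: len)
    then show ?thesis
      using minor_gram_square [OF dist len, of E] set by simp
  qed
  then have "(\<Sum>S\<in>{S. S \<subseteq> V \<and> card S = ?r}. gram (map (\<lambda>c. D (axis c 1)) (enum S))) = minor_gram ?r E V * gram b"
    by (simp add: Cauchy_Binet_gram [of V] sum_distrib_right)
  then show ?thesis
    using one by (metis mult.assoc mult.commute mult.left_neutral)
qed

section \<open>Rank and torsion of quotients of integral lattices\<close>

locale additive_quotient =
  fixes Z C :: "'v::ab_group_add set"
  assumes Z: "add_subgroup Z" and C: "add_subgroup C" and CZ: "C \<subseteq> Z"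
begin

abbreviation "Q \<equiv> additive_group Z Mod C"
abbreviation "cls z \<equiv> C #>\<^bsub>additive_group Z\<^esub> z"

lemma normal_C: "C \<lhd> additive_group Z"
proof -
  interpret comm_group "additive_group Z"
    by (rule comm_group_additive_group [OF Z])
  have "subgroup C (additive_group Z)"
  proof (rule subgroupI)
    fix a assume "a \<in> C"
    moreover have "inv\<^bsub>additive_group Z\<^esub> a = - a" if "a \<in> C"
      using that CZ add_subgroup_uminus [OF Z, of a] by (intro inv_equality) auto
    ultimately show "inv\<^bsub>additive_group Z\<^esub> a \<in> C"
      using add_subgroup_uminus [OF C] by simp
  qed (use CZ add_subgroup_zero [OF C] add_subgroup_add [OF C] in auto)
  then show ?thesis
    by (rule subgroup_imp_normal)
qed

lemma comm_group_Q: "comm_group Q"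
  by (rule comm_group.abelian_FactGroup [OF comm_group_additive_group [OF Z] normal_imp_subgroup [OF normal_C]])

lemma cls_hom: "(\<lambda>z. cls z) \<in> hom (additive_group Z) Q"
  by (rule normal.r_coset_hom_Mod [OF normal_C])

lemma carrier_Q: "carrier Q = (\<lambda>z. cls z) ` Z"
  by (auto simp: FactGroup_def RCOSETS_def)

lemma one_Q: "\<one>\<^bsub>Q\<^esub> = C"
  by (simp add: FactGroup_def)

lemma mem_cls: "w \<in> cls z \<longleftrightarrow> w - z \<in> C"
  by (auto simp: r_coset_def) (metis diff_add_cancel)

lemma cls_eq_iff: "cls z = cls w \<longleftrightarrow> z - w \<in> C"
proof
  assume "cls z = cls w"
  then show "z - w \<in> C"
    using mem_cls [of z z] mem_cls [of z w] add_subgroup_zero [OF C] by simp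
next
  assume zw: "z - w \<in> C"
  show "cls z = cls w"
  proof (intro Set.set_eqI iffI; unfold mem_cls)
    fix x assume "x - z \<in> C"
    then show "x - w \<in> C" using add_subgroup_add [OF C _ zw, of "x - z"] by simp
  next
    fix x assume "x - w \<in> C"
    then show "x - z \<in> C" using add_subgroup_diff [OF C _ zw, of "x - w"] by simp
  qed
qed

lemma cls_eq_C_iff: "cls z = C \<longleftrightarrow> z \<in> C"
proof -
  have "cls 0 = C" by (intro Set.set_eqI) (simp add: mem_cls)
  then show ?thesis using cls_eq_iff [of z 0] by simp
qed

end

locale integral_quotient = additive_quotient Z C for Z C :: "(int ^ 'c::finite) set"
begin

lemma Z_independent_iff:
  assumes "set zs \<subseteq> Z"
  shows "Z_independent Q (map (\<lambda>z. cls z) zs) \<longleftrightarrow>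
    (\<forall>m::nat \<Rightarrow> int. lincomb (\<lambda>i. of_int (m i)) (map real_vec zs) \<in> real_vec ` C \<longrightarrow> (\<forall>i<length zs. m i = 0))"
proof -
  have "Z_combination Q (map (\<lambda>z. cls z) zs) m = \<one>\<^bsub>Q\<^esub> \<longleftrightarrow> lincomb (\<lambda>i. of_int (m i)) (map real_vec zs) \<in> real_vec ` C"
    for m :: "nat \<Rightarrow> int"
  proof -
    have "real_vec \<in> hom (additive_group Z) (additive_group UNIV)"
      by (auto simp: hom_def)
    then have "lincomb (\<lambda>i. of_int (m i)) (map real_vec zs) = real_vec (Z_combination (additive_group Z) zs m)"
      using Z_combination_hom [OF comm_group_additive_group [OF Z] comm_group_additive_group, of UNIV real_vec zs m] assms
      by (simp add: Z_combination_UNIV add_subgroup_def)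
    moreover have "Z_combination Q (map (\<lambda>z. cls z) zs) m = cls (Z_combination (additive_group Z) zs m)"
      using assms by (intro Z_combination_hom comm_group_additive_group Z comm_group_Q cls_hom) simp
    ultimately show ?thesis
      by (simp add: one_Q cls_eq_C_iff real_vec_mem_image)
  qed
  moreover have "set (map (\<lambda>z. cls z) zs) \<subseteq> carrier Q"
    using assms by (auto simp: carrier_Q)
  ultimately show ?thesis
    by (simp add: Z_independent_def)
qed

lemma real_basis_C:
  obtains cs where "lattice_basis (real_vec ` C) cs" "lin_indep cs" "span (set cs) = span (real_vec ` C)"
proof -
  obtain cs where cs: "lattice_basis (real_vec ` C) cs" "lin_indep cs"
    using integral_lattice_basis [OF add_subgroup_real_vec [OF C]] by blast
  then show thesis
    using that span_lattice_basis [OF add_subgroup_real_vec [OF C] cs(1)] by blast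
qed

text \<open>Independence modulo the lattice \<open>C\<close> becomes linear independence once a basis of \<open>C\<close> is put in front.\<close>

lemma lin_indep_append:
  assumes cs: "lattice_basis (real_vec ` C) cs" and ws: "set ws \<subseteq> range real_vec"
    and indep: "\<And>m::nat \<Rightarrow> int. lincomb (\<lambda>i. of_int (m i)) ws \<in> real_vec ` C \<Longrightarrow> \<forall>i<length ws. m i = 0"
  shows "lin_indep (cs @ ws)"
proof (rule lin_indep_of_int_indep)
  show "set (cs @ ws) \<subseteq> range real_vec"
    using cs ws by (auto simp: lattice_basis_def)
  fix m :: "nat \<Rightarrow> int"
  let ?n = "length cs"
  assume "lincomb (\<lambda>i. of_int (m i)) (cs @ ws) = 0"
  then have 0: "lincomb (\<lambda>i. of_int (m i)) cs + lincomb (\<lambda>i. of_int (m (?n + i))) ws = 0"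
    by (simp add: lincomb_append)
  have sub: "add_subgroup (real_vec ` C)"
    by (rule add_subgroup_real_vec [OF C])
  have "lincomb (\<lambda>i. of_int (m i)) cs \<in> real_vec ` C"
    using lattice_basis_eq_Z_span [OF sub cs] by (simp add: Z_span_def)
  then have "lincomb (\<lambda>i. of_int (m (?n + i))) ws \<in> real_vec ` C"
    using 0 add_subgroup_uminus [OF sub] by (metis add_eq_0_iff)
  from indep [OF this] have w: "\<forall>i<length ws. m (?n + i) = 0" .
  then have "lincomb (\<lambda>i. of_int (m (?n + i))) ws = 0"
    by (simp add: lincomb_def)
  with 0 have "lincomb (\<lambda>i. of_int (m i)) cs = 0" by simp
  then have "\<forall>i<?n. m i = 0"
    using cs by (simp add: lattice_basis_def)
  with w show "\<forall>i<length (cs @ ws). m i = 0"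
    by (metis add_diff_inverse_nat length_append nat_add_left_cancel_less)
qed

text \<open>A family of elements of \<open>Z\<close> is independent modulo \<open>C\<close> if and only if it is linearly independent after a
  basis of \<open>C\<close>; such families have at most as many members as the difference of the dimensions, and one of
  that size is found by extending a basis of \<open>C\<close> inside \<open>Z\<close>.\<close>

lemma Z_rank_Q: "Z_rank Q = dim (real_vec ` Z) - dim (real_vec ` C)"
proof -
  obtain cs where cs: "lattice_basis (real_vec ` C) cs" "lin_indep cs" and span_cs: "span (set cs) = span (real_vec ` C)"
    by (rule real_basis_C)
  have lcs: "length cs = dim (real_vec ` C)"
    using length_eq_dim [OF cs(2)] span_cs by simp
  show ?thesis
    unfolding Z_rank_def
  proof (rule Greatest_equality)
    have "set cs \<subseteq> real_vec ` C"
      using cs(1) by (simp add: lattice_basis_def)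
    also have "\<dots> \<subseteq> real_vec ` Z" using CZ by (rule image_mono)
    finally have "set cs \<subseteq> real_vec ` Z" .
    moreover have "independent (set cs)" using cs(2) by (simp add: lin_indep_iff)
    ultimately obtain B where B: "set cs \<subseteq> B" "B \<subseteq> real_vec ` Z" "independent B" "real_vec ` Z \<subseteq> span B"
      by (rule maximal_independent_subset_extend)
    have finB: "finite B" using B(3) by (rule independent_imp_finite)
    define ws where "ws = enum (B - set cs)"
    have ws: "distinct ws" "set ws = B - set cs"
      using finB by (simp_all add: ws_def enum)
    have "lin_indep (cs @ ws)"
      using ws cs(2) B by (auto simp: lin_indep_iff Un_absorb1)
    have "span B = span (real_vec ` Z)"
      using B(2,4) by (meson span_mono span_minimal subspace_span subset_antisym)
    then have "dim (real_vec ` Z) = card B"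
      using B(3) by (rule dim_eq_card)
    moreover have "card B = length cs + length ws"
    proof -
      have "card B = card (set cs) + card (B - set cs)"
        using card_Diff_subset [of "set cs" B] card_mono [OF finB B(1)] B(1) by simp
      moreover have "length ws = card (B - set cs)"
        using distinct_card [OF ws(1)] ws(2) by simp
      moreover have "length cs = card (set cs)"
        using cs(2) by (simp add: lin_indep_iff distinct_card)
      ultimately show ?thesis by simp
    qed
    ultimately have lws: "length ws = dim (real_vec ` Z) - dim (real_vec ` C)"
      by (simp add: lcs)
    define zs where "zs = map (inv_into Z real_vec) ws"
    have wZ: "w \<in> real_vec ` Z" if "w \<in> set ws" for w
      using that ws B(2) by auto
    have zs: "set zs \<subseteq> Z" "map real_vec zs = ws"
      using wZ by (auto simp: zs_def inv_into_into f_inv_into_f intro!: map_idI)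
    have "Z_independent Q (map (\<lambda>z. cls z) zs)"
      unfolding Z_independent_iff [OF zs(1)] zs(2)
    proof (intro allI impI)
      fix m :: "nat \<Rightarrow> int" and i
      assume m: "lincomb (\<lambda>i. of_int (m i)) ws \<in> real_vec ` C" and i: "i < length zs"
      from m have "lincomb (\<lambda>i. of_int (m i)) ws \<in> span (set cs)"
        unfolding span_cs by (rule span_base)
      then obtain a where a: "lincomb (\<lambda>i. of_int (m i)) ws = lincomb a cs"
        by (auto simp: span_set_eq_lincomb)
      define b where "b i = (if i < length cs then a i else - of_int (m (i - length cs)))" for i
      have "lincomb b (cs @ ws) = lincomb a cs + lincomb (\<lambda>i. - of_int (m i)) ws"
        unfolding lincomb_append by (intro arg_cong2 [of _ _ _ _ "(+)"] lincomb_cong) (auto simp: b_def)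
      also have "\<dots> = 0"
        using lincomb_scale [of "-1" "\<lambda>i. of_int (m i)" ws] a by simp
      finally have "b (length cs + i) = 0"
        using lin_indepD [OF \<open>lin_indep (cs @ ws)\<close>, of b "length cs + i"] i by (simp add: zs_def)
      then show "m i = 0" by (simp add: b_def)
    qed
    then show "\<exists>xs. length xs = dim (real_vec ` Z) - dim (real_vec ` C) \<and> Z_independent Q xs"
      using lws by (intro exI [of _ "map (\<lambda>z. cls z) zs"]) (simp add: zs_def)
  next
    fix n assume "\<exists>xs. length xs = n \<and> Z_independent Q xs"
    then obtain xs where xs: "length xs = n" "Z_independent Q xs" by blast
    then have "set xs \<subseteq> (\<lambda>z. cls z) ` Z"
      by (simp add: Z_independent_def carrier_Q)
    note xsZ = this
    define zs where "zs = map (inv_into Z (\<lambda>z. cls z)) xs"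
    have zs: "set zs \<subseteq> Z" "xs = map (\<lambda>z. cls z) zs"
      using xsZ
      by (auto simp: zs_def subset_iff f_inv_into_f inv_into_into o_def intro!: map_idI [symmetric])
    have "lin_indep (cs @ map real_vec zs)"
      using xs(2) unfolding zs(2) Z_independent_iff [OF zs(1)]
      by (intro lin_indep_append cs) auto
    from length_eq_dim [OF this] have "length cs + n = dim (set (cs @ map real_vec zs))"
      using zs xs by simp
    also have "\<dots> \<le> dim (real_vec ` Z)"
    proof (rule dim_subset)
      have "set cs \<subseteq> real_vec ` C"
        using cs(1) by (simp add: lattice_basis_def)
      also have "\<dots> \<subseteq> real_vec ` Z" using CZ by (rule image_mono)
      finally show "set (cs @ map real_vec zs) \<subseteq> real_vec ` Z"
        using zs by auto
    qed
    finally show "n \<le> dim (real_vec ` Z) - dim (real_vec ` C)"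
      by (simp add: lcs)
  qed
qed

lemma real_vec_nat_pow: "real_vec (z [^]\<^bsub>additive_group Z\<^esub> (n::nat)) = real n *\<^sub>R real_vec z"
  by (induction n) (simp_all add: scaleR_add_left)

text \<open>If \<open>z\<close> lies in the real span of \<open>C\<close>, then a basis of \<open>C\<close> followed by \<open>z\<close> is dependent over \<open>\<real>\<close>, hence over
  \<open>\<int>\<close>, so that a multiple of \<open>z\<close> lies in \<open>C\<close>.\<close>

lemma torsion_subgroup_Q:
  "torsion_subgroup Q = (\<lambda>z. cls z) ` {z \<in> Z. real_vec z \<in> span (real_vec ` C)}"
proof -
  have iff: "(\<exists>n>0. cls z [^]\<^bsub>Q\<^esub> (n::nat) = \<one>\<^bsub>Q\<^esub>) \<longleftrightarrow> real_vec z \<in> span (real_vec ` C)" if z: "z \<in> Z" for z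
  proof -
    have pow: "cls z [^]\<^bsub>Q\<^esub> n = \<one>\<^bsub>Q\<^esub> \<longleftrightarrow> real n *\<^sub>R real_vec z \<in> real_vec ` C" for n :: nat
    proof -
      have "cls z [^]\<^bsub>Q\<^esub> n = cls (z [^]\<^bsub>additive_group Z\<^esub> n)"
        using hom_nat_pow [OF cls_hom _ comm_group.axioms(2) [OF comm_group_additive_group [OF Z]]
            comm_group.axioms(2) [OF comm_group_Q], of z n] z by simp
      then show ?thesis
        by (simp add: one_Q cls_eq_C_iff real_vec_mem_image flip: real_vec_nat_pow)
    qed
    show ?thesis
    proof
      assume "\<exists>n>0. cls z [^]\<^bsub>Q\<^esub> (n::nat) = \<one>\<^bsub>Q\<^esub>"
      then obtain n :: nat where "0 < n" "real n *\<^sub>R real_vec z \<in> real_vec ` C"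
        unfolding pow by blast
      then have "inverse (real n) *\<^sub>R (real n *\<^sub>R real_vec z) \<in> span (real_vec ` C)"
        by (intro span_scale span_base)
      then show "real_vec z \<in> span (real_vec ` C)" using \<open>0 < n\<close> by simp
    next
      assume sp: "real_vec z \<in> span (real_vec ` C)"
      obtain cs where cs: "lattice_basis (real_vec ` C) cs" "lin_indep cs" "span (set cs) = span (real_vec ` C)"
        by (rule real_basis_C)
      have "\<not> lin_indep (cs @ [real_vec z])"
        using sp cs(3) by (simp add: lin_indep_snoc)
      then obtain m :: "nat \<Rightarrow> int" where m: "lincomb (\<lambda>i. of_int (m i)) [real_vec z] \<in> real_vec ` C" "m 0 \<noteq> 0"
        using lin_indep_append [OF cs(1), of "[real_vec z]"] by auto
      then have "of_int (m 0) *\<^sub>R real_vec z \<in> real_vec ` C"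
        by (simp add: lincomb_def)
      moreover have sub: "add_subgroup (real_vec ` C)"
        by (rule add_subgroup_real_vec [OF C])
      ultimately have "real (nat \<bar>m 0\<bar>) *\<^sub>R real_vec z \<in> real_vec ` C"
        using add_subgroup_uminus [OF sub, of "of_int (m 0) *\<^sub>R real_vec z"] by (auto simp: abs_if)
      then show "\<exists>n>0. cls z [^]\<^bsub>Q\<^esub> (n::nat) = \<one>\<^bsub>Q\<^esub>"
        using m(2) unfolding pow by (intro exI [of _ "nat \<bar>m 0\<bar>"]) simp
    qed
  qed
  show ?thesis
    unfolding torsion_subgroup_def carrier_Q using iff by auto
qed

text \<open>The torsion subgroup is the quotient by \<open>C\<close> of the lattice of all elements of \<open>Z\<close> in the real span of \<open>C\<close>,
  so its order is the index of \<open>C\<close> in that lattice.\<close>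

lemma card_torsion_Q:
  assumes ys: "lattice_basis (real_vec ` C) ys"
    and \<sigma>: "lattice_basis (real_vec ` {z \<in> Z. real_vec z \<in> span (real_vec ` C)}) \<sigma>"
  shows "(real (card (torsion_subgroup Q)))\<^sup>2 * gram \<sigma> = gram ys"
proof -
  let ?W = "{z \<in> Z. real_vec z \<in> span (real_vec ` C)}"
  have W: "add_subgroup ?W"
    using Z by (auto simp: add_subgroup_def span_zero intro: span_diff)
  have CW: "C \<subseteq> ?W"
    using CZ by (auto intro: span_base)
  have rC: "add_subgroup (real_vec ` C)" and rW: "add_subgroup (real_vec ` ?W)"
    using add_subgroup_real_vec C W by blast+
  have li\<sigma>: "lin_indep \<sigma>" and liys: "lin_indep ys"
    using lattice_basis_lin_indep [OF \<sigma>] lattice_basis_lin_indep [OF ys] by auto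
  have span\<sigma>: "span (set \<sigma>) = span (real_vec ` C)"
    unfolding span_lattice_basis [OF rW \<sigma>]
    using CW by (intro subset_antisym span_minimal span_mono image_mono subspace_span) auto
  have Wspan: "real_vec ` ?W = Z_span \<sigma>"
    by (rule lattice_basis_eq_Z_span [OF rW \<sigma>])
  have "real_vec ` C \<subseteq> Z_span \<sigma>"
    using CW unfolding Wspan [symmetric] by (rule image_mono)
  from sublattice_basis [OF li\<sigma> this rC]
  obtain ys' where ys': "lattice_basis (real_vec ` C) ys'" "lin_indep ys'"
    and R: "length ys' = length \<sigma> \<longrightarrow> (\<exists>R. finite R \<and> transversal R (Z_span \<sigma>) (real_vec ` C) \<and> gram ys' = (real (card R))\<^sup>2 * gram \<sigma>)"
    by blast
  have "length ys' = length \<sigma>"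
    using length_eq_dim [OF ys'(2)] length_eq_dim [OF li\<sigma>] span\<sigma> span_lattice_basis [OF rC ys'(1)] by simp
  then obtain R where R: "transversal R (real_vec ` ?W) (real_vec ` C)" "gram ys' = (real (card R))\<^sup>2 * gram \<sigma>"
    using R Wspan by auto
  define R' where "R' = {z. real_vec z \<in> R}"
  have RR': "R = real_vec ` R'" and R'W: "R' \<subseteq> ?W"
  proof -
    have "R \<subseteq> real_vec ` ?W"
      using R(1) by (simp add: transversal_def)
    then show "R = real_vec ` R'" "R' \<subseteq> ?W"
      by (auto simp: R'_def real_vec_inj)
  qed
  note memC = real_vec_mem_image [of _ C]
  have "torsion_subgroup Q = (\<lambda>z. cls z) ` R'"
    unfolding torsion_subgroup_Q
  proof
    show "(\<lambda>z. cls z) ` ?W \<subseteq> (\<lambda>z. cls z) ` R'"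
    proof
      fix x assume "x \<in> (\<lambda>z. cls z) ` ?W"
      then obtain z where z: "z \<in> ?W" "x = cls z" by blast
      then obtain \<rho> where "\<rho> \<in> R'" "real_vec z - real_vec \<rho> \<in> real_vec ` C"
        using R(1) unfolding RR' transversal_def by blast
      then show "x \<in> (\<lambda>z. cls z) ` R'"
        using z(2) cls_eq_iff [of z \<rho>] memC by (metis image_eqI real_vec_simps(3))
    qed
  qed (use R'W in blast)
  moreover have "inj_on (\<lambda>z. cls z) R'"
  proof (rule inj_onI)
    fix z w assume zw: "z \<in> R'" "w \<in> R'" "cls z = cls w"
    then have "real_vec z - real_vec w \<in> real_vec ` C"
      using memC [of "z - w"] by (simp add: cls_eq_iff)
    then have "real_vec z = real_vec w"
      using R(1) zw unfolding RR' transversal_def by blast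
    then show "z = w" by (simp add: real_vec_inj)
  qed
  ultimately have "card (torsion_subgroup Q) = card R'"
    by (simp add: card_image)
  also have "\<dots> = card R"
    unfolding RR' by (simp add: card_image inj_on_subset [OF inj_real_vec])
  finally show ?thesis
    using R(2) lattice_basis_unique(2) [OF ys ys'(1)] by simp
qed

end

section \<open>Chains, cycles and boundaries\<close>

lemma chainsI: "(\<And>c. c \<notin> cells_of_dim X k \<Longrightarrow> v $ c = 0) \<Longrightarrow> v \<in> chains X k"
  by (simp add: chains_def)

lemma chainsD: "v \<in> chains X k \<Longrightarrow> c \<notin> cells_of_dim X k \<Longrightarrow> v $ c = 0"
  by (simp add: chains_def)

lemma bdry_add: "bdry X (v + w) = bdry X v + bdry X w"
  by (simp add: Finite_Cartesian_Product.vec_eq_iff bdry_def distrib_left sum.distrib)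

lemma bdry_diff: "bdry X (v - w) = bdry X v - bdry X w"
  by (simp add: Finite_Cartesian_Product.vec_eq_iff bdry_def right_diff_distrib sum_subtractf)

lemma bdry_0 [simp]: "bdry X 0 = 0"
  using bdry_diff [of X 0 0] by simp

lemma linear_bdry: "linear (bdry X :: real ^ 'c \<Rightarrow> real ^ 'c::finite)"
  by (rule linearI)
     (simp_all add: bdry_add, simp add: Finite_Cartesian_Product.vec_eq_iff bdry_def sum_distrib_left mult_ac)

lemma real_vec_bdry: "real_vec (bdry X z) = bdry X (real_vec z)"
  by (simp add: Finite_Cartesian_Product.vec_eq_iff bdry_def)

lemma real_vec_axis: "real_vec (axis c 1) = axis c 1"
  by (simp add: Finite_Cartesian_Product.vec_eq_iff axis_def)

lemma real_vec_in_chains: "real_vec z \<in> chains X k \<longleftrightarrow> z \<in> chains X k"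
  by (simp add: chains_def)

lemma real_vec_in_cycles: "real_vec z \<in> cycles X k \<longleftrightarrow> z \<in> cycles X k"
  by (simp add: cycles_def real_vec_in_chains flip: real_vec_bdry) (metis real_vec_inj real_vec_simps(1))

lemma add_subgroup_chains: "add_subgroup (chains X k)"
  by (simp add: add_subgroup_def chains_def)

lemma add_subgroup_cycles: "add_subgroup (cycles X k)"
  using add_subgroup_chains [of X k] by (auto simp: add_subgroup_def cycles_def bdry_diff)

lemma add_subgroup_bdry_image:
  assumes "add_subgroup L" shows "add_subgroup (bdry X ` L)"
proof -
  have "0 \<in> bdry X ` L"
    using add_subgroup_zero [OF assms] by (intro image_eqI [of _ _ 0]) simp_all
  then show ?thesis
    using assms by (auto simp: add_subgroup_def simp flip: bdry_diff)
qed

lemma add_subgroup_boundaries: "add_subgroup (boundaries X k)"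
  unfolding boundaries_def by (intro add_subgroup_bdry_image add_subgroup_chains)

lemma subspace_chains: "subspace (chains X k :: (real ^ 'c::finite) set)"
  by (simp add: subspace_def chains_def)

lemma subspace_cycles: "subspace (cycles X k :: (real ^ 'c::finite) set)"
  using subspace_chains [of X k] linear_bdry [of X]
  by (auto simp: subspace_def cycles_def bdry_add linear_scale)

lemma subspace_boundaries: "subspace (boundaries X k :: (real ^ 'c::finite) set)"
  unfolding boundaries_def by (intro linear_subspace_image linear_bdry subspace_chains)

lemma bdry_in_chains:
  assumes "v \<in> chains X (Suc k)" shows "bdry X v \<in> chains X k"
proof (rule chainsI)
  fix d assume d: "d \<notin> cells_of_dim X k"
  show "bdry X v $ d = 0"
  proof (cases "d \<in> cells X")
    case True
    with d have "cell_dim X d \<noteq> k" by (simp add: cells_of_dim_def)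
    then have "v $ c = 0" if "c \<in> cells_of_dim X (Suc (cell_dim X d))" for c
      using that by (intro chainsD [OF assms]) (simp add: cells_of_dim_def)
    then show ?thesis by (simp add: bdry_def)
  qed (simp add: bdry_def)
qed

lemma real_boundaries_eq_span:
  "boundaries X k = span (real_vec ` boundaries X k)"
proof
  show "boundaries X k \<subseteq> span (real_vec ` boundaries X k)"
  proof
    fix x :: "real ^ 'a" assume "x \<in> boundaries X k"
    then obtain v where v: "v \<in> chains X (Suc k)" "x = bdry X v"
      by (auto simp: boundaries_def)
    have "x = (\<Sum>c\<in>cells_of_dim X (Suc k). v $ c *\<^sub>R bdry X (axis c 1))"
      unfolding v(2) using supported_expand [OF chainsD [OF v(1)]] linear_bdry [of X]
      by (metis (no_types, lifting) linear_scale linear_sum sum.cong)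
    moreover have "bdry X (axis c 1) \<in> span (real_vec ` boundaries X k)" if "c \<in> cells_of_dim X (Suc k)" for c
    proof (rule span_base)
      have "bdry X (axis c (1::int)) \<in> boundaries X k"
        using that by (auto simp: boundaries_def axis_def intro!: imageI chainsI)
      then show "bdry X (axis c (1::real)) \<in> real_vec ` boundaries X k"
        by (metis imageI real_vec_axis real_vec_bdry)
    qed
    ultimately show "x \<in> span (real_vec ` boundaries X k)"
      by (auto intro: span_sum span_scale)
  qed
  have "real_vec ` boundaries X k \<subseteq> (boundaries X k :: (real ^ 'a) set)"
    by (auto simp: boundaries_def real_vec_bdry real_vec_in_chains)
  then show "span (real_vec ` boundaries X k) \<subseteq> boundaries X k"
    by (intro span_minimal subspace_boundaries)
qed

text \<open>The real \<open>k\<close>-cycles are the kernel of an integral map on the vectors supported on the \<open>k\<close>-cells.\<close>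

lemma real_cycles_eq_span:
  "cycles X k = span (real_vec ` cycles X k)"
proof
  show "cycles X k \<subseteq> span (real_vec ` cycles X k)"
  proof
    fix v :: "real ^ 'a" assume v: "v \<in> cycles X k"
    let ?S = "- cells_of_dim X k"
    have "v \<in> span (real_vec ` {z. bdry X (real_vec z) = 0 \<and> (\<forall>c\<in>?S. z $ c = 0)})"
      using v by (intro rational_kernel linear_bdry) (auto simp: cycles_def chains_def simp flip: real_vec_bdry)
    also have "{z. bdry X (real_vec z) = 0 \<and> (\<forall>c\<in>?S. z $ c = 0)} = cycles X k"
      using real_vec_in_cycles [of _ X k] by (auto simp: cycles_def chains_def)
    finally show "v \<in> span (real_vec ` cycles X k)" .
  qed
  have "real_vec ` cycles X k \<subseteq> (cycles X k :: (real ^ 'a) set)"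
    by (auto simp: real_vec_in_cycles)
  then show "span (real_vec ` cycles X k) \<subseteq> cycles X k"
    by (intro span_minimal subspace_cycles)
qed

lemma cycles_0: "cycles X 0 = chains X 0"
proof -
  have "bdry X v = 0" if "v \<in> chains X 0" for v :: "'a ^ 'b"
    using that by (auto simp: Finite_Cartesian_Product.vec_eq_iff bdry_def chains_def cells_of_dim_def intro!: sum.neutral)
  then show ?thesis by (auto simp: cycles_def)
qed

lemma dim_chains: "dim (chains X k :: (real ^ 'c::finite) set) = card (cells_of_dim X k)"
proof -
  let ?B = "(\<lambda>c. axis c (1::real)) ` cells_of_dim X k"
  have "?B \<subseteq> Basis"
    by (auto simp: Basis_vec_def)
  then have "independent ?B"
    using independent_Basis independent_mono by blast
  moreover have "span ?B = chains X k"
  proof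
    show "span ?B \<subseteq> chains X k"
      by (intro span_minimal subspace_chains) (auto simp: axis_def chains_def)
    show "chains X k \<subseteq> span ?B"
    proof
      fix v :: "real ^ 'c" assume "v \<in> chains X k"
      then have "v = (\<Sum>c\<in>cells_of_dim X k. v $ c *\<^sub>R axis c 1)"
        by (intro supported_expand) (rule chainsD)
      then show "v \<in> span ?B"
        by (metis (no_types, lifting) imageI span_base span_scale span_sum)
    qed
  qed
  ultimately have "dim (chains X k :: (real ^ 'c) set) = card ?B"
    by (metis dim_span_eq_card_independent)
  also have "\<dots> = card (cells_of_dim X k)"
    by (intro card_image inj_onI) (auto simp: axis_eq_axis)
  finally show ?thesis .
qed

section \<open>Harmonic representatives and the homology lattice\<close>

locale chain_complex =
  fixes X :: "('a, 'c::finite) cell_complex"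
  assumes cell_structure: "cell_structure X"
begin

lemma boundaries_subset_cycles: "boundaries X k \<subseteq> cycles X k"
  using bdry_bdry [OF cell_structure] by (auto simp: boundaries_def cycles_def bdry_in_chains)

sublocale int: integral_quotient "cycles X k" "boundaries X k" for k
  by unfold_locales (rule add_subgroup_cycles add_subgroup_boundaries boundaries_subset_cycles)+

sublocale real: additive_quotient "cycles X k :: (real ^ 'c) set" "boundaries X k" for k
  by unfold_locales (rule add_subgroup_cycles add_subgroup_boundaries boundaries_subset_cycles)+

lemma carrier_homology: "carrier (homology_real X k) = homology_class X k ` cycles X k"
  by (simp add: homology_def real.carrier_Q homology_class_def)

lemma homology_class_eq_iff:
  "homology_class X k z = homology_class X k (w :: real ^ 'c) \<longleftrightarrow> z - w \<in> boundaries X k"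
  by (simp add: homology_class_def real.cls_eq_iff)

lemma mem_homology_class: "w \<in> homology_class X k z \<longleftrightarrow> w - (z :: real ^ 'c) \<in> boundaries X k"
  by (simp add: homology_class_def real.mem_cls)

text \<open>The passage to the harmonic representative as a map on chains. It is subtraction of the orthogonal
  projection to the boundaries, hence linear on the whole space.\<close>

definition harmonic :: "nat \<Rightarrow> real ^ 'c \<Rightarrow> real ^ 'c" where
  "harmonic k z = harmonic_rep X k (homology_class X k z)"

text \<open>Existence is the orthogonal decomposition with respect to the boundaries. Two representatives that are
  orthogonal to the boundaries differ by a boundary orthogonal to itself.\<close>

lemma harmonic:
  shows "harmonic k z - z \<in> boundaries X k" and "x \<in> boundaries X k \<Longrightarrow> inner x (harmonic k z) = 0"
    and "w - z \<in> boundaries X k \<Longrightarrow> (\<And>x. x \<in> boundaries X k \<Longrightarrow> inner x w = 0) \<Longrightarrow> harmonic k z = w"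
proof -
  let ?P = "\<lambda>w. w \<in> homology_class X k z \<and> w \<in> orthogonal_comp (boundaries X k)"
  have P: "?P w \<longleftrightarrow> w - z \<in> boundaries X k \<and> (\<forall>x\<in>boundaries X k. inner x w = 0)" for w
    by (auto simp: mem_homology_class orthogonal_comp_def real_inner_class.orthogonal_def)
  have uniq: "w = w'" if "?P w" "?P w'" for w w'
  proof -
    have "w - w' \<in> boundaries X k"
      using that subspace_diff [OF subspace_boundaries, of "w - z" X k "w' - z"] unfolding P by simp
    then have "inner (w - w') (w - w') = 0"
      using that unfolding P by (simp add: inner_diff_right)
    then show ?thesis by simp
  qed
  have "\<exists>w. ?P w"
  proof -
    obtain y0 w0 where "y0 \<in> span (boundaries X k)"
      "\<And>x. x \<in> span (boundaries X k) \<Longrightarrow> real_inner_class.orthogonal w0 x" "z = y0 + w0"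
      using orthogonal_subspace_decomp_exists [of "boundaries X k" z] by metis
    moreover have span: "span (boundaries X k) = (boundaries X k :: (real ^ 'c) set)"
      using subspace_boundaries by (simp add: span_eq_iff)
    ultimately have "?P w0"
      unfolding P using subspace_neg [OF subspace_boundaries, of y0 X k]
      by (auto simp: real_inner_class.orthogonal_def inner_commute)
    then show ?thesis ..
  qed
  then have "\<exists>!w. ?P w" using uniq by blast
  then have har: "?P (harmonic k z)"
    unfolding harmonic_def harmonic_rep_def by (rule theI')
  then show "harmonic k z - z \<in> boundaries X k" "x \<in> boundaries X k \<Longrightarrow> inner x (harmonic k z) = 0"
    unfolding P by simp_all
  show "harmonic k z = w" if "w - z \<in> boundaries X k" "\<And>x. x \<in> boundaries X k \<Longrightarrow> inner x w = 0"
    using that har uniq [of "harmonic k z" w] unfolding P by blast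
qed

lemma harmonic_linear: "linear (harmonic k)"
proof (rule linearI)
  fix z w show "harmonic k (z + w) = harmonic k z + harmonic k w"
  proof (rule harmonic(3))
    show "harmonic k z + harmonic k w - (z + w) \<in> boundaries X k"
      using subspace_add [OF subspace_boundaries harmonic(1) harmonic(1), of k z w] by (simp add: algebra_simps)
  qed (simp add: inner_add_right harmonic(2))
next
  fix r z show "harmonic k (r *\<^sub>R z) = r *\<^sub>R harmonic k z"
  proof (rule harmonic(3))
    show "r *\<^sub>R harmonic k z - r *\<^sub>R z \<in> boundaries X k"
      using subspace_scale [OF subspace_boundaries harmonic(1), of r k z] by (simp add: algebra_simps)
  qed (simp add: harmonic(2))
qed

lemma harmonic_eq_0_iff: "harmonic k z = 0 \<longleftrightarrow> z \<in> boundaries X k"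
proof
  assume "harmonic k z = 0"
  then show "z \<in> boundaries X k"
    using harmonic(1) [of k z] subspace_neg [OF subspace_boundaries, of "- z" X k] by simp
next
  assume "z \<in> boundaries X k"
  then show "harmonic k z = 0"
    using subspace_neg [OF subspace_boundaries, of z X k] by (intro harmonic(3)) auto
qed

lemma harmonic_in_cycles: "z \<in> cycles X k \<Longrightarrow> harmonic k z \<in> cycles X k"
  using subspace_add [OF subspace_cycles, of "harmonic k z - z" X k z] harmonic(1) boundaries_subset_cycles by auto

lemma harmonic_rep_in_class: "x \<in> carrier (homology_real X k) \<Longrightarrow> harmonic_rep X k x \<in> cycles X k \<and> homology_class X k (harmonic_rep X k x) = x"
proof -
  assume "x \<in> carrier (homology_real X k)"
  then obtain z where z: "z \<in> cycles X k" "x = homology_class X k z"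
    by (auto simp: carrier_homology)
  have "homology_class X k (harmonic k z) = homology_class X k z"
    unfolding homology_class_eq_iff by (rule harmonic(1))
  with z harmonic_in_cycles [OF z(1)] show ?thesis
    by (simp flip: harmonic_def)
qed

lemma homology_lattice_eq: "homology_lattice X k = (\<lambda>z. homology_class X k (real_vec z)) ` cycles X k"
proof -
  have "homology_extend X k (boundaries X k #>\<^bsub>additive_group (cycles X k)\<^esub> z) = homology_class X k (real_vec z)"
    if "z \<in> cycles X k" for z
  proof -
    have "homology_class X k (real_vec w) = homology_class X k (real_vec z)"
      if "w - z \<in> boundaries X k" for w
    proof -
      have "real_vec (w - z) \<in> boundaries X k"
        using that real_boundaries_eq_span span_base by blast
      then show ?thesis by (simp add: homology_class_eq_iff)
    qed
    then have "homology_extend X k (boundaries X k #>\<^bsub>additive_group (cycles X k)\<^esub> z)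
        = (\<Union>w\<in>boundaries X k #>\<^bsub>additive_group (cycles X k)\<^esub> z. homology_class X k (real_vec z))"
      unfolding homology_extend_def by (intro SUP_cong refl) (simp add: int.mem_cls)
    moreover have "z \<in> boundaries X k #>\<^bsub>additive_group (cycles X k)\<^esub> z"
      unfolding int.mem_cls using add_subgroup_zero [OF add_subgroup_boundaries] by simp
    then have "boundaries X k #>\<^bsub>additive_group (cycles X k)\<^esub> z \<noteq> {}"
      by blast
    ultimately show ?thesis
      by (simp only: UN_constant if_False)
  qed
  then show ?thesis
    unfolding homology_lattice_def homology_def int.carrier_Q image_image by (rule image_cong [OF refl])
qed

context
  fixes h k
  assumes h: "Z_basis ((homology_real X k)\<lparr>carrier := homology_lattice X k\<rparr>) h"
begin

abbreviation "harmonic_basis \<equiv> map (harmonic_rep X k) h"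

lemma image_harmonic_rep: "harmonic_rep X k ` homology_lattice X k = harmonic k ` real_vec ` cycles X k"
  by (simp add: homology_lattice_eq image_image harmonic_def)

text \<open>Taking harmonic representatives is an injective homomorphism on the homology lattice, so it carries a
  \<open>\<int>\<close>-basis to a \<open>\<int>\<close>-basis of the image.\<close>

lemma lattice_basis_harmonic: "lattice_basis (harmonic k ` real_vec ` cycles X k) harmonic_basis"
proof -
  let ?G = "(homology_real X k)\<lparr>carrier := homology_lattice X k\<rparr>"
  interpret H: comm_group "homology_real X k"
    unfolding homology_def by (rule real.comm_group_Q)
  let ?\<phi> = "\<lambda>z. homology_class X k (real_vec z)"
  have "(\<lambda>z. homology_class X k z) \<in> hom (additive_group (cycles X k)) (homology_real X k)"
    using real.cls_hom by (simp add: homology_def homology_class_def)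
  then have class_add: "homology_class X k (z + w) = homology_class X k z \<otimes>\<^bsub>homology_real X k\<^esub> homology_class X k w"
    if "z \<in> cycles X k" "w \<in> cycles X k" for z w
    using that by (simp add: hom_def)
  have "?\<phi> \<in> hom (additive_group (cycles X k)) (homology_real X k)"
    using class_add by (auto simp: hom_def real_vec_in_cycles carrier_homology)
  then have "group_hom (additive_group (cycles X k)) (homology_real X k) ?\<phi>"
    by (simp add: group_hom_def group_hom_axioms_def comm_group_additive_group add_subgroup_cycles comm_group.axioms(2) H.is_group)
  from group_hom.img_is_subgroup [OF this]
  have sub: "subgroup (homology_lattice X k) (homology_real X k)"
    by (simp add: homology_lattice_eq)
  have G: "comm_group ?G"
  proof (rule group.group_comm_groupI)
    show "Group.group ?G"
      by (rule subgroup.subgroup_is_group [OF sub H.is_group])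
    fix x y assume "x \<in> carrier ?G" "y \<in> carrier ?G"
    then show "x \<otimes>\<^bsub>?G\<^esub> y = y \<otimes>\<^bsub>?G\<^esub> x"
      using subgroup.subset [OF sub] by (auto intro!: H.m_comm)
  qed
  have rep: "harmonic_rep X k \<in> hom ?G (additive_group UNIV)"
    using linear_add [OF harmonic_linear, of k]
    by (auto simp: hom_def homology_lattice_eq real_vec_in_cycles simp flip: class_add harmonic_def)
  have inj: "harmonic_rep X k x = 0 \<longleftrightarrow> x = \<one>\<^bsub>?G\<^esub>" if "x \<in> homology_lattice X k" for x
  proof -
    have "\<one>\<^bsub>?G\<^esub> = homology_class X k 0"
      using homology_class_eq_iff [of k 0 0] real.one_Q [of k] real.cls_eq_C_iff [of k 0] add_subgroup_zero [OF add_subgroup_boundaries]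
      by (simp add: homology_def homology_class_def)
    moreover obtain z where "x = homology_class X k (real_vec z)"
      using \<open>x \<in> homology_lattice X k\<close> by (auto simp: homology_lattice_eq)
    ultimately show ?thesis
      using harmonic_eq_0_iff [of k "real_vec z"] homology_class_eq_iff [of k "real_vec z" 0]
      by (simp add: harmonic_def)
  qed
  have hl: "set h \<subseteq> homology_lattice X k"
    and indep: "\<And>m. Z_combination ?G h m = \<one>\<^bsub>?G\<^esub> \<Longrightarrow> \<forall>i<length h. m i = 0"
    and gen: "\<And>x. x \<in> homology_lattice X k \<Longrightarrow> \<exists>m. x = Z_combination ?G h m"
    using h by (auto simp: Z_basis_def Z_independent_def)
  have comb: "lincomb (\<lambda>i. of_int (m i)) harmonic_basis = harmonic_rep X k (Z_combination ?G h m)" for m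
    using Z_combination_hom [OF G comm_group_additive_group rep, of h m] hl
    by (simp add: Z_combination_UNIV add_subgroup_def)
  have closed: "Z_combination ?G h m \<in> homology_lattice X k" for m
  proof -
    interpret G: comm_group ?G by (rule G)
    have "finprod ?G (\<lambda>i. (h ! i) [^]\<^bsub>?G\<^esub> m i) {..<length h} \<in> carrier ?G"
    proof (intro G.finprod_closed Pi_I)
      fix i assume "i \<in> {..<length h}"
      then have "h ! i \<in> carrier ?G" using hl by auto
      then show "(h ! i) [^]\<^bsub>?G\<^esub> m i \<in> carrier ?G" by (rule G.int_pow_closed)
    qed
    then show ?thesis by (simp add: Z_combination_def)
  qed
  show ?thesis
    unfolding lattice_basis_def image_harmonic_rep [symmetric]
  proof (intro conjI ballI allI impI)
    fix m :: "nat \<Rightarrow> int" and i assume "lincomb (\<lambda>i. of_int (m i)) harmonic_basis = 0" "i < length harmonic_basis"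
    then show "m i = 0"
      using inj [OF closed] indep by (simp add: comb)
  next
    fix x assume "x \<in> harmonic_rep X k ` homology_lattice X k"
    then obtain y where "y \<in> homology_lattice X k" "x = harmonic_rep X k y" by blast
    then show "\<exists>m::nat \<Rightarrow> int. x = lincomb (\<lambda>i. of_int (m i)) harmonic_basis"
      using gen [of y] comb by metis
  qed (use hl in auto)
qed

lemma add_subgroup_harmonic: "add_subgroup (harmonic k ` real_vec ` cycles X k)"
proof -
  have "add_subgroup (real_vec ` (cycles X k :: (int ^ 'c) set))"
    by (intro add_subgroup_real_vec add_subgroup_cycles)
  then show ?thesis
    using linear_diff [OF harmonic_linear, of k] linear_0 [OF harmonic_linear, of k]
    unfolding add_subgroup_def by (auto simp: image_iff) (metis+)
qed

lemma eta_const_eq: "eta_const X k = gram harmonic_basis"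
  unfolding eta_const_def image_harmonic_rep
  by (rule covolume_squared [OF add_subgroup_harmonic lattice_basis_harmonic])

lemma harmonic_basis_lift:
  assumes "x \<in> set harmonic_basis"
  obtains z where "z \<in> cycles X k" "harmonic k (real_vec z) = x"
proof -
  have "set harmonic_basis \<subseteq> harmonic k ` real_vec ` cycles X k"
    using lattice_basis_harmonic unfolding lattice_basis_def by (elim conjE)
  then have "x \<in> harmonic k ` real_vec ` cycles X k"
    using assms by (rule subsetD)
  then show thesis using that by auto
qed

lemma harmonic_basis_cycle:
  assumes "x \<in> set harmonic_basis" shows "x \<in> cycles X k"
  using assms
proof (rule harmonic_basis_lift)
  fix z :: "int ^ 'c" assume "z \<in> cycles X k" "harmonic k (real_vec z) = x"
  then show ?thesis using harmonic_in_cycles [of "real_vec z" k] by (simp add: real_vec_in_cycles)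
qed

lemma harmonic_basis_orthogonal:
  assumes "x \<in> set harmonic_basis" "y \<in> boundaries X k"
  shows "inner y x = 0"
  using assms(1)
proof (rule harmonic_basis_lift)
  fix z :: "int ^ 'c" assume "harmonic k (real_vec z) = x"
  then show ?thesis using harmonic(2) [OF assms(2)] by blast
qed

text \<open>Lifts of the basis to integral cycles are independent modulo the lattice of boundaries, hence linearly
  independent after a basis of it. Their Gram determinant, which is not zero, has that of the harmonic
  basis as a factor.\<close>

lemma lin_indep_harmonic_basis: "lin_indep harmonic_basis"
proof -
  let ?hb = harmonic_basis
  have "\<exists>z. z \<in> cycles X k \<and> harmonic k (real_vec z) = x" if "x \<in> set ?hb" for x
    using that by (rule harmonic_basis_lift) blast
  then obtain g where g: "\<And>x. x \<in> set ?hb \<Longrightarrow> g x \<in> cycles X k \<and> harmonic k (real_vec (g x)) = x"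
    by metis
  define ws where "ws = map (\<lambda>x. real_vec (g x)) ?hb"
  have hw: "map (harmonic k) ws = ?hb"
    using g by (auto simp: ws_def intro!: map_idI)
  have len: "length ws = length ?hb" by (simp add: ws_def)
  obtain cs where cs: "lattice_basis (real_vec ` (boundaries X k :: (int ^ 'c) set)) cs" "lin_indep cs"
    "span (set cs) = span (real_vec ` (boundaries X k :: (int ^ 'c) set))"
    using int.real_basis_C by blast
  have spancs: "span (set cs) = boundaries X k"
    using cs(3) real_boundaries_eq_span by metis
  have "lin_indep (cs @ ws)"
  proof (rule int.lin_indep_append [OF cs(1)])
    show "set ws \<subseteq> range real_vec" by (auto simp: ws_def)
    fix m :: "nat \<Rightarrow> int" assume "lincomb (\<lambda>i. of_int (m i)) ws \<in> real_vec ` (boundaries X k :: (int ^ 'c) set)"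
    then have "lincomb (\<lambda>i. of_int (m i)) ws \<in> boundaries X k"
      using real_boundaries_eq_span span_base by blast
    then have "harmonic k (lincomb (\<lambda>i. of_int (m i)) ws) = 0"
      by (simp add: harmonic_eq_0_iff)
    then have "lincomb (\<lambda>i. of_int (m i)) ?hb = 0"
      using lincomb_map [OF harmonic_linear, of "\<lambda>i. of_int (m i)" k ws] by (simp only: hw)
    then show "\<forall>i<length ws. m i = 0"
      using lattice_basis_harmonic unfolding lattice_basis_def len by blast
  qed
  then have "gram (cs @ ws) \<noteq> 0" by (simp add: gram_eq_0_iff)
  moreover have "gram (cs @ ws) = gram cs * gram ?hb"
  proof (rule gram_append)
    fix j assume "j < length ws"
    then have "?hb ! j = harmonic k (ws ! j)"
      using hw by (metis nth_map)
    then show "ws ! j - ?hb ! j \<in> span (set cs)"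
      using harmonic(1) [of k "ws ! j"] subspace_neg [OF subspace_boundaries, of "harmonic k (ws ! j) - ws ! j" X k]
      by (simp add: spancs)
  next
    fix x y assume "x \<in> set cs" "y \<in> set ?hb"
    then show "inner x y = 0"
      using harmonic_basis_orthogonal [of y x] spancs span_base by blast
  qed (simp add: len)
  ultimately show ?thesis
    using gram_eq_0_iff by fastforce
qed

lemma cycles_eq_span_harmonic_basis:
  assumes "span (set bs) = boundaries X k"
  shows "span (set bs \<union> set harmonic_basis) = cycles X k"
proof
  show "span (set bs \<union> set harmonic_basis) \<subseteq> cycles X k"
    using assms span_superset [of "set bs"] boundaries_subset_cycles harmonic_basis_cycle
    by (intro span_minimal subspace_cycles) blast
  have "real_vec ` (cycles X k :: (int ^ 'c) set) \<subseteq> span (set bs \<union> set harmonic_basis)"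
  proof
    fix x assume x: "x \<in> real_vec ` (cycles X k :: (int ^ 'c) set)"
    have "harmonic k x \<in> Z_span harmonic_basis"
      using lattice_basis_eq_Z_span [OF add_subgroup_harmonic lattice_basis_harmonic] x by blast
    then have "harmonic k x \<in> span (set bs \<union> set harmonic_basis)"
      using Z_span_subset_span span_mono [of "set harmonic_basis" "set bs \<union> set harmonic_basis"] by blast
    moreover have "harmonic k x - x \<in> span (set bs \<union> set harmonic_basis)"
      using harmonic(1) [of k x] assms span_mono [of "set bs" "set bs \<union> set harmonic_basis"] by blast
    ultimately show "x \<in> span (set bs \<union> set harmonic_basis)"
      using span_diff by (metis diff_diff_eq2 diff_add_cancel add_diff_cancel_left')
  qed
  then show "cycles X k \<subseteq> span (set bs \<union> set harmonic_basis)"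
    by (subst real_cycles_eq_span) (intro span_minimal subspace_span)
qed

end

end

section \<open>Subcomplexes between consecutive skeleta\<close>

lemma restrict_cells_restrict_cells:
  assumes "B \<subseteq> A" shows "restrict_cells (restrict_cells X A) B = restrict_cells X B"
proof -
  have "(\<Union>c\<in>A. open_cell X c) \<inter> (\<Union>c\<in>B. open_cell X c) = (\<Union>c\<in>B. open_cell X c)"
    using assms by blast
  then show ?thesis
    unfolding restrict_cells_def [of "restrict_cells X A"] open_cell_restrict_cells
    by (simp add: restrict_cells_def subtopology_subtopology)
qed

context cell_structure begin

abbreviation low_cells :: "nat \<Rightarrow> 'c set" where
  "low_cells k \<equiv> {c \<in> cells X. cell_dim X c \<le> k}"

definition full_complex :: "nat \<Rightarrow> 'c set \<Rightarrow> ('a, 'c) cell_complex" where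
  "full_complex k S = restrict_cells X (low_cells k \<union> S)"

lemma full_subcomplex: "S \<subseteq> cells_of_dim X (Suc k) \<Longrightarrow> full_subcomplex X (low_cells k \<union> S) k"
  using cell_structure_axioms
  by (auto simp: full_subcomplex_def full_subcomplex_axioms_def cells_of_dim_def)

lemma full_complex_in_subcomplexes:
  assumes S: "S \<subseteq> cells_of_dim X (Suc k)"
  shows "full_complex k S \<in> subcomplexes (skeleton X (Suc k))"
proof -
  let ?S = "low_cells k \<union> S" and ?Y = "skeleton X (Suc k)"
  have sub: "?S \<subseteq> low_cells (Suc k)"
    using S by (auto simp: cells_of_dim_def)
  have "underlying ?Y closure_of open_cell ?Y c \<subseteq> (\<Union>d\<in>?S. open_cell ?Y d)" if c: "c \<in> ?S" for c
  proof -
    have cX: "c \<in> cells X" "cell_dim X c \<le> Suc k" using c sub by auto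
    let ?D = "char_map X c ` topspace (disk (cell_dim X c))"
    have "open_cell X c \<subseteq> ?D" by (auto simp: image_topspace_disk)
    then have "underlying X closure_of open_cell X c \<subseteq> ?D"
      by (rule closure_of_minimal [OF _ closedin_closed_cell [OF cX(1)]])
    moreover have "?D \<subseteq> (\<Union>d\<in>?S. open_cell X d)"
      using closed_cell_subset [OF cX(1)] c cX by (fastforce simp: union_of_cells_def)
    moreover have "underlying ?Y closure_of open_cell ?Y c \<subseteq> underlying X closure_of open_cell X c"
      by (simp add: skeleton_def closure_of_subtopology) (meson closure_of_mono inf_le2 le_infI2)
    ultimately show ?thesis by (simp add: skeleton_def)
  qed
  moreover have "full_complex k S = restrict_cells ?Y ?S"
    unfolding full_complex_def skeleton_def using restrict_cells_restrict_cells [OF sub, of X] by simp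
  moreover have "?S \<subseteq> cells ?Y" using sub by (simp add: skeleton_def)
  ultimately show ?thesis
    unfolding subcomplexes_def by blast
qed

lemma inj_on_full_complex: "inj_on (full_complex k) {S. S \<subseteq> cells_of_dim X (Suc k)}"
proof (rule inj_onI)
  fix S S' assume S: "S \<in> {S. S \<subseteq> cells_of_dim X (Suc k)}" "S' \<in> {S. S \<subseteq> cells_of_dim X (Suc k)}"
    and "full_complex k S = full_complex k S'"
  then have "cells (full_complex k S) = cells (full_complex k S')" by simp
  then have "(low_cells k \<union> S) \<inter> cells_of_dim X (Suc k) = (low_cells k \<union> S') \<inter> cells_of_dim X (Suc k)"
    by (simp add: full_complex_def)
  moreover have "low_cells k \<inter> cells_of_dim X (Suc k) = {}"
    by (auto simp: cells_of_dim_def)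
  ultimately show "S = S'" using S by blast
qed

end

context chain_complex begin

sublocale cell_structure X
  by (rule cell_structure)

text \<open>A subcomplex between \<open>X\<^bsup>(k)\<^esup>\<close> and \<open>X\<^bsup>(k+1)\<^esup>\<close> amounts to a set of \<open>(k + 1)\<close>-cells, as any such set
  gives a subcomplex.\<close>

lemma spanning_trees_eq:
  "spanning_trees X (Suc k) = full_complex k ` {S. S \<subseteq> cells_of_dim X (Suc k) \<and>
     trivial_group (homology_int (full_complex k S) (Suc k)) \<and>
     betti (full_complex k S) k = betti (full_complex k (cells_of_dim X (Suc k))) k}"
  (is "?L = ?R")
proof -
  have skel: "skeleton X (Suc k) = full_complex k (cells_of_dim X (Suc k))"
    unfolding skeleton_def full_complex_def by (rule arg_cong [of _ _ "restrict_cells X"]) (auto simp: cells_of_dim_def)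
  show ?thesis
  proof (intro subset_antisym subsetI)
    fix T assume T: "T \<in> ?L"
    then have T': "T \<in> subcomplexes (skeleton X (Suc k))" "cells (skeleton X k) \<subseteq> cells T"
      and triv: "trivial_group (homology_int T (Suc k))" and bet: "betti T k = betti (skeleton X (Suc k)) k"
      by (simp_all add: spanning_trees_def)
    then obtain A where A: "T = restrict_cells (skeleton X (Suc k)) A" "A \<subseteq> low_cells (Suc k)"
      by (auto simp: subcomplexes_def skeleton_def)
    then have "low_cells k \<subseteq> A"
      using T'(2) by (simp add: skeleton_def)
    then have Aeq: "A = low_cells k \<union> (A \<inter> cells_of_dim X (Suc k))"
      using A(2) by (auto simp: cells_of_dim_def)
    have "T = restrict_cells X A"
      unfolding A(1) skeleton_def by (rule restrict_cells_restrict_cells [OF A(2)])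
    then have "T = full_complex k (A \<inter> cells_of_dim X (Suc k))"
      unfolding full_complex_def using Aeq by simp
    with triv bet skel show "T \<in> ?R" by auto
  next
    fix T assume "T \<in> ?R"
    then obtain S where S: "S \<subseteq> cells_of_dim X (Suc k)" "T = full_complex k S"
      "trivial_group (homology_int T (Suc k))" "betti T k = betti (skeleton X (Suc k)) k"
      unfolding skel by blast
    have "cells (skeleton X k) \<subseteq> cells T"
      unfolding S(2) by (simp add: skeleton_def full_complex_def)
    with S full_complex_in_subcomplexes [OF S(1)] show "T \<in> ?L"
      by (simp add: spanning_trees_def)
  qed
qed

text \<open>For a set \<open>S\<close> of \<open>(k + 1)\<close>-cells these are the \<open>(k + 1)\<close>-chains of \<open>full_complex k S\<close>, over any ring.\<close>

definition supported :: "'c set \<Rightarrow> ('r::comm_ring_1 ^ 'c) set" where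
  "supported S = {v. \<forall>c. c \<notin> S \<longrightarrow> v $ c = 0}"

definition boundary_columns :: "'c set \<Rightarrow> (real ^ 'c) list" where
  "boundary_columns S = map (\<lambda>c. bdry X (axis c 1)) (enum S)"

context
  fixes k S
  assumes S: "S \<subseteq> cells_of_dim X (Suc k)"
begin

interpretation full: full_subcomplex X "low_cells k \<union> S" k
  by (rule full_subcomplex [OF S])

abbreviation "T \<equiv> full_complex k S"

lemma cells_of_dim_full: "j \<le> k \<Longrightarrow> cells_of_dim T j = cells_of_dim X j"
  "cells_of_dim T (Suc k) = S" "cells_of_dim T (Suc (Suc k)) = {}"
  using S by (auto simp: full_complex_def cells_of_dim_def)

lemma chains_full: "j \<le> k \<Longrightarrow> chains T j = chains X j"
  "chains T (Suc k) = supported S" "chains T (Suc (Suc k)) = {0}"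
  by (auto simp: chains_def supported_def cells_of_dim_full Finite_Cartesian_Product.vec_eq_iff)

lemma supported_subset_chains: "supported S \<subseteq> chains X (Suc k)"
  using S by (auto simp: chains_def supported_def)

text \<open>Up to dimension \<open>k\<close> the cells are those of \<open>X\<close>, and the incidence numbers of any cell of \<open>T\<close> are the same in
  \<open>T\<close> as in \<open>X\<close>.\<close>

lemma bdry_full:
  fixes v :: "'r::comm_ring_1 ^ 'c"
  assumes j: "j \<le> Suc k" and v: "v \<in> chains T j"
  shows "bdry T v = bdry X v"
proof -
  have sub: "cells_of_dim T j \<subseteq> cells_of_dim X j"
    using S by (auto simp: full_complex_def cells_of_dim_def)
  have "bdry T v $ d = bdry X v $ d" for d
  proof (cases "d \<in> cells X \<and> Suc (cell_dim X d) = j")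
    case True
    then have d: "d \<in> low_cells k" "d \<in> cells T" "cell_dim T d = cell_dim X d"
      using j by (auto simp: full_complex_def)
    have "bdry T v $ d = (\<Sum>c\<in>cells_of_dim T j. of_int (incidence T c d) * v $ c)"
      using True d by (simp add: bdry_def)
    also have "\<dots> = (\<Sum>c\<in>cells_of_dim T j. of_int (incidence X c d) * v $ c)"
    proof (rule sum.cong [OF refl])
      fix c assume "c \<in> cells_of_dim T j"
      then have "c \<in> low_cells k \<union> S" "cell_dim X c = Suc (cell_dim X d)"
        using True by (auto simp: cells_of_dim_def full_complex_def)
      then show "of_int (incidence T c d) * v $ c = of_int (incidence X c d) * v $ c"
        using full.incidence_T by (simp add: full_complex_def)
    qed
    also have "\<dots> = (\<Sum>c\<in>cells_of_dim X j. of_int (incidence X c d) * v $ c)"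
      using chainsD [OF v] sub by (intro sum.mono_neutral_left) auto
    also have "\<dots> = bdry X v $ d"
      using True by (simp add: bdry_def)
    finally show ?thesis .
  next
    case False
    have "bdry X v $ d = 0"
    proof (cases "d \<in> cells X")
      case True
      with False have "cell_dim X c \<noteq> j" if "c \<in> cells_of_dim X (Suc (cell_dim X d))" for c
        using that by (simp add: cells_of_dim_def)
      then have "v $ c = 0" if "c \<in> cells_of_dim X (Suc (cell_dim X d))" for c
      proof (intro chainsD [OF v] notI)
        assume "c \<in> cells_of_dim T j"
        then have "cell_dim X c = j" using sub by (auto simp: cells_of_dim_def [of X])
        with that \<open>\<And>c. c \<in> cells_of_dim X (Suc (cell_dim X d)) \<Longrightarrow> cell_dim X c \<noteq> j\<close> show False by blast
      qed
      then show ?thesis by (simp add: bdry_def)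
    qed (simp add: bdry_def)
    moreover have "bdry T v $ d = 0"
    proof (cases "d \<in> cells T")
      case True
      then have dX: "d \<in> cells X" using S by (auto simp: full_complex_def cells_of_dim_def)
      have "v $ c = 0" if "c \<in> cells_of_dim T (Suc (cell_dim T d))" for c
      proof (rule chainsD [OF v])
        have "cell_dim X c = Suc (cell_dim X d)" using that by (simp add: cells_of_dim_def full_complex_def)
        with False dX show "c \<notin> cells_of_dim T j" by (auto simp: cells_of_dim_def full_complex_def)
      qed
      then show ?thesis by (simp add: bdry_def)
    qed (simp add: bdry_def)
    ultimately show ?thesis by simp
  qed
  then show ?thesis by (simp add: Finite_Cartesian_Product.vec_eq_iff)
qed

lemma cycles_full: "cycles T k = (cycles X k :: ('r::comm_ring_1 ^ 'c) set)"
  using bdry_full [of k, where 'r = 'r] by (auto simp: cycles_def chains_full)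

lemma boundaries_full: "boundaries T k = (bdry X ` supported S :: ('r::comm_ring_1 ^ 'c) set)"
  unfolding boundaries_def chains_full
  using bdry_full [of "Suc k", where 'r = 'r] by (intro image_cong refl) (simp add: chains_full)

lemma homology_full: "homology T k = additive_group (cycles X k) Mod (bdry X ` supported S)"
  by (simp add: homology_def cycles_full boundaries_full)

lemma add_subgroup_supported: "add_subgroup (supported S)"
  by (simp add: add_subgroup_def supported_def)

interpretation quot: integral_quotient "cycles X k" "bdry X ` supported S"
proof unfold_locales
  have "bdry X ` supported S \<subseteq> (boundaries X k :: (int ^ 'c) set)"
    unfolding boundaries_def using supported_subset_chains by (intro image_mono)
  then show "bdry X ` supported S \<subseteq> (cycles X k :: (int ^ 'c) set)"
    using boundaries_subset_cycles by blast
qed (intro add_subgroup_cycles add_subgroup_bdry_image add_subgroup_supported)+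

text \<open>There are no cells of dimension \<open>k + 2\<close>, so the homology in degree \<open>k + 1\<close> is the group of cycles.\<close>

lemma trivial_homology_full:
  "trivial_group (homology_int T (Suc k)) \<longleftrightarrow> (\<forall>v\<in>supported S. bdry X v = (0 :: int ^ 'c) \<longrightarrow> v = 0)"
proof -
  let ?Z = "cycles T (Suc k) :: (int ^ 'c) set"
  have B: "boundaries T (Suc k) = ({0} :: (int ^ 'c) set)"
    unfolding boundaries_def chains_full(3) by simp
  interpret q: additive_quotient ?Z "{0}"
  proof
    show "add_subgroup ?Z" by (rule add_subgroup_cycles)
    show "{0} \<subseteq> ?Z" using add_subgroup_zero [OF add_subgroup_cycles] by blast
  qed (simp add: add_subgroup_def)
  have "trivial_group (homology_int T (Suc k)) \<longleftrightarrow> (\<forall>z\<in>?Z. z = 0)"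
  proof -
    have "trivial_group q.Q \<longleftrightarrow> carrier q.Q = {\<one>\<^bsub>q.Q\<^esub>}"
      using comm_group.axioms(2) [OF q.comm_group_Q] by (auto simp: trivial_group_def)
    also have "\<dots> \<longleftrightarrow> (\<forall>z\<in>?Z. q.cls z = {0})"
      using add_subgroup_zero [OF q.Z] unfolding q.carrier_Q q.one_Q by blast
    also have "\<dots> \<longleftrightarrow> (\<forall>z\<in>?Z. z = 0)"
      by (simp add: q.cls_eq_C_iff)
    finally show ?thesis by (simp add: homology_def B)
  qed
  also have "?Z = {v \<in> supported S. bdry X v = 0}"
  proof -
    have "bdry T v = bdry X v" if "v \<in> supported S" for v :: "int ^ 'c"
      using that by (intro bdry_full [of "Suc k"]) (simp_all add: chains_full)
    then show ?thesis
      unfolding cycles_def chains_full(2) by (intro Collect_cong conj_cong refl) simp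
  qed
  finally show ?thesis by blast
qed

lemma bdry_supported:
  fixes v :: "real ^ 'c"
  assumes "v \<in> supported S"
  shows "bdry X v = lincomb (\<lambda>i. v $ (enum S ! i)) (boundary_columns S)"
proof -
  have "v = (\<Sum>c\<in>S. v $ c *\<^sub>R axis c 1)"
    using assms by (intro supported_expand) (simp add: supported_def)
  then have "bdry X v = (\<Sum>c\<in>S. v $ c *\<^sub>R bdry X (axis c 1))"
    using linear_bdry [of X] by (metis (no_types, lifting) linear_scale linear_sum sum.cong)
  also have "\<dots> = (\<Sum>i<length (enum S). v $ (enum S ! i) *\<^sub>R bdry X (axis (enum S ! i) 1))"
    using sum.reindex_bij_betw [OF bij_betw_nth [OF enum(1) refl refl], OF finite, of "\<lambda>c. v $ c *\<^sub>R bdry X (axis c 1)", symmetric]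
    by (simp add: enum)
  finally show ?thesis
    by (simp add: lincomb_def boundary_columns_def)
qed

lemma real_vec_boundaries_full: "real_vec ` bdry X ` supported S = Z_span (boundary_columns S)"
proof (intro subset_antisym subsetI)
  fix x assume "x \<in> real_vec ` bdry X ` supported S"
  then obtain v :: "int ^ 'c" where v: "v \<in> supported S" "x = bdry X (real_vec v)"
    by (auto simp: real_vec_bdry)
  then have "x = lincomb (\<lambda>i. of_int (v $ (enum S ! i))) (boundary_columns S)"
    using bdry_supported [of "real_vec v"] by (simp add: supported_def)
  then show "x \<in> Z_span (boundary_columns S)" by (rule Z_spanI)
next
  have "set (boundary_columns S) \<subseteq> real_vec ` bdry X ` supported S"
  proof
    fix x assume "x \<in> set (boundary_columns S)"
    then obtain c where c: "c \<in> S" "x = bdry X (axis c 1)"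
      by (auto simp: boundary_columns_def enum)
    then have "x = real_vec (bdry X (axis c 1))"
      by (simp add: real_vec_bdry real_vec_axis)
    moreover have "axis c 1 \<in> (supported S :: (int ^ 'c) set)"
      using c by (auto simp: supported_def axis_def)
    ultimately show "x \<in> real_vec ` bdry X ` supported S" by blast
  qed
  moreover have sub: "add_subgroup (real_vec ` bdry X ` supported S)"
    by (intro add_subgroup_real_vec quot.C)
  moreover fix x assume "x \<in> Z_span (boundary_columns S)"
  ultimately show "x \<in> real_vec ` bdry X ` supported S"
    by (auto simp: Z_span_def lincomb_def intro!: add_subgroup_sum add_subgroup_of_int)
qed

lemma length_boundary_columns: "length (boundary_columns S) = card S"
  by (simp add: boundary_columns_def length_enum)

lemma span_boundary_columns: "span (set (boundary_columns S)) = span (real_vec ` bdry X ` supported S)"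
proof
  show "span (real_vec ` bdry X ` supported S) \<subseteq> span (set (boundary_columns S))"
    unfolding real_vec_boundaries_full by (intro span_minimal Z_span_subset_span subspace_span)
  have "set (boundary_columns S) \<subseteq> Z_span (boundary_columns S)"
  proof
    fix x assume "x \<in> set (boundary_columns S)"
    then obtain j where j: "j < length (boundary_columns S)" "x = boundary_columns S ! j"
      by (auto simp: in_set_conv_nth)
    then show "x \<in> Z_span (boundary_columns S)"
      using lincomb_unit [OF j(1)] by (intro Z_spanI [of _ "\<lambda>i. if i = j then 1 else 0"]) (simp add: if_distrib [of of_int] cong: if_cong)
  qed
  then show "span (set (boundary_columns S)) \<subseteq> span (real_vec ` bdry X ` supported S)"
    unfolding real_vec_boundaries_full by (rule span_mono)
qed

text \<open>Injectivity of the boundary map on integral chains suffices, because independence over \<open>\<int>\<close> of integral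
  vectors implies independence over \<open>\<real>\<close>.\<close>

lemma lin_indep_boundary_columns_iff:
  "lin_indep (boundary_columns S) \<longleftrightarrow> (\<forall>v\<in>supported S. bdry X v = (0 :: int ^ 'c) \<longrightarrow> v = 0)"
proof
  assume li: "lin_indep (boundary_columns S)"
  show "\<forall>v\<in>supported S. bdry X v = (0 :: int ^ 'c) \<longrightarrow> v = 0"
  proof (intro ballI impI)
    fix v :: "int ^ 'c" assume v: "v \<in> supported S" "bdry X v = 0"
    then have 0: "lincomb (\<lambda>i. real_vec v $ (enum S ! i)) (boundary_columns S) = 0"
      using bdry_supported [of "real_vec v"] by (simp add: supported_def flip: real_vec_bdry)
    have "v $ (enum S ! i) = 0" if "i < card S" for i
      using lin_indepD [OF li 0, of i] that by (simp add: length_boundary_columns)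
    then have "v $ c = 0" if "c \<in> S" for c
      using that enum(2) [OF finite] length_enum [OF finite] by (metis in_set_conv_nth)
    then show "v = 0"
      using v(1) by (auto simp: Finite_Cartesian_Product.vec_eq_iff supported_def)
  qed
next
  assume inj: "\<forall>v\<in>supported S. bdry X v = (0 :: int ^ 'c) \<longrightarrow> v = 0"
  show "lin_indep (boundary_columns S)"
  proof (rule lin_indep_of_int_indep)
    show "set (boundary_columns S) \<subseteq> range real_vec"
      by (auto simp: boundary_columns_def simp flip: real_vec_axis real_vec_bdry)
    fix m :: "nat \<Rightarrow> int" assume m: "lincomb (\<lambda>i. of_int (m i)) (boundary_columns S) = 0"
    define g where "g = inv_into {..<card S} ((!) (enum S))"
    have bij: "bij_betw ((!) (enum S)) {..<card S} S"
      using bij_betw_nth [OF enum(1) refl refl, OF finite] by (simp add: enum length_enum)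
    have g: "g (enum S ! i) = i" if "i < card S" for i
      using bij that by (simp add: g_def bij_betw_inv_into_left)
    define v :: "int ^ 'c" where "v = (\<chi> c. if c \<in> S then m (g c) else 0)"
    have nth: "enum S ! i \<in> S" if "i < card S" for i
      using bij that by (auto simp: bij_betw_def)
    have v: "v \<in> supported S" by (simp add: v_def supported_def)
    have "real_vec (bdry X v) = lincomb (\<lambda>i. real_vec v $ (enum S ! i)) (boundary_columns S)"
      using bdry_supported [of "real_vec v"] v by (simp add: supported_def real_vec_bdry)
    also have "\<dots> = lincomb (\<lambda>i. of_int (m i)) (boundary_columns S)"
      by (rule lincomb_cong) (simp add: length_boundary_columns v_def nth g)
    finally have "bdry X v = 0" using m real_vec_inj [of "bdry X v" 0] by simp
    with inj v have "v = 0" by blast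
    then have "m i = 0" if "i < card S" for i
    proof -
      have "v $ (enum S ! i) = m i"
        using nth [OF that] g [OF that] by (simp add: v_def)
      with \<open>v = 0\<close> show ?thesis by simp
    qed
    then show "\<forall>i<length (boundary_columns S). m i = 0"
      by (simp add: length_boundary_columns)
  qed
qed

lemma betti_full:
  "betti T k = dim (real_vec ` (cycles X k :: (int ^ 'c) set)) - dim (real_vec ` bdry X ` (supported S :: (int ^ 'c) set))"
  by (simp add: betti_def homology_full quot.Z_rank_Q)

lemma torsion_order_full:
  assumes ys: "lattice_basis (real_vec ` bdry X ` supported S) ys"
    and span: "span (real_vec ` bdry X ` (supported S :: (int ^ 'c) set)) = boundaries X k"
    and \<sigma>: "lattice_basis (real_vec ` {z \<in> cycles X k. real_vec z \<in> boundaries X k}) \<sigma>"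
  shows "(real (torsion_order T k))\<^sup>2 * gram \<sigma> = gram ys"
  unfolding torsion_order_def homology_full
  using quot.card_torsion_Q [OF ys] \<sigma> span by simp

end

section \<open>The weighted number of spanning trees\<close>

text \<open>This number mediates between torsion and spanning trees: on the one hand it is a quotient of two
  Gram determinants by the Cauchy-Binet formula, on the other hand its non-zero terms belong to the
  spanning trees.\<close>

definition column_sum :: "nat \<Rightarrow> real" where
  "column_sum k = (\<Sum>S\<in>{S. S \<subseteq> cells_of_dim X (Suc k) \<and> card S = dim (boundaries X k :: (real ^ 'c) set)}.
     gram (boundary_columns S))"

text \<open>Both \<open>B\<^sub>k(X; \<int>)\<close> and, for a spanning tree \<open>T\<close>, the lattice \<open>B\<^sub>k(T; \<int>)\<close> have finite index in the lattice of
  integral cycles that are real boundaries, namely \<open>\<theta>\<^sub>k\<close> and \<open>\<theta>\<^sub>T\<close>. So the squared covolumes are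
  \<open>\<mu>\<^sub>k = \<theta>\<^sub>k\<^sup>2 \<cdot> gram(\<sigma>)\<close> and \<open>gram(\<partial>(S)) = \<theta>\<^sub>T\<^sup>2 \<cdot> gram(\<sigma>)\<close> for a basis \<open>\<sigma>\<close> of that lattice.\<close>

lemma spanning_tree_sum:
  "delta_const X k * (\<Sum>T\<in>spanning_trees X (Suc k). (real (torsion_order T k))\<^sup>2) = eta_const X k * column_sum k"
proof -
  let ?V = "cells_of_dim X (Suc k)"
  let ?Zi = "cycles X k :: (int ^ 'c) set" and ?Bi = "boundaries X k :: (int ^ 'c) set"
  let ?B = "boundaries X k :: (real ^ 'c) set"
  let ?C = "\<lambda>S. bdry X ` supported S :: (int ^ 'c) set"
  have spanB: "span (real_vec ` ?Bi) = ?B"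
    using real_boundaries_eq_span by (rule sym)
  have CV: "?C ?V = ?Bi"
    by (simp add: boundaries_def supported_def chains_def)
  have dimV: "dim (real_vec ` ?C ?V) = dim ?B"
    by (metis CV dim_span spanB)
  have CB: "real_vec ` ?C S \<subseteq> real_vec ` ?Bi" if "S \<subseteq> ?V" for S
    using supported_subset_chains [OF that] by (auto simp: boundaries_def)
  have BZ: "dim ?B \<le> dim (real_vec ` ?Zi)"
    by (metis dim_span dim_subset image_mono boundaries_subset_cycles spanB)
  obtain \<beta> where \<beta>: "lattice_basis (real_vec ` ?Bi) \<beta>" "lin_indep \<beta>"
    using integral_lattice_basis [OF add_subgroup_real_vec [OF add_subgroup_boundaries]] by blast
  have sat: "add_subgroup {z \<in> ?Zi. real_vec z \<in> ?B}"
  proof -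
    have "add_subgroup ?Zi" "add_subgroup ?B"
      by (rule add_subgroup_cycles, rule add_subgroup_boundaries)
    then show ?thesis by (auto simp: add_subgroup_def)
  qed
  obtain \<sigma> where \<sigma>: "lattice_basis (real_vec ` {z \<in> ?Zi. real_vec z \<in> ?B}) \<sigma>" "lin_indep \<sigma>"
    using integral_lattice_basis [OF add_subgroup_real_vec [OF sat]] by blast
  have \<sigma>0: "0 < gram \<sigma>" and \<beta>0: "0 < gram \<beta>"
    using \<sigma>(2) \<beta>(2) by (simp_all add: gram_pos)
  have mu: "mu_const X k = gram \<beta>"
    unfolding mu_const_def by (rule covolume_squared [OF add_subgroup_real_vec [OF add_subgroup_boundaries] \<beta>(1)])
  have \<theta>: "(real (torsion_order X k))\<^sup>2 * gram \<sigma> = gram \<beta>"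
    unfolding torsion_order_def homology_def using int.card_torsion_Q [OF \<beta>(1)] \<sigma>(1) spanB by simp
  have \<theta>0: "(real (torsion_order X k))\<^sup>2 \<noteq> 0"
  proof
    assume "(real (torsion_order X k))\<^sup>2 = 0"
    then have "gram \<beta> = 0" using \<theta> by (simp only: mult_zero_left)
    then show False using \<beta>0 by simp
  qed
  \<comment> \<open>For a set \<open>S\<close>, trivial homology in degree \<open>k + 1\<close> says that \<open>\<partial>(S)\<close> is independent, and then the
     condition on the Betti number fixes the cardinality of \<open>S\<close>.\<close>
  let ?A = "{S. S \<subseteq> ?V \<and> card S = dim ?B \<and> lin_indep (boundary_columns S)}"
  have dimS: "dim (real_vec ` ?C S) = card S" if "S \<subseteq> ?V" "lin_indep (boundary_columns S)" for S
    using length_eq_dim [OF that(2)] length_boundary_columns [OF that(1)] span_boundary_columns [OF that(1)]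
    by (metis dim_span)
  have "{S. S \<subseteq> ?V \<and> trivial_group (homology_int (full_complex k S) (Suc k)) \<and>
     betti (full_complex k S) k = betti (full_complex k ?V) k} = ?A"
  proof (rule Collect_cong, rule conj_cong [OF refl])
    fix S assume S: "S \<subseteq> ?V"
    have "dim (real_vec ` ?C S) \<le> dim ?B"
      using dim_subset [OF CB [OF S]] dimV CV by metis
    then have "betti (full_complex k S) k = betti (full_complex k ?V) k \<longleftrightarrow> dim (real_vec ` ?C S) = dim ?B"
      using BZ unfolding betti_full [OF S] betti_full [OF subset_refl] dimV by linarith
    moreover have "trivial_group (homology_int (full_complex k S) (Suc k)) \<longleftrightarrow> lin_indep (boundary_columns S)"
      by (simp add: trivial_homology_full [OF S] lin_indep_boundary_columns_iff [OF S])
    ultimately show "(trivial_group (homology_int (full_complex k S) (Suc k)) \<and>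
        betti (full_complex k S) k = betti (full_complex k ?V) k) \<longleftrightarrow> (card S = dim ?B \<and> lin_indep (boundary_columns S))"
      using dimS [OF S] by auto
  qed
  then have trees: "spanning_trees X (Suc k) = full_complex k ` ?A"
    by (simp add: spanning_trees_eq)
  have tree: "(real (torsion_order (full_complex k S) k))\<^sup>2 * gram \<sigma> = gram (boundary_columns S)" if "S \<in> ?A" for S
  proof -
    have S: "S \<subseteq> ?V" "card S = dim ?B" and li: "lin_indep (boundary_columns S)"
      using that by auto
    have "span (real_vec ` ?C S) \<subseteq> ?B"
      unfolding spanB [symmetric] by (rule span_mono [OF CB [OF S(1)]])
    moreover have "dim ?B \<le> dim (span (real_vec ` ?C S))"
      using dimS [OF S(1) li] S(2) by simp
    ultimately have "span (real_vec ` ?C S) = ?B"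
      by (intro subspace_dim_equal subspace_span subspace_boundaries)
    moreover have "lattice_basis (real_vec ` ?C S) (boundary_columns S)"
      unfolding real_vec_boundaries_full [OF S(1)] by (rule lattice_basis_Z_span [OF li])
    ultimately show ?thesis
      using torsion_order_full [OF S(1) _ _ \<sigma>(1)] by blast
  qed
  have "(\<Sum>T\<in>spanning_trees X (Suc k). (real (torsion_order T k))\<^sup>2)
      = (\<Sum>S\<in>?A. (real (torsion_order (full_complex k S) k))\<^sup>2)"
    unfolding trees by (subst sum.reindex) (auto intro: inj_on_subset [OF inj_on_full_complex])
  also have "\<dots> = (\<Sum>S\<in>?A. gram (boundary_columns S) / gram \<sigma>)"
    using tree \<sigma>0 by (intro sum.cong refl) (simp add: field_simps)
  also have "\<dots> = (\<Sum>S\<in>?A. gram (boundary_columns S)) / gram \<sigma>"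
    by (simp add: sum_divide_distrib)
  also have "(\<Sum>S\<in>?A. gram (boundary_columns S)) = column_sum k"
    unfolding column_sum_def
    by (rule sum.mono_neutral_left) (auto simp: gram_eq_0_iff)
  finally have "delta_const X k * (\<Sum>T\<in>spanning_trees X (Suc k). (real (torsion_order T k))\<^sup>2)
      = eta_const X k * (gram \<beta> / (real (torsion_order X k))\<^sup>2) * (column_sum k / gram \<sigma>)"
    by (simp add: delta_const_def mu)
  also have "gram \<beta> / (real (torsion_order X k))\<^sup>2 = gram \<sigma>"
    using \<theta> \<theta>0 by (simp add: field_simps)
  finally show ?thesis
    using \<sigma>0 by simp
qed

section \<open>The squared determinant in one degree\<close>

text \<open>The components \<open>u\<close> of the lifts orthogonal to the cycles are again lifts of \<open>b\<close>, so that
  \<open>sum_gram_columns\<close> applies to them.\<close>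

lemma orthogonal_splitting:
  assumes b: "boundary_basis X k b" and s: "boundary_splitting X k s"
  obtains u where "length u = length b" "\<And>j. j < length b \<Longrightarrow> map s b ! j - u ! j \<in> cycles X (Suc k)"
    "\<And>j z. j < length b \<Longrightarrow> z \<in> cycles X (Suc k) \<Longrightarrow> inner z (u ! j) = 0"
    "lin_indep u" "chains X (Suc k) \<subseteq> span (cycles X (Suc k) \<union> set (map s b))"
    "column_sum k * gram u = gram b"
proof -
  have li: "lin_indep b" and spanb: "span (set b) = boundaries X k"
    using b by (auto simp: boundary_basis_def lin_indep_iff)
  have sb: "s x \<in> chains X (Suc k)" "bdry X (s x) = x" if "x \<in> boundaries X k" for x
    using s that by (auto simp: boundary_splitting_def)
  have bb: "b ! j \<in> boundaries X k" if "j < length b" for j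
    using that spanb span_base nth_mem by blast
  have spanZ: "span (cycles X (Suc k)) = (cycles X (Suc k) :: (real ^ 'c) set)"
    using subspace_cycles by (simp add: span_eq_iff)
  have "\<exists>w. x - w \<in> cycles X (Suc k) \<and> (\<forall>z\<in>cycles X (Suc k). inner z w = 0)" for x :: "real ^ 'c"
  proof -
    obtain y w where "y \<in> span (cycles X (Suc k))" "\<And>z. z \<in> span (cycles X (Suc k)) \<Longrightarrow> real_inner_class.orthogonal w z" "x = y + w"
      using orthogonal_subspace_decomp_exists [of "cycles X (Suc k)" x] by metis
    then show ?thesis
      unfolding spanZ by (intro exI [of _ w]) (auto simp: real_inner_class.orthogonal_def inner_commute)
  qed
  then obtain p :: "real ^ 'c \<Rightarrow> real ^ 'c"
    where p: "\<And>x. x - p x \<in> cycles X (Suc k)" "\<And>x z. z \<in> cycles X (Suc k) \<Longrightarrow> inner z (p x) = 0"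
    by metis
  define u where "u = map (\<lambda>x. p (s x)) b"
  have uj: "u ! j = p (s (b ! j))" if "j < length b" for j
    using that by (simp add: u_def)
  have uD: "u ! j \<in> chains X (Suc k)" "bdry X (u ! j) = b ! j" if j: "j < length b" for j
  proof -
    have "s (b ! j) - u ! j \<in> cycles X (Suc k)"
      using p(1) uj [OF j] by simp
    then have c: "s (b ! j) - u ! j \<in> chains X (Suc k)" "bdry X (s (b ! j)) - bdry X (u ! j) = 0"
      by (simp_all add: cycles_def bdry_diff)
    show "bdry X (u ! j) = b ! j" using c(2) sb [OF bb [OF j]] by simp
    show "u ! j \<in> chains X (Suc k)"
      using subspace_diff [OF subspace_chains sb(1) [OF bb [OF j]] c(1)] by simp
  qed
  have mapu: "map (bdry X) u = b"
    using uD(2) by (intro nth_equalityI) (auto simp: u_def)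
  have "lin_indep u"
    unfolding lin_indep_def
  proof (intro allI impI)
    fix a i assume a: "lincomb a u = 0" and i: "i < length u"
    have "lincomb a b = 0"
      using lincomb_map [OF linear_bdry, of a X u] a by (simp add: mapu)
    then show "a i = 0"
      using lin_indepD [OF li] i by (simp add: u_def)
  qed
  moreover have "chains X (Suc k) \<subseteq> span (cycles X (Suc k) \<union> set (map s b))"
  proof
    fix v :: "real ^ 'c" assume v: "v \<in> chains X (Suc k)"
    then have "bdry X v \<in> boundaries X k" by (simp add: boundaries_def)
    then obtain a where a: "bdry X v = lincomb a b"
      using spanb by (auto simp: span_set_eq_lincomb)
    let ?w = "lincomb a (map s b)"
    have "map (bdry X) (map s b) = b"
      using sb bb by (intro nth_equalityI) auto
    then have "bdry X ?w = lincomb a b"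
      using lincomb_map [OF linear_bdry, of a X "map s b"] by simp
    moreover have "?w \<in> chains X (Suc k)"
    proof -
      have "set (map s b) \<subseteq> chains X (Suc k)"
        using sb bb by (auto simp: in_set_conv_nth)
      then show ?thesis
        using lincomb_in_span span_minimal subspace_chains by blast
    qed
    ultimately have "v - ?w \<in> cycles X (Suc k)"
      using v a subspace_diff [OF subspace_chains] by (simp add: cycles_def bdry_diff)
    then have "(v - ?w) + ?w \<in> span (cycles X (Suc k) \<union> set (map s b))"
      using lincomb_in_span [of a "map s b"] span_mono [of "set (map s b)" "cycles X (Suc k) \<union> set (map s b)"]
      by (intro span_add) (auto intro: span_base)
    then show "v \<in> span (cycles X (Suc k) \<union> set (map s b))" by simp
  qed
  moreover have "column_sum k * gram u = gram b"
  proof -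
    have len: "length b = dim (boundaries X k :: (real ^ 'c) set)"
      using length_eq_dim [OF li] spanb by simp
    show ?thesis
      unfolding column_sum_def boundary_columns_def len [symmetric]
    proof (rule sum_gram_columns [OF linear_bdry li])
      show "length u = length b" by (simp add: u_def)
      fix c assume "c \<in> cells_of_dim X (Suc k)"
      then have "axis c 1 \<in> (chains X (Suc k) :: (real ^ 'c) set)"
        by (auto simp: chains_def axis_def)
      then show "bdry X (axis c 1) \<in> span (set b)"
        unfolding spanb by (simp add: boundaries_def)
    next
      fix j and z :: "real ^ 'c" assume "j < length b" "bdry X z = 0" "\<And>c. c \<notin> cells_of_dim X (Suc k) \<Longrightarrow> z $ c = 0"
      then have "z \<in> cycles X (Suc k)"
        by (simp add: cycles_def chains_def)
      then show "inner (u ! j) z = 0"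
        using p(2) uj [OF \<open>j < length b\<close>] by (simp add: inner_commute)
    qed (use uD chainsD in blast)+
  qed
  ultimately show thesis
    using that [of u] p uj by (simp add: u_def)
qed

lemma square_det_coordinate_matrix:
  assumes "set vs \<subseteq> chains X k" "cell_ordering X k cs" "length vs = length cs"
  shows "(Determinant.det (coordinate_matrix vs cs))\<^sup>2 = gram vs"
proof -
  let ?n = "length cs" and ?M = "coordinate_matrix vs cs"
  have c: "?M \<in> carrier_mat ?n ?n" "transpose_mat ?M \<in> carrier_mat ?n ?n"
    using assms(3) by (auto simp: coordinate_matrix_def)
  have cs: "distinct cs" "set cs = cells_of_dim X k"
    using assms(2) by (auto simp: cell_ordering_def)
  have inner: "inner v w = (\<Sum>i<?n. v $ (cs ! i) * w $ (cs ! i))" if "v \<in> chains X k" for v w :: "real ^ 'c"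
  proof -
    have "inner v w = (\<Sum>c\<in>UNIV. v $ c * w $ c)"
      by (simp add: inner_vec_def)
    also have "\<dots> = (\<Sum>c\<in>set cs. v $ c * w $ c)"
      using chainsD [OF that] cs by (intro sum.mono_neutral_right) auto
    also have "\<dots> = (\<Sum>i<?n. v $ (cs ! i) * w $ (cs ! i))"
      using sum.reindex_bij_betw [OF bij_betw_nth [OF cs(1) refl refl], of "\<lambda>c. v $ c * w $ c"] by simp
    finally show ?thesis .
  qed
  have "Matrix.mat ?n ?n (\<lambda>(i, j). inner (vs ! i) (vs ! j)) = transpose_mat ?M * ?M"
  proof (rule eq_matI)
    fix i j assume "i < dim_row (transpose_mat ?M * ?M)" "j < dim_col (transpose_mat ?M * ?M)"
    then have ij: "i < ?n" "j < ?n" using c by auto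
    then have "vs ! i \<in> chains X k" using assms(1,3) nth_mem by force
    then show "Matrix.mat ?n ?n (\<lambda>(i, j). inner (vs ! i) (vs ! j)) $$ (i, j) = (transpose_mat ?M * ?M) $$ (i, j)"
      using ij assms(3) by (simp add: inner coordinate_matrix_def scalar_prod_def lessThan_atLeast0)
  qed (use c in auto)
  then show ?thesis
    using Determinant.det_mult [OF c(2,1)] Determinant.det_transpose [OF c(1)] assms(3)
    by (simp add: gram_def power2_eq_square)
qed

text \<open>The vectors \<open>t h\<close> differ from the harmonic representatives by boundaries, and \<open>vs\<close> differs from \<open>u\<close> by
  cycles, which are combinations of \<open>b\<close> and the harmonic representatives. So the Gram determinant splits into
  the three orthogonal blocks \<open>b\<close>, harmonic representatives and \<open>u\<close>.\<close>

lemma torsion_factor: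
  assumes h: "Z_basis ((homology_real X k)\<lparr>carrier := homology_lattice X k\<rparr>) h"
    and b: "boundary_basis X k b" and t: "homology_splitting X k t" and cs: "cell_ordering X k cs"
    and vs: "set vs \<subseteq> chains X k" "chains X k \<subseteq> span (cycles X k \<union> set vs)"
    and u: "length u = length vs" "\<And>j. j < length vs \<Longrightarrow> vs ! j - u ! j \<in> cycles X k"
      "\<And>j z. j < length vs \<Longrightarrow> z \<in> cycles X k \<Longrightarrow> inner z (u ! j) = 0" "lin_indep u"
  shows "(Determinant.det (coordinate_matrix (b @ map t h @ vs) cs))\<^sup>2 = gram b * eta_const X k * gram u"
    and "length (b @ map t h @ vs) = length cs"
proof -
  let ?hb = "harmonic_basis h k"
  have li: "lin_indep b" and spanb: "span (set b) = boundaries X k"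
    using b by (auto simp: boundary_basis_def lin_indep_iff)
  have bB: "x \<in> boundaries X k" if "x \<in> set b" for x
    using that spanb span_base by blast
  have hcar: "x \<in> carrier (homology_real X k)" if "x \<in> set h" for x
  proof -
    have "set h \<subseteq> homology_lattice X k"
      using h by (auto simp: Z_basis_def Z_independent_def)
    then obtain z where "z \<in> cycles X k" "x = homology_class X k (real_vec z)"
      using \<open>x \<in> set h\<close> by (auto simp: homology_lattice_eq)
    then show ?thesis
      using real_vec_in_cycles [of z X k] by (auto simp: carrier_homology)
  qed
  have tdiff: "t x - harmonic_rep X k x \<in> boundaries X k" and tZ: "t x \<in> cycles X k" if "x \<in> set h" for x
  proof -
    have "homology_class X k (t x) = x" "t x \<in> cycles X k"
      using t hcar [OF that] by (auto simp: homology_splitting_def)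
    then show "t x - harmonic_rep X k x \<in> boundaries X k" "t x \<in> cycles X k"
      using harmonic_rep_in_class [OF hcar [OF that]] homology_class_eq_iff by metis+
  qed
  have spanbh: "span (set b \<union> set ?hb) = cycles X k"
    by (rule cycles_eq_span_harmonic_basis [OF h spanb])
  have hZ: "x \<in> cycles X k" if "x \<in> set ?hb" for x
    by (rule harmonic_basis_cycle [OF h that])
  have horth: "inner y x = 0" if "x \<in> set ?hb" "y \<in> boundaries X k" for x y
    by (rule harmonic_basis_orthogonal [OF h that])
  have "\<forall>j<length vs. \<exists>y w. y \<in> span (set b) \<and> w \<in> span (set ?hb) \<and> vs ! j - u ! j = y + w"
    using u(2) unfolding spanbh [symmetric] span_Un by blast
  then obtain y w where yw: "\<And>j. j < length vs \<Longrightarrow> y j \<in> span (set b) \<and> w j \<in> span (set ?hb) \<and> vs ! j - u ! j = y j + w j"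
    by metis
  \<comment> \<open>First only the boundary part of \<open>vs - u\<close> is removed, so that the block \<open>b\<close> splits off; the harmonic part
     \<open>w\<close> is removed afterwards.\<close>
  define vs' where "vs' = map (\<lambda>j. vs ! j - y j) [0..<length vs]"
  have vs': "length vs' = length vs" "vs' ! j = u ! j + w j" if "j < length vs" for j
    using yw [OF that] that by (auto simp: vs'_def algebra_simps)
  have wZ: "w j \<in> cycles X k" if "j < length vs" for j
    using yw [OF that] span_mono [of "set ?hb" "set b \<union> set ?hb"] spanbh by blast
  have hspan_orth: "inner x z = 0" if x: "x \<in> set b" and z: "z \<in> span (set ?hb)" for x z
  proof -
    have "real_inner_class.orthogonal x z"
      using z by (rule orthogonal_to_span) (use horth [OF _ bB [OF x]] in \<open>auto simp: real_inner_class.orthogonal_def\<close>)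
    then show ?thesis by (simp add: real_inner_class.orthogonal_def)
  qed
  have "gram (b @ (map t h @ vs)) = gram b * gram (?hb @ vs')"
  proof (rule gram_append)
    show "length (?hb @ vs') = length (map t h @ vs)" by (simp add: vs'_def)
  next
    fix j assume j: "j < length (map t h @ vs)"
    show "(map t h @ vs) ! j - (?hb @ vs') ! j \<in> span (set b)"
    proof (cases "j < length h")
      case True
      then show ?thesis using tdiff [of "h ! j"] by (simp add: nth_append spanb)
    next
      case False
      define l where "l = j - length h"
      have l: "l < length vs" "j = length h + l" using j False by (auto simp: l_def)
      then have "(map t h @ vs) ! j - (?hb @ vs') ! j = vs ! l - vs' ! l"
        by (simp add: nth_append)
      also have "\<dots> = y l" using l(1) by (simp add: vs'_def)
      finally show ?thesis using yw [OF l(1)] by simp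
    qed
  next
    fix x z assume x: "x \<in> set b" and z: "z \<in> set (?hb @ vs')"
    show "inner x z = 0"
    proof (cases "z \<in> set ?hb")
      case True
      then show ?thesis using horth bB [OF x] by blast
    next
      case False
      then obtain j where j: "j < length vs" "z = u ! j + w j"
        using z vs' by (auto simp: in_set_conv_nth vs'_def)
      have "inner x (u ! j) = 0"
        using u(3) [OF j(1)] bB [OF x] boundaries_subset_cycles by blast
      moreover have "inner x (w j) = 0"
        using hspan_orth [OF x] yw [OF j(1)] by blast
      ultimately show ?thesis by (simp add: j(2) inner_add_right)
    qed
  qed
  also have "gram (?hb @ vs') = gram ?hb * gram u"
  proof (rule gram_append)
    show "length u = length vs'" using u(1) by (simp add: vs'_def)
  next
    fix j assume "j < length vs'"
    then show "vs' ! j - u ! j \<in> span (set ?hb)"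
      using vs'(2) [of j] yw [of j] by (simp add: vs'_def)
  next
    fix x z assume x: "x \<in> set ?hb" and z: "z \<in> set u"
    then obtain j where "j < length vs" "z = u ! j"
      using u(1) by (auto simp: in_set_conv_nth)
    then show "inner x z = 0"
      using u(3) hZ [OF x] by blast
  qed
  finally have gram: "gram (b @ map t h @ vs) = gram b * eta_const X k * gram u"
    using eta_const_eq [OF h] by simp
  have "gram (b @ map t h @ vs) \<noteq> 0"
    unfolding gram eta_const_eq [OF h]
    using li lin_indep_harmonic_basis [OF h] u(4) by (simp add: gram_eq_0_iff)
  then have lin: "lin_indep (b @ map t h @ vs)"
    by (simp add: gram_eq_0_iff)
  have sub: "set (b @ map t h @ vs) \<subseteq> chains X k"
    using bB tZ vs(1) real.CZ [of k] by (auto simp: cycles_def)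
  let ?W = "span (set (b @ map t h @ vs))"
  have "set ?hb \<subseteq> ?W"
  proof
    fix x assume "x \<in> set ?hb"
    then obtain y where y: "y \<in> set h" "x = harmonic_rep X k y" by auto
    have "t y \<in> ?W" using y by (intro span_base) auto
    moreover have "t y - x \<in> ?W"
      using tdiff [OF y(1)] y(2) spanb span_mono [of "set b" "set (b @ map t h @ vs)"] by auto
    ultimately have "t y - (t y - x) \<in> ?W" by (rule span_diff)
    then show "x \<in> ?W" by simp
  qed
  moreover have "set b \<subseteq> ?W" "set vs \<subseteq> ?W" by (auto intro: span_base)
  ultimately have "cycles X k \<subseteq> ?W"
    unfolding spanbh [symmetric] by (intro span_minimal subspace_span) auto
  then have "span (cycles X k \<union> set vs) \<subseteq> ?W"
    using \<open>set vs \<subseteq> ?W\<close> by (intro span_minimal subspace_span) auto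
  with vs(2) have "chains X k \<subseteq> ?W" by blast
  moreover have "?W \<subseteq> chains X k"
    using sub by (intro span_minimal subspace_chains)
  ultimately have "?W = chains X k" by blast
  then have "length (b @ map t h @ vs) = card (cells_of_dim X k)"
    using length_eq_dim [OF lin] dim_chains [of X k] by simp
  also have "\<dots> = length cs"
    using cs by (metis cell_ordering_def distinct_card)
  finally show len: "length (b @ map t h @ vs) = length cs" .
  show "(Determinant.det (coordinate_matrix (b @ map t h @ vs) cs))\<^sup>2 = gram b * eta_const X k * gram u"
    using square_det_coordinate_matrix [OF sub cs len] gram by simp
qed

end

section \<open>The torsion as an alternating product\<close>

lemma powi_alternating_sign:
  fixes x y :: real
  shows "((x * y) powi ((-1) ^ k)) = (x powi ((-1) ^ k)) * (y powi ((-1) ^ k))"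
    "(x powi ((-1) ^ k))\<^sup>2 = (x\<^sup>2) powi ((-1) ^ k)"
  by (cases "even k"; simp add: power_int_minus power_inverse)+

lemma alternating_telescope:
  fixes \<nu> :: "nat \<Rightarrow> real"
  assumes "\<And>k. \<nu> k \<noteq> 0" "\<nu> 0 = 1"
  shows "(\<Prod>k<n. (\<nu> k * \<nu> (Suc k)) powi ((-1) ^ k)) = \<nu> n powi (- ((-1) ^ n))"
proof (induction n)
  case 0
  then show ?case using assms(2) by simp
next
  case (Suc n)
  show ?case
    using assms(1) [of n] by (cases "even n") (simp_all add: Suc power_int_minus field_simps)
qed

context chain_complex begin

lemma exists_torsion_choices:
  "\<exists>b s t cs. \<forall>k. boundary_basis X k (b k) \<and> boundary_splitting X k (s k) \<and>
    homology_splitting X k (t k) \<and> cell_ordering X k (cs k)"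
proof -
  have "\<exists>b s t cs. boundary_basis X k b \<and> boundary_splitting X k s \<and> homology_splitting X k t \<and> cell_ordering X k cs" for k
  proof -
    obtain B :: "(real ^ 'c) set" where B: "B \<subseteq> boundaries X k" "independent B" "boundaries X k \<subseteq> span B"
      using maximal_independent_subset [of "boundaries X k :: (real ^ 'c) set"] by metis
    then have finB: "finite B" by (simp add: independent_imp_finite)
    have "span B = boundaries X k"
      using B span_minimal [OF B(1) subspace_boundaries] by blast
    then have b: "boundary_basis X k (enum B)"
      using B(2) enum [OF finB] by (simp add: boundary_basis_def)
    obtain g :: "real ^ 'c \<Rightarrow> real ^ 'c" where g: "g ` UNIV \<subseteq> chains X (Suc k)" "linear g" "\<forall>v\<in>bdry X ` chains X (Suc k). bdry X (g v) = v"
      using linear_exists_right_inverse_on [OF linear_bdry [of X] subspace_chains [of X "Suc k"]] by blast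
    then have s: "boundary_splitting X k g"
      by (auto simp: boundary_splitting_def linear_on_def linear_add linear_scale boundaries_def)
    have t: "homology_splitting X k (harmonic_rep X k)"
      using harmonic_rep_in_class linear_add [OF harmonic_linear] linear_scale [OF harmonic_linear]
      by (auto simp: homology_splitting_def linear_on_def simp flip: harmonic_def)
    have "cell_ordering X k (enum (cells_of_dim X k))"
      by (simp add: cell_ordering_def enum)
    with b s t show ?thesis by blast
  qed
  then show ?thesis by metis
qed

text \<open>With \<open>\<nu>\<^sub>k\<close> the Gram determinant of the orthogonal part in degree \<open>k\<close>, the squared determinant in degree
  \<open>k\<close> is \<open>gram(b\<^sub>k) \<cdot> \<eta>\<^sub>k \<cdot> \<nu>\<^sub>k\<close>, and \<open>gram(b\<^sub>k)\<close> is \<open>\<nu>\<^bsub>k+1\<^esub>\<close> times the column sum. The products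
  \<open>\<nu>\<^sub>k \<cdot> \<nu>\<^bsub>k+1\<^esub>\<close> telescope.\<close>

lemma torsion_of_choices_squared:
  assumes h: "combinatorial_basis X h"
    and choices: "\<And>k. boundary_basis X k (b k) \<and> boundary_splitting X k (s k) \<and>
      homology_splitting X k (t k) \<and> cell_ordering X k (cs k)"
  shows "(torsion_of_choices b h s t cs)\<^sup>2 = prodinf (\<lambda>k. (eta_const X k * column_sum k) powi ((-1) ^ k))"
proof -
  have hk: "Z_basis ((homology_real X k)\<lparr>carrier := homology_lattice X k\<rparr>) (h k)" for k
    using h by (simp add: combinatorial_basis_def)
  have bk: "boundary_basis X k (b k)" and sk: "boundary_splitting X k (s k)"
    and tk: "homology_splitting X k (t k)" and ck: "cell_ordering X k (cs k)" for k
    using choices by auto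
  have "\<exists>u. length u = length (b k) \<and> (\<forall>j<length (b k). map (s k) (b k) ! j - u ! j \<in> cycles X (Suc k)) \<and>
    (\<forall>j<length (b k). \<forall>z\<in>cycles X (Suc k). inner z (u ! j) = 0) \<and> lin_indep u \<and>
    chains X (Suc k) \<subseteq> span (cycles X (Suc k) \<union> set (map (s k) (b k))) \<and> column_sum k * gram u = gram (b k)" for k
    by (rule orthogonal_splitting [OF bk sk, of k]) blast
  then obtain U where U: "\<And>k. length (U k) = length (b k)"
    "\<And>k j. j < length (b k) \<Longrightarrow> map (s k) (b k) ! j - U k ! j \<in> cycles X (Suc k)"
    "\<And>k j z. j < length (b k) \<Longrightarrow> z \<in> cycles X (Suc k) \<Longrightarrow> inner z (U k ! j) = 0"
    "\<And>k. lin_indep (U k)" "\<And>k. chains X (Suc k) \<subseteq> span (cycles X (Suc k) \<union> set (map (s k) (b k)))"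
    "\<And>k. column_sum k * gram (U k) = gram (b k)"
    by metis
  \<comment> \<open>The lifts of \<open>b\<^bsub>k-1\<^esub>\<close> live in degree \<open>k\<close>, so indices shift by one and degree \<open>0\<close> has none.\<close>
  define vs where "vs k = (case k of 0 \<Rightarrow> [] | Suc j \<Rightarrow> map (s j) (b j))" for k
  define W where "W k = (case k of 0 \<Rightarrow> [] | Suc j \<Rightarrow> U j)" for k
  define d where "d k = Determinant.det (coordinate_matrix (combined_basis b h s t k) (cs k))" for k
  have comb: "combined_basis b h s t k = b k @ map (t k) (h k) @ vs k" for k
    by (simp add: combined_basis_def vs_def)
  have lenW: "length (W k) = length (vs k)" for k
    by (cases k) (simp_all add: W_def vs_def U(1))
  have liW: "lin_indep (W k)" for k
    using U(4) by (cases k) (simp_all add: W_def lin_indep_def)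
  have vsC: "set (vs k) \<subseteq> chains X k" for k
  proof (cases k)
    case (Suc j)
    have "s j x \<in> chains X (Suc j)" if "x \<in> set (b j)" for x
    proof -
      have "x \<in> boundaries X j"
        using bk [of j] that span_base [of x "set (b j)"] by (simp add: boundary_basis_def)
      then show ?thesis using sk [of j] by (simp add: boundary_splitting_def)
    qed
    then show ?thesis by (auto simp: vs_def Suc)
  qed (simp add: vs_def)
  have vsW: "vs k ! j - W k ! j \<in> cycles X k" "\<And>z. z \<in> cycles X k \<Longrightarrow> inner z (W k ! j) = 0"
    if "j < length (vs k)" for k j
    using that U(2,3) by (cases k; simp add: vs_def W_def)+
  have vsspan: "chains X k \<subseteq> span (cycles X k \<union> set (vs k))" for k
  proof (cases k)
    case 0
    have "cycles X 0 = (chains X 0 :: (real ^ 'c) set)" by (rule cycles_0)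
    with 0 show ?thesis by (auto simp: vs_def intro: span_base)
  next
    case (Suc j)
    then show ?thesis using U(5) by (simp add: vs_def)
  qed
  have d2: "(d k)\<^sup>2 = gram (b k) * eta_const X k * gram (W k)"
    and len: "length (b k @ map (t k) (h k) @ vs k) = length (cs k)" for k
    unfolding d_def comb using torsion_factor [OF hk bk tk ck vsC vsspan lenW vsW liW] by blast+
  \<comment> \<open>From degree \<open>N\<close> on there are no cells, all lists are empty and all factors are \<open>1\<close>.\<close>
  obtain N where N: "\<And>c. c \<in> cells X \<Longrightarrow> cell_dim X c < N"
    using finite_nat_set_iff_bounded [of "cell_dim X ` cells X"] finite_cells by auto
  have cs0: "cs k = []" if "N \<le> k" for k
  proof -
    have "cells_of_dim X k = {}" using N that by (fastforce simp: cells_of_dim_def)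
    then show ?thesis using ck [of k] by (simp add: cell_ordering_def)
  qed
  have empty: "b k = []" "vs k = []" "W k = []" "U k = []" if "N \<le> k" for k
    using len [of k] cs0 [OF that] lenW [of k] U(1) [of k] by simp_all
  have d1: "d k = 1" if "N \<le> k" for k
    unfolding d_def coordinate_matrix_def comb using len [of k] cs0 [OF that]
    by (intro det_dim_zero) simp
  have col1: "column_sum k = 1" if "N \<le> k" for k
    using U(6) [of k] empty [OF that] by simp
  have eta1: "eta_const X k = 1" if "N \<le> k" for k
    using d2 [of k] d1 [OF that] empty [OF that] by simp
  define \<nu> where "\<nu> k = gram (W k)" for k
  have \<nu>: "\<nu> k \<noteq> 0" "\<nu> 0 = 1" "\<nu> N = 1" for k
    using liW [of k] empty(3) [of N] by (simp_all add: \<nu>_def gram_eq_0_iff W_def)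
  have fac: "(d k)\<^sup>2 = (eta_const X k * column_sum k) * (\<nu> k * \<nu> (Suc k))" for k
    unfolding d2 U(6) [symmetric] by (simp add: \<nu>_def W_def)
  have "torsion_of_choices b h s t cs = (\<Prod>k<N. d k powi ((-1) ^ k))"
    unfolding torsion_of_choices_def d_def [symmetric] using d1 by (intro prodinf_finite) auto
  then have "(torsion_of_choices b h s t cs)\<^sup>2 = (\<Prod>k<N. (d k)\<^sup>2 powi ((-1) ^ k))"
    by (simp add: prod_power_distrib powi_alternating_sign)
  also have "\<dots> = (\<Prod>k<N. (eta_const X k * column_sum k) powi ((-1) ^ k)) * (\<Prod>k<N. (\<nu> k * \<nu> (Suc k)) powi ((-1) ^ k))"
    unfolding fac by (subst powi_alternating_sign) (rule prod.distrib)
  also have "(\<Prod>k<N. (\<nu> k * \<nu> (Suc k)) powi ((-1) ^ k)) = 1"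
    using alternating_telescope [of \<nu> N] \<nu> by simp
  also have "(\<Prod>k<N. (eta_const X k * column_sum k) powi ((-1) ^ k)) = prodinf (\<lambda>k. (eta_const X k * column_sum k) powi ((-1) ^ k))"
    using col1 eta1 by (intro prodinf_finite [symmetric]) auto
  finally show ?thesis by simp
qed

text \<open>The right-hand side does not involve the choices, so the square of the torsion is well defined.\<close>

lemma torsion_squared_eq:
  assumes "combinatorial_basis X h"
  shows "torsion_squared X h = prodinf (\<lambda>k. (eta_const X k * column_sum k) powi ((-1) ^ k))"
  unfolding torsion_squared_def
proof (rule the_equality)
  obtain b s t cs where choices: "\<forall>k. boundary_basis X k (b k) \<and> boundary_splitting X k (s k) \<and>
    homology_splitting X k (t k) \<and> cell_ordering X k (cs k)"
    using exists_torsion_choices by blast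
  have "prodinf (\<lambda>k. (eta_const X k * column_sum k) powi ((-1) ^ k)) = (torsion_of_choices b h s t cs)\<^sup>2"
    by (rule torsion_of_choices_squared [OF assms choices [THEN spec], symmetric])
  with choices show "\<exists>b s t cs. (\<forall>k. boundary_basis X k (b k) \<and> boundary_splitting X k (s k) \<and>
      homology_splitting X k (t k) \<and> cell_ordering X k (cs k)) \<and>
    prodinf (\<lambda>k. (eta_const X k * column_sum k) powi ((-1) ^ k)) = (torsion_of_choices b h s t cs)\<^sup>2"
    by (intro exI conjI)
next
  fix r
  assume "\<exists>b s t cs. (\<forall>k. boundary_basis X k (b k) \<and> boundary_splitting X k (s k) \<and>
      homology_splitting X k (t k) \<and> cell_ordering X k (cs k)) \<and>
    r = (torsion_of_choices b h s t cs)\<^sup>2"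
  then obtain b s t cs where choices: "\<forall>k. boundary_basis X k (b k) \<and> boundary_splitting X k (s k) \<and>
      homology_splitting X k (t k) \<and> cell_ordering X k (cs k)"
    and r: "r = (torsion_of_choices b h s t cs)\<^sup>2"
    by (elim exE conjE)
  show "r = prodinf (\<lambda>k. (eta_const X k * column_sum k) powi ((-1) ^ k))"
    unfolding r by (rule torsion_of_choices_squared [OF assms choices [THEN spec]])
qed

end

theorem theorem6:
  fixes X :: "('a, 'c::finite) cell_complex"
    and h :: "nat \<Rightarrow> (real ^ 'c) set list"
  assumes "finite_CW_complex X"
    and "connected_space (underlying X)"
    and "combinatorial_basis X h"
  shows "torsion_squared X h =
    prodinf (\<lambda>k. (delta_const X k * (\<Sum>T\<in>spanning_trees X (Suc k). (real (torsion_order T k))\<^sup>2))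
             powi ((-1) ^ k))"
proof -
  interpret chain_complex X
    by (rule chain_complex.intro [OF cell_structure_of_finite_CW_complex [OF assms(1)]])
  show ?thesis
    by (simp only: torsion_squared_eq [OF assms(3)] spanning_tree_sum)
qed

end
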